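(* Let $R$ be a unital ring and let $\mathcal{B}$ be an additive full subcategory of the category of finitely presented left $R$-modules. Assume that $R$ (as a left $R$-module) is in $\varinjlim\mathcal{B}$ and that $R$ is $\mathcal{B}$-coherent. If a left $R$-module $F$ is in $\varinjlim\mathcal{B}$, then its pure injective envelope $PE(F)$ and the quotient $PE(F)/F$ are in $\varinjlim\mathcal{B}$.
   Context: $\varinjlim\mathcal{B}$ is the class of left $R$-modules that are filtered colimits of modules from $\mathcal{B}$. $R$ is called $\mathcal{B}$-coherent if $\varinjlim\mathcal{B}$ is closed under products in the category of left $R$-modules. *)

theory Defs
  imports Complex_Main "HOL-Algebra.Module" "HOL-Algebra.QuotRing"
begin

section \<open>Left modules over a not necessarily commutative ring\<close>

text \<open>
  The library locale \<^locale>\<open>module\<close> asks for a commutative ring.  The record type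
  \<^typ>\<open>('a, 'b) module\<close> and the locale \<^locale>\<open>submodule\<close> do not, and are reused.  The fields
  \<open>mult\<close> and \<open>one\<close> of a module record carry no meaning.
\<close>

locale left_module = R?: ring R + M?: abelian_group M
  for R :: "('r, 'x) ring_scheme" (structure) and M :: "('r, 'm) module" (structure) +
  assumes smult_closed [simp, intro]:
      "\<lbrakk>a \<in> carrier R; x \<in> carrier M\<rbrakk> \<Longrightarrow> a \<odot>\<^bsub>M\<^esub> x \<in> carrier M"
    and smult_l_distr:
      "\<lbrakk>a \<in> carrier R; b \<in> carrier R; x \<in> carrier M\<rbrakk> \<Longrightarrow>
        (a \<oplus> b) \<odot>\<^bsub>M\<^esub> x = a \<odot>\<^bsub>M\<^esub> x \<oplus>\<^bsub>M\<^esub> b \<odot>\<^bsub>M\<^esub> x"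
    and smult_r_distr:
      "\<lbrakk>a \<in> carrier R; x \<in> carrier M; y \<in> carrier M\<rbrakk> \<Longrightarrow>
        a \<odot>\<^bsub>M\<^esub> (x \<oplus>\<^bsub>M\<^esub> y) = a \<odot>\<^bsub>M\<^esub> x \<oplus>\<^bsub>M\<^esub> a \<odot>\<^bsub>M\<^esub> y"
    and smult_assoc1:
      "\<lbrakk>a \<in> carrier R; b \<in> carrier R; x \<in> carrier M\<rbrakk> \<Longrightarrow>
        (a \<otimes> b) \<odot>\<^bsub>M\<^esub> x = a \<odot>\<^bsub>M\<^esub> (b \<odot>\<^bsub>M\<^esub> x)"
    and smult_one [simp]:
      "x \<in> carrier M \<Longrightarrow> \<one> \<odot>\<^bsub>M\<^esub> x = x"

definition lmod_hom ::
  "('r, 'x) ring_scheme \<Rightarrow> ('r, 'm) module \<Rightarrow> ('r, 'n) module \<Rightarrow> ('m \<Rightarrow> 'n) set" where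
  "lmod_hom R M N = {f \<in> carrier M \<rightarrow> carrier N.
     (\<forall>x\<in>carrier M. \<forall>y\<in>carrier M. f (x \<oplus>\<^bsub>M\<^esub> y) = f x \<oplus>\<^bsub>N\<^esub> f y) \<and>
     (\<forall>r\<in>carrier R. \<forall>x\<in>carrier M. f (r \<odot>\<^bsub>M\<^esub> x) = r \<odot>\<^bsub>N\<^esub> f x)}"

definition regular_module :: "('r, 'x) ring_scheme \<Rightarrow> ('r, 'r) module" where
  "regular_module R = \<lparr>carrier = carrier R, mult = (\<otimes>\<^bsub>R\<^esub>), one = \<one>\<^bsub>R\<^esub>,
     zero = \<zero>\<^bsub>R\<^esub>, add = (\<oplus>\<^bsub>R\<^esub>), smult = (\<otimes>\<^bsub>R\<^esub>)\<rparr>"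

definition prod_module :: "'i set \<Rightarrow> ('i \<Rightarrow> ('r, 'm) module) \<Rightarrow> ('r, 'i \<Rightarrow> 'm) module" where
  "prod_module I M = \<lparr>carrier = (\<Pi>\<^sub>E i\<in>I. carrier (M i)),
     mult = (\<lambda>x y. \<lambda>i\<in>I. x i \<otimes>\<^bsub>M i\<^esub> y i),
     one = (\<lambda>i\<in>I. \<one>\<^bsub>M i\<^esub>),
     zero = (\<lambda>i\<in>I. \<zero>\<^bsub>M i\<^esub>),
     add = (\<lambda>x y. \<lambda>i\<in>I. x i \<oplus>\<^bsub>M i\<^esub> y i),
     smult = (\<lambda>r x. \<lambda>i\<in>I. r \<odot>\<^bsub>M i\<^esub> x i)\<rparr>"

definition quotient_module :: "('r, 'm) module \<Rightarrow> 'm set \<Rightarrow> ('r, 'm set) module" where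
  "quotient_module M H = \<lparr>carrier = a_rcosets\<^bsub>M\<^esub> H,
     mult = rcoset_mult M H,
     one = H +>\<^bsub>M\<^esub> \<one>\<^bsub>M\<^esub>,
     zero = H,
     add = set_add M,
     smult = (\<lambda>r X. \<Union>x\<in>X. H +>\<^bsub>M\<^esub> (r \<odot>\<^bsub>M\<^esub> x))\<rparr>"


section \<open>Finitely presented modules and additive full subcategories\<close>

definition free_module :: "('r, 'x) ring_scheme \<Rightarrow> nat \<Rightarrow> ('r, nat \<Rightarrow> 'r) module" where
  "free_module R n = prod_module {..<n} (\<lambda>_. regular_module R)"

definition submodule_span :: "('r, 'x) ring_scheme \<Rightarrow> ('r, 'm) module \<Rightarrow> 'm set \<Rightarrow> 'm set" where
  "submodule_span R M S = \<Inter>{H. submodule H R M \<and> S \<subseteq> H}"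

definition finitely_presented :: "('r, 'x) ring_scheme \<Rightarrow> ('r, 'm) module \<Rightarrow> bool" where
  "finitely_presented R M \<longleftrightarrow> left_module R M \<and>
     (\<exists>n p S. p \<in> lmod_hom R (free_module R n) M \<and>
        p ` carrier (free_module R n) = carrier M \<and>
        finite S \<and> S \<subseteq> carrier (free_module R n) \<and>
        a_kernel (free_module R n) M p = submodule_span R (free_module R n) S)"

text \<open>
  A full subcategory is given by its set of objects.  Every finitely presented module is
  isomorphic to one carried by any sufficiently large type, and \<open>'b\<close> below is arbitrary, so
  restricting the objects to one carrier type is harmless.
\<close>

definition is_biproduct :: "('r, 'x) ring_scheme \<Rightarrow>
  ('r, 'a) module \<Rightarrow> ('r, 'b) module \<Rightarrow> ('r, 'c) module \<Rightarrow> bool" where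
  "is_biproduct R X Y Z \<longleftrightarrow>
     (\<exists>i\<in>lmod_hom R X Z. \<exists>j\<in>lmod_hom R Y Z. \<exists>p\<in>lmod_hom R Z X. \<exists>q\<in>lmod_hom R Z Y.
        (\<forall>x\<in>carrier X. p (i x) = x \<and> q (i x) = \<zero>\<^bsub>Y\<^esub>) \<and>
        (\<forall>y\<in>carrier Y. p (j y) = \<zero>\<^bsub>X\<^esub> \<and> q (j y) = y) \<and>
        (\<forall>z\<in>carrier Z. i (p z) \<oplus>\<^bsub>Z\<^esub> j (q z) = z))"

definition additive_fp_subcategory ::
  "('r, 'x) ring_scheme \<Rightarrow> ('r, 'b) module set \<Rightarrow> bool" where
  "additive_fp_subcategory R B \<longleftrightarrow>
     (\<forall>X\<in>B. finitely_presented R X) \<and>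
     (\<exists>X\<in>B. carrier X = {\<zero>\<^bsub>X\<^esub>}) \<and>
     (\<forall>X\<in>B. \<forall>Y\<in>B. \<exists>Z\<in>B. is_biproduct R X Y Z)"


section \<open>Filtered colimits\<close>

text \<open>
  \<open>Cmp i j k v u\<close> is the composite of \<open>u : i \<rightarrow> j\<close> followed by \<open>v : j \<rightarrow> k\<close>.  Composition and
  diagrams know the endpoints of arrows, so hom-sets need not be disjoint.
\<close>

record ('o, 'a) small_cat =
  Obj :: "'o set"
  Arr :: "'o \<Rightarrow> 'o \<Rightarrow> 'a set"
  Idt :: "'o \<Rightarrow> 'a"
  Cmp :: "'o \<Rightarrow> 'o \<Rightarrow> 'o \<Rightarrow> 'a \<Rightarrow> 'a \<Rightarrow> 'a"

locale small_category =
  fixes J :: "('o, 'a) small_cat"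
  assumes Idt_in: "i \<in> Obj J \<Longrightarrow> Idt J i \<in> Arr J i i"
    and Cmp_in: "\<lbrakk>i \<in> Obj J; j \<in> Obj J; k \<in> Obj J; u \<in> Arr J i j; v \<in> Arr J j k\<rbrakk> \<Longrightarrow>
      Cmp J i j k v u \<in> Arr J i k"
    and Cmp_Idt: "\<lbrakk>i \<in> Obj J; j \<in> Obj J; u \<in> Arr J i j\<rbrakk> \<Longrightarrow> Cmp J i i j u (Idt J i) = u"
    and Idt_Cmp: "\<lbrakk>i \<in> Obj J; j \<in> Obj J; u \<in> Arr J i j\<rbrakk> \<Longrightarrow> Cmp J i j j (Idt J j) u = u"
    and Cmp_assoc: "\<lbrakk>i \<in> Obj J; j \<in> Obj J; k \<in> Obj J; l \<in> Obj J;
        u \<in> Arr J i j; v \<in> Arr J j k; w \<in> Arr J k l\<rbrakk> \<Longrightarrow>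
      Cmp J i k l w (Cmp J i j k v u) = Cmp J i j l (Cmp J j k l w v) u"

locale filtered_category = small_category J for J :: "('o, 'a) small_cat" +
  assumes Obj_nonempty: "Obj J \<noteq> {}"
    and upper: "\<lbrakk>i \<in> Obj J; j \<in> Obj J\<rbrakk> \<Longrightarrow> \<exists>k\<in>Obj J. Arr J i k \<noteq> {} \<and> Arr J j k \<noteq> {}"
    and equalize: "\<lbrakk>i \<in> Obj J; j \<in> Obj J; u \<in> Arr J i j; v \<in> Arr J i j\<rbrakk> \<Longrightarrow>
      \<exists>k\<in>Obj J. \<exists>w\<in>Arr J j k. Cmp J i j k w u = Cmp J i j k w v"

text \<open>Functors from \<open>J\<close> to the full subcategory of left modules with set of objects \<open>B\<close>.\<close>

definition is_diagram :: "('r, 'x) ring_scheme \<Rightarrow> ('r, 'b) module set \<Rightarrow> ('o, 'a) small_cat \<Rightarrow>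
  ('o \<Rightarrow> ('r, 'b) module) \<Rightarrow> ('o \<Rightarrow> 'o \<Rightarrow> 'a \<Rightarrow> 'b \<Rightarrow> 'b) \<Rightarrow> bool" where
  "is_diagram R B J D d \<longleftrightarrow>
     (\<forall>i\<in>Obj J. D i \<in> B) \<and>
     (\<forall>i\<in>Obj J. \<forall>j\<in>Obj J. \<forall>u\<in>Arr J i j. d i j u \<in> lmod_hom R (D i) (D j)) \<and>
     (\<forall>i\<in>Obj J. \<forall>x\<in>carrier (D i). d i i (Idt J i) x = x) \<and>
     (\<forall>i\<in>Obj J. \<forall>j\<in>Obj J. \<forall>k\<in>Obj J. \<forall>u\<in>Arr J i j. \<forall>v\<in>Arr J j k. \<forall>x\<in>carrier (D i).
        d i k (Cmp J i j k v u) x = d j k v (d i j u x))"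

definition is_cocone :: "('r, 'x) ring_scheme \<Rightarrow> ('o, 'a) small_cat \<Rightarrow>
  ('o \<Rightarrow> ('r, 'b) module) \<Rightarrow> ('o \<Rightarrow> 'o \<Rightarrow> 'a \<Rightarrow> 'b \<Rightarrow> 'b) \<Rightarrow>
  ('r, 't) module \<Rightarrow> ('o \<Rightarrow> 'b \<Rightarrow> 't) \<Rightarrow> bool" where
  "is_cocone R J D d T t \<longleftrightarrow> left_module R T \<and>
     (\<forall>i\<in>Obj J. t i \<in> lmod_hom R (D i) T) \<and>
     (\<forall>i\<in>Obj J. \<forall>j\<in>Obj J. \<forall>u\<in>Arr J i j. \<forall>x\<in>carrier (D i). t j (d i j u x) = t i x)"

definition unique_factorization :: "('r, 'x) ring_scheme \<Rightarrow> ('o, 'a) small_cat \<Rightarrow>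
  ('o \<Rightarrow> ('r, 'b) module) \<Rightarrow> ('r, 'm) module \<Rightarrow> ('o \<Rightarrow> 'b \<Rightarrow> 'm) \<Rightarrow>
  ('r, 't) module \<Rightarrow> ('o \<Rightarrow> 'b \<Rightarrow> 't) \<Rightarrow> bool" where
  "unique_factorization R J D M c T t \<longleftrightarrow>
     (\<exists>h\<in>lmod_hom R M T. \<forall>i\<in>Obj J. \<forall>x\<in>carrier (D i). h (c i x) = t i x) \<and>
     (\<forall>h\<in>lmod_hom R M T. \<forall>h'\<in>lmod_hom R M T.
        (\<forall>i\<in>Obj J. \<forall>x\<in>carrier (D i). h (c i x) = t i x) \<longrightarrow>
        (\<forall>i\<in>Obj J. \<forall>x\<in>carrier (D i). h' (c i x) = t i x) \<longrightarrow>
        (\<forall>y\<in>carrier M. h y = h' y))"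

text \<open>
  A universal property cannot quantify over modules of all types.  The type of test objects below
  is large enough to hold a copy of \<open>M\<close> and the standard construction of a filtered colimit;
  the lemma \<open>is_colimit_universal\<close> below shows that the universal property then holds for test
  objects of every type.
\<close>

definition is_colimit :: "('r, 'x) ring_scheme \<Rightarrow> ('o, 'a) small_cat \<Rightarrow>
  ('o \<Rightarrow> ('r, 'b) module) \<Rightarrow> ('o \<Rightarrow> 'o \<Rightarrow> 'a \<Rightarrow> 'b \<Rightarrow> 'b) \<Rightarrow>
  ('r, 'm) module \<Rightarrow> ('o \<Rightarrow> 'b \<Rightarrow> 'm) \<Rightarrow> bool" where
  "is_colimit R J D d M c \<longleftrightarrow> is_cocone R J D d M c \<and>
     (\<forall>(T :: ('r, ('m + 'o \<times> 'b) set) module) t.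
        is_cocone R J D d T t \<longrightarrow> unique_factorization R J D M c T t)"

text \<open>
  The types of objects and arrows of the index category are those of the category of pairs
  \<open>(X, f)\<close> with \<open>X \<in> B\<close> and \<open>f : X \<rightarrow> M\<close>.  This is no restriction: the lemma
  \<open>lim_classI\<close> below shows that a filtered colimit over index categories of any other types is
  also in the class.
\<close>

definition lim_class ::
  "('r, 'x) ring_scheme \<Rightarrow> ('r, 'b) module set \<Rightarrow> ('r, 'm) module set" where
  "lim_class R B = {M.
     \<exists>(J :: (('r, 'b) module \<times> ('b \<Rightarrow> 'm), 'b \<Rightarrow> 'b) small_cat) D d c.
       filtered_category J \<and> is_diagram R B J D d \<and> is_colimit R J D d M c}"

text \<open>
  Closure under products, with bounds on the types of the index set and of the factors, since a
  definition cannot quantify over types.  Closure under all products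
  implies this instance, so as a hypothesis it is not stronger than the unrestricted one.
  It is not really weaker either.  Let \<open>A\<close> be a finitely presented module with \<open>n\<close> generators.
  A homomorphism from \<open>A\<close> to a member \<open>X\<close> of \<open>B\<close> is given by an \<open>n\<close>-tuple in \<open>X\<close>, so the
  product over all such homomorphisms is covered; factoring the
  canonical map from \<open>A\<close> to it through \<open>B\<close> gives a left \<open>B\<close>-approximation of \<open>A\<close>.
  If all finitely presented modules have one, the class is closed under arbitrary products.
\<close>

definition B_coherent :: "('r, 'x) ring_scheme \<Rightarrow> ('r, 'b) module set \<Rightarrow> bool" where
  "B_coherent R B \<longleftrightarrow>
     (\<forall>(I :: (('r, 'b) module \<times> 'b list) set) (M :: _ \<Rightarrow> ('r, 'b) module).
        (\<forall>i\<in>I. M i \<in> lim_class R B) \<longrightarrow> prod_module I M \<in> lim_class R B)"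


section \<open>Purity\<close>

text \<open>
  A finite system of linear equations with constants in \<open>A\<close> that is solvable in \<open>C\<close> is
  solvable in \<open>A\<close>.
\<close>

definition pure_mono :: "('r, 'x) ring_scheme \<Rightarrow>
  ('r, 'a) module \<Rightarrow> ('r, 'c) module \<Rightarrow> ('a \<Rightarrow> 'c) \<Rightarrow> bool" where
  "pure_mono R A C f \<longleftrightarrow> f \<in> lmod_hom R A C \<and> inj_on f (carrier A) \<and>
     (\<forall>(m::nat) (n::nat) r a x.
        (\<forall>k<m. \<forall>l<n. r k l \<in> carrier R) \<longrightarrow>
        (\<forall>k<m. a k \<in> carrier A) \<longrightarrow>
        (\<forall>l<n. x l \<in> carrier C) \<longrightarrow>
        (\<forall>k<m. (\<Oplus>\<^bsub>C\<^esub>l\<in>{..<n}. r k l \<odot>\<^bsub>C\<^esub> x l) = f (a k)) \<longrightarrow>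
        (\<exists>y. (\<forall>l<n. y l \<in> carrier A) \<and>
          (\<forall>k<m. (\<Oplus>\<^bsub>A\<^esub>l\<in>{..<n}. r k l \<odot>\<^bsub>A\<^esub> y l) = a k)))"

text \<open>
  Injectivity with respect to pure monomorphisms.  The types of the test modules suffice:
  the double character module of \<open>P\<close> (characters with values in the complex unit circle) lives
  on \<open>('p \<Rightarrow> complex) \<Rightarrow> complex\<close>, is pure injective, and contains \<open>P\<close> as a pure submodule, so
  extending the identity of \<open>P\<close> makes \<open>P\<close> a direct summand of a pure injective module.
\<close>

definition pure_injective :: "('r, 'x) ring_scheme \<Rightarrow> ('r, 'p) module \<Rightarrow> bool" where
  "pure_injective R P \<longleftrightarrow> left_module R P \<and>
     (\<forall>(A :: ('r, 'p) module) (C :: ('r, ('p \<Rightarrow> complex) \<Rightarrow> complex) module) f g.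
        left_module R A \<longrightarrow> left_module R C \<longrightarrow> pure_mono R A C f \<longrightarrow> g \<in> lmod_hom R A P \<longrightarrow>
        (\<exists>h\<in>lmod_hom R C P. \<forall>x\<in>carrier A. h (f x) = g x))"

text \<open>
  Envelopes with respect to the class of pure injective modules; a homomorphism to a pure
  injective module is a pure monomorphism iff it is a pure injective preenvelope.
\<close>

definition pure_injective_envelope :: "('r, 'x) ring_scheme \<Rightarrow>
  ('r, 'f) module \<Rightarrow> ('r, 'p) module \<Rightarrow> ('f \<Rightarrow> 'p) \<Rightarrow> bool" where
  "pure_injective_envelope R F P e \<longleftrightarrow>
     left_module R F \<and> pure_injective R P \<and> pure_mono R F P e \<and>
     (\<forall>\<phi>\<in>lmod_hom R P P. (\<forall>x\<in>carrier F. \<phi> (e x) = e x) \<longrightarrow>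
        bij_betw \<phi> (carrier P) (carrier P))"


section \<open>Independence of the chosen types\<close>

lemma lmod_homI:
  assumes "\<And>x. x \<in> carrier M \<Longrightarrow> f x \<in> carrier N"
    and "\<And>x y. x \<in> carrier M \<Longrightarrow> y \<in> carrier M \<Longrightarrow> f (x \<oplus>\<^bsub>M\<^esub> y) = f x \<oplus>\<^bsub>N\<^esub> f y"
    and "\<And>r x. r \<in> carrier R \<Longrightarrow> x \<in> carrier M \<Longrightarrow> f (r \<odot>\<^bsub>M\<^esub> x) = r \<odot>\<^bsub>N\<^esub> f x"
  shows "f \<in> lmod_hom R M N"
  using assms by (auto simp: lmod_hom_def)

lemma lmod_homD:
  assumes "f \<in> lmod_hom R M N"
  shows "x \<in> carrier M \<Longrightarrow> f x \<in> carrier N"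
    and "x \<in> carrier M \<Longrightarrow> y \<in> carrier M \<Longrightarrow> f (x \<oplus>\<^bsub>M\<^esub> y) = f x \<oplus>\<^bsub>N\<^esub> f y"
    and "r \<in> carrier R \<Longrightarrow> x \<in> carrier M \<Longrightarrow> f (r \<odot>\<^bsub>M\<^esub> x) = r \<odot>\<^bsub>N\<^esub> f x"
  using assms by (auto simp: lmod_hom_def)

lemma lmod_hom_comp:
  assumes "f \<in> lmod_hom R L M" "g \<in> lmod_hom R M N"
  shows "(\<lambda>x. g (f x)) \<in> lmod_hom R L N"
  by (rule lmod_homI) (simp_all add: lmod_homD[OF assms(1)] lmod_homD[OF assms(2)])

lemma lmod_hom_abelian:
  assumes "left_module R M" "left_module R N" "f \<in> lmod_hom R M N"
  shows "abelian_group_hom M N f"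
proof -
  interpret M: left_module R M by fact
  interpret N: left_module R N by fact
  show ?thesis
    by (intro abelian_group_homI M.abelian_group_axioms N.abelian_group_axioms group_hom.intro
        group_hom_axioms.intro M.a_group N.a_group)
      (auto simp: hom_def lmod_homD[OF assms(3)])
qed

lemma lmod_hom_zero:
  assumes "left_module R M" "left_module R N" "f \<in> lmod_hom R M N"
  shows "f \<zero>\<^bsub>M\<^esub> = \<zero>\<^bsub>N\<^esub>"
  using abelian_group_hom.hom_zero[OF lmod_hom_abelian[OF assms]] .

lemma lmod_hom_a_inv:
  assumes "left_module R M" "left_module R N" "f \<in> lmod_hom R M N" "x \<in> carrier M"
  shows "f (\<ominus>\<^bsub>M\<^esub> x) = \<ominus>\<^bsub>N\<^esub> f x"
  using abelian_group_hom.hom_a_inv[OF lmod_hom_abelian[OF assms(1-3)] assms(4)] .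

lemma (in left_module) smult_zero: "r \<in> carrier R \<Longrightarrow> r \<odot>\<^bsub>M\<^esub> \<zero>\<^bsub>M\<^esub> = \<zero>\<^bsub>M\<^esub>"
  by (metis M.add.r_cancel_one' M.l_zero M.zero_closed smult_closed smult_r_distr)

lemma (in left_module) zero_smult: "x \<in> carrier M \<Longrightarrow> \<zero>\<^bsub>R\<^esub> \<odot>\<^bsub>M\<^esub> x = \<zero>\<^bsub>M\<^esub>"
  by (metis M.add.r_cancel_one' R.l_zero R.zero_closed smult_closed smult_l_distr)

lemma (in left_module) diff_zero_iff:
  assumes "x \<in> carrier M" "y \<in> carrier M"
  shows "x \<oplus>\<^bsub>M\<^esub> \<ominus>\<^bsub>M\<^esub> y = \<zero>\<^bsub>M\<^esub> \<longleftrightarrow> x = y"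
  using assms by (metis M.minus_equality M.minus_minus M.a_inv_closed M.r_neg)

lemma regular_left_module:
  assumes "ring R" shows "left_module R (regular_module R)"
proof -
  interpret ring R by fact
  show ?thesis
    by (intro left_module.intro left_module_axioms.intro assms abelian_groupI)
      (auto simp: regular_module_def l_distr r_distr a_assoc m_assoc a_comm a_lcomm
        intro!: bexI[of _ "\<ominus>\<^bsub>R\<^esub> x" for x] l_neg)
qed

lemma prod_left_module:
  assumes "ring R" "\<And>i. i \<in> I \<Longrightarrow> left_module R (M i)"
  shows "left_module R (prod_module I M)"
proof -
  interpret ring R by fact
  have ag: "abelian_group (M i)" if "i \<in> I" for i
    using assms(2)[OF that] by (rule left_module.axioms)
  note am = abelian_group.axioms(1)[OF ag]
  note cl = abelian_monoid.a_closed[OF am] abelian_monoid.zero_closed[OF am]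
    left_module.smult_closed[OF assms(2)] abelian_group.a_inv_closed[OF ag]
  let ?P = "prod_module I M"
  have el: "x \<in> carrier ?P \<longleftrightarrow> (\<forall>i\<in>I. x i \<in> carrier (M i)) \<and> x \<in> extensional I" for x
    by (auto simp: prod_module_def PiE_iff)
  have ops: "x \<oplus>\<^bsub>?P\<^esub> y = (\<lambda>i\<in>I. x i \<oplus>\<^bsub>M i\<^esub> y i)" "\<zero>\<^bsub>?P\<^esub> = (\<lambda>i\<in>I. \<zero>\<^bsub>M i\<^esub>)"
    "r \<odot>\<^bsub>?P\<^esub> x = (\<lambda>i\<in>I. r \<odot>\<^bsub>M i\<^esub> x i)" for x y r by (simp_all add: prod_module_def)
  show ?thesis
  proof (intro left_module.intro left_module_axioms.intro assms abelian_groupI)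
    fix x assume x: "x \<in> carrier ?P"
    show "\<exists>y\<in>carrier ?P. y \<oplus>\<^bsub>?P\<^esub> x = \<zero>\<^bsub>?P\<^esub>"
      using x by (intro bexI[of _ "\<lambda>i\<in>I. \<ominus>\<^bsub>M i\<^esub> x i"])
        (auto simp: el ops cl abelian_group.l_neg[OF ag] intro!: restrict_ext)
    show "\<zero>\<^bsub>?P\<^esub> \<oplus>\<^bsub>?P\<^esub> x = x"
      using x by (intro extensionalityI[of _ I]) (auto simp: el ops abelian_monoid.l_zero[OF am])
    show "\<one>\<^bsub>R\<^esub> \<odot>\<^bsub>?P\<^esub> x = x"
      using x by (intro extensionalityI[of _ I]) (auto simp: el ops left_module.smult_one[OF assms(2)])
    fix r assume r: "r \<in> carrier R"
    show "r \<odot>\<^bsub>?P\<^esub> x \<in> carrier ?P" using x r by (simp add: el ops cl)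
    fix s assume s: "s \<in> carrier R"
    show "(r \<oplus>\<^bsub>R\<^esub> s) \<odot>\<^bsub>?P\<^esub> x = r \<odot>\<^bsub>?P\<^esub> x \<oplus>\<^bsub>?P\<^esub> s \<odot>\<^bsub>?P\<^esub> x"
      unfolding ops using x r s
      by (intro restrict_ext) (simp add: el left_module.smult_l_distr[OF assms(2)])
    show "(r \<otimes>\<^bsub>R\<^esub> s) \<odot>\<^bsub>?P\<^esub> x = r \<odot>\<^bsub>?P\<^esub> (s \<odot>\<^bsub>?P\<^esub> x)"
      unfolding ops using x r s
      by (intro restrict_ext) (simp add: el left_module.smult_assoc1[OF assms(2)])
  next
    fix x y assume x: "x \<in> carrier ?P" "y \<in> carrier ?P"
    show "x \<oplus>\<^bsub>?P\<^esub> y \<in> carrier ?P" using x by (simp add: el ops cl)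
    show "x \<oplus>\<^bsub>?P\<^esub> y = y \<oplus>\<^bsub>?P\<^esub> x"
      unfolding ops using x by (intro restrict_ext) (simp add: el abelian_monoid.a_comm[OF am])
    fix r assume r: "r \<in> carrier R"
    show "r \<odot>\<^bsub>?P\<^esub> (x \<oplus>\<^bsub>?P\<^esub> y) = r \<odot>\<^bsub>?P\<^esub> x \<oplus>\<^bsub>?P\<^esub> r \<odot>\<^bsub>?P\<^esub> y"
      unfolding ops using x r
      by (intro restrict_ext) (simp add: el left_module.smult_r_distr[OF assms(2)])
  next
    fix x y z assume x: "x \<in> carrier ?P" "y \<in> carrier ?P" "z \<in> carrier ?P"
    show "x \<oplus>\<^bsub>?P\<^esub> y \<oplus>\<^bsub>?P\<^esub> z = x \<oplus>\<^bsub>?P\<^esub> (y \<oplus>\<^bsub>?P\<^esub> z)"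
      unfolding ops using x by (intro restrict_ext) (simp add: el abelian_monoid.a_assoc[OF am])
  next
    show "\<zero>\<^bsub>?P\<^esub> \<in> carrier ?P" by (simp add: el ops cl)
  qed
qed

lemma free_left_module: "ring R \<Longrightarrow> left_module R (free_module R n)"
  unfolding free_module_def by (intro prod_left_module regular_left_module)

definition unit_vec :: "('r, 'x) ring_scheme \<Rightarrow> nat \<Rightarrow> nat \<Rightarrow> nat \<Rightarrow> 'r" where
  "unit_vec R n l = (\<lambda>k\<in>{..<n}. if k = l then \<one>\<^bsub>R\<^esub> else \<zero>\<^bsub>R\<^esub>)"

lemma unit_vec_closed: "ring R \<Longrightarrow> unit_vec R n l \<in> carrier (free_module R n)"
  by (auto simp: free_module_def prod_module_def regular_module_def unit_vec_def
      ring.ring_simprules)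

lemma free_hom_expand:
  assumes N: "left_module R N" and s: "s \<in> lmod_hom R (free_module R n) N"
    and r: "r \<in> carrier (free_module R n)"
  shows "s r = (\<Oplus>\<^bsub>N\<^esub>l\<in>{..<n}. r l \<odot>\<^bsub>N\<^esub> s (unit_vec R n l))"
proof -
  interpret N: left_module R N by fact
  let ?F = "free_module R n"
  have F: "left_module R ?F" by (intro free_left_module N.ring_axioms)
  have sc: "s (unit_vec R n l) \<in> carrier N" for l
    by (intro lmod_homD(1)[OF s] unit_vec_closed N.ring_axioms)
  have "k \<le> n \<Longrightarrow> r \<in> carrier ?F \<Longrightarrow> (\<And>l. k \<le> l \<Longrightarrow> l < n \<Longrightarrow> r l = \<zero>\<^bsub>R\<^esub>) \<Longrightarrow>
    s r = (\<Oplus>\<^bsub>N\<^esub>l\<in>{..<k}. r l \<odot>\<^bsub>N\<^esub> s (unit_vec R n l))" for k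
  proof (induction k arbitrary: r)
    case 0
    have "r = \<zero>\<^bsub>?F\<^esub>"
      using 0 by (auto simp: free_module_def prod_module_def regular_module_def fun_eq_iff
          PiE_def extensional_def)
    then show ?case using lmod_hom_zero[OF F N s] by simp
  next
    case (Suc k)
    have rc: "r l \<in> carrier R" if "l < n" for l
      using Suc.prems(2) that by (auto simp: free_module_def prod_module_def regular_module_def)
    let ?r = "r(k := \<zero>\<^bsub>R\<^esub>)"
    have r': "?r \<in> carrier ?F"
      using Suc.prems by (auto simp: free_module_def prod_module_def regular_module_def
          PiE_def extensional_def)
    have u: "unit_vec R n k \<in> carrier ?F" by (intro unit_vec_closed N.ring_axioms)
    have k: "k < n" using Suc.prems by simp
    have "r = r k \<odot>\<^bsub>?F\<^esub> unit_vec R n k \<oplus>\<^bsub>?F\<^esub> ?r"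
      using Suc.prems(2) rc rc[OF k] by (auto simp: free_module_def prod_module_def regular_module_def
          fun_eq_iff unit_vec_def PiE_def extensional_def)
    then have "s r = s (r k \<odot>\<^bsub>?F\<^esub> unit_vec R n k \<oplus>\<^bsub>?F\<^esub> ?r)" by (rule arg_cong)
    also have "\<dots> = s (r k \<odot>\<^bsub>?F\<^esub> unit_vec R n k) \<oplus>\<^bsub>N\<^esub> s ?r"
      by (rule lmod_homD(2)[OF s left_module.smult_closed[OF F rc[OF k] u] r'])
    also have "s (r k \<odot>\<^bsub>?F\<^esub> unit_vec R n k) = r k \<odot>\<^bsub>N\<^esub> s (unit_vec R n k)"
      by (rule lmod_homD(3)[OF s rc[OF k] u])
    also have "s ?r = (\<Oplus>\<^bsub>N\<^esub>l\<in>{..<k}. ?r l \<odot>\<^bsub>N\<^esub> s (unit_vec R n l))"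
    proof (rule Suc.IH[OF _ r'])
      fix l assume "k \<le> l" "l < n"
      then show "?r l = \<zero>\<^bsub>R\<^esub>" using Suc.prems(3)[of l] by auto
    qed (use k in simp)
    also have "\<dots> = (\<Oplus>\<^bsub>N\<^esub>l\<in>{..<k}. r l \<odot>\<^bsub>N\<^esub> s (unit_vec R n l))"
      using k rc sc by (intro N.add.finprod_cong') auto
    finally show ?case
      using k rc sc by (simp add: lessThan_Suc N.M.finsum_insert)
  qed
  from this[of n] r show ?thesis by simp
qed

lemma free_hom_exists:
  assumes N: "left_module R N" and y: "\<And>l. l < n \<Longrightarrow> y l \<in> carrier N"
  shows "(\<lambda>r. \<Oplus>\<^bsub>N\<^esub>l\<in>{..<n}. r l \<odot>\<^bsub>N\<^esub> y l) \<in> lmod_hom R (free_module R n) N"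
proof -
  interpret N: left_module R N by fact
  have rc: "r l \<in> carrier R" if "l < n" "r \<in> carrier (free_module R n)" for l r
    using that by (auto simp: free_module_def prod_module_def regular_module_def)
  have sm: "(\<Oplus>\<^bsub>N\<^esub>l\<in>{..<m}. a \<odot>\<^bsub>N\<^esub> z l) = a \<odot>\<^bsub>N\<^esub> (\<Oplus>\<^bsub>N\<^esub>l\<in>{..<m}. z l)"
    if "a \<in> carrier R" "\<And>l. l < m \<Longrightarrow> z l \<in> carrier N" for a m and z :: "nat \<Rightarrow> _"
    using that(2)
  proof (induction m)
    case 0 then show ?case by (simp add: that N.smult_zero)
  next
    case (Suc m)
    have z: "z \<in> {..<m} \<rightarrow> carrier N" "z m \<in> carrier N" using Suc.prems by auto
    have "(\<lambda>l. a \<odot>\<^bsub>N\<^esub> z l) \<in> {..<m} \<rightarrow> carrier N" using z that by auto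
    then show ?case using Suc z that
      by (simp add: lessThan_Suc N.M.finsum_insert N.smult_r_distr N.M.finsum_closed)
  qed
  show ?thesis
  proof (rule lmod_homI)
    fix r r' assume r: "r \<in> carrier (free_module R n)" "r' \<in> carrier (free_module R n)"
    have "(\<Oplus>\<^bsub>N\<^esub>l\<in>{..<n}. (r \<oplus>\<^bsub>free_module R n\<^esub> r') l \<odot>\<^bsub>N\<^esub> y l) =
        (\<Oplus>\<^bsub>N\<^esub>l\<in>{..<n}. r l \<odot>\<^bsub>N\<^esub> y l \<oplus>\<^bsub>N\<^esub> r' l \<odot>\<^bsub>N\<^esub> y l)"
      using r y rc by (intro N.add.finprod_cong')
        (auto simp: N.smult_l_distr[symmetric] free_module_def prod_module_def regular_module_def)
    also have "\<dots> = (\<Oplus>\<^bsub>N\<^esub>l\<in>{..<n}. r l \<odot>\<^bsub>N\<^esub> y l) \<oplus>\<^bsub>N\<^esub> (\<Oplus>\<^bsub>N\<^esub>l\<in>{..<n}. r' l \<odot>\<^bsub>N\<^esub> y l)"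
      using r y rc by (intro N.M.finsum_addf) auto
    finally show "(\<Oplus>\<^bsub>N\<^esub>l\<in>{..<n}. (r \<oplus>\<^bsub>free_module R n\<^esub> r') l \<odot>\<^bsub>N\<^esub> y l) =
      (\<Oplus>\<^bsub>N\<^esub>l\<in>{..<n}. r l \<odot>\<^bsub>N\<^esub> y l) \<oplus>\<^bsub>N\<^esub> (\<Oplus>\<^bsub>N\<^esub>l\<in>{..<n}. r' l \<odot>\<^bsub>N\<^esub> y l)" .
  next
    fix a r assume r: "a \<in> carrier R" "r \<in> carrier (free_module R n)"
    have "(\<Oplus>\<^bsub>N\<^esub>l\<in>{..<n}. (a \<odot>\<^bsub>free_module R n\<^esub> r) l \<odot>\<^bsub>N\<^esub> y l) =
        (\<Oplus>\<^bsub>N\<^esub>l\<in>{..<n}. a \<odot>\<^bsub>N\<^esub> (r l \<odot>\<^bsub>N\<^esub> y l))"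
      using r y rc by (intro N.add.finprod_cong')
        (auto simp: N.smult_assoc1[symmetric] free_module_def prod_module_def regular_module_def)
    also have "\<dots> = a \<odot>\<^bsub>N\<^esub> (\<Oplus>\<^bsub>N\<^esub>l\<in>{..<n}. r l \<odot>\<^bsub>N\<^esub> y l)"
      using r y rc by (intro sm) auto
    finally show "(\<Oplus>\<^bsub>N\<^esub>l\<in>{..<n}. (a \<odot>\<^bsub>free_module R n\<^esub> r) l \<odot>\<^bsub>N\<^esub> y l) =
      a \<odot>\<^bsub>N\<^esub> (\<Oplus>\<^bsub>N\<^esub>l\<in>{..<n}. r l \<odot>\<^bsub>N\<^esub> y l)" .
  qed (use y rc in \<open>auto intro!: N.M.finsum_closed\<close>)
qed

lemma free_hom_kernel:
  assumes N: "left_module R N" and s: "s \<in> lmod_hom R (free_module R n) N"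
    and S: "S \<subseteq> carrier (free_module R n)" "\<And>x. x \<in> S \<Longrightarrow> s x = \<zero>\<^bsub>N\<^esub>"
    and x: "x \<in> submodule_span R (free_module R n) S"
  shows "s x = \<zero>\<^bsub>N\<^esub>"
proof -
  interpret N: left_module R N by fact
  let ?F = "free_module R n"
  have F: "left_module R ?F" by (intro free_left_module N.ring_axioms)
  interpret F: left_module R ?F by fact
  let ?H = "{x \<in> carrier ?F. s x = \<zero>\<^bsub>N\<^esub>}"
  have "submodule ?H R ?F"
    by (intro submodule.intro submodule_axioms.intro subgroup.intro)
      (auto simp: lmod_homD[OF s] lmod_hom_zero[OF F N s] N.smult_zero
        lmod_hom_a_inv[OF F N s] a_inv_def[symmetric])
  then have "submodule_span R ?F S \<subseteq> ?H"
    using S by (auto simp: submodule_span_def)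
  then show ?thesis using x by auto
qed

text \<open>The elementwise description of filtered colimits.\<close>

definition explicit_colimit :: "('r, 'x) ring_scheme \<Rightarrow> ('o, 'a) small_cat \<Rightarrow>
  ('o \<Rightarrow> ('r, 'b) module) \<Rightarrow> ('o \<Rightarrow> 'o \<Rightarrow> 'a \<Rightarrow> 'b \<Rightarrow> 'b) \<Rightarrow>
  ('r, 'm) module \<Rightarrow> ('o \<Rightarrow> 'b \<Rightarrow> 'm) \<Rightarrow> bool" where
  "explicit_colimit R J D d M c \<longleftrightarrow> is_cocone R J D d M c \<and>
     (\<forall>y\<in>carrier M. \<exists>i\<in>Obj J. \<exists>x\<in>carrier (D i). c i x = y) \<and>
     (\<forall>i\<in>Obj J. \<forall>x\<in>carrier (D i). c i x = \<zero>\<^bsub>M\<^esub> \<longrightarrow>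
        (\<exists>j\<in>Obj J. \<exists>u\<in>Arr J i j. d i j u x = \<zero>\<^bsub>D j\<^esub>))"

locale filtered_diagram = filtered_category J
  for J :: "('o, 'a) small_cat" +
  fixes R :: "('r, 'x) ring_scheme" and B :: "('r, 'b) module set"
    and D :: "'o \<Rightarrow> ('r, 'b) module" and d :: "'o \<Rightarrow> 'o \<Rightarrow> 'a \<Rightarrow> 'b \<Rightarrow> 'b"
  assumes R: "ring R" and B_mod: "X \<in> B \<Longrightarrow> left_module R X" and diag: "is_diagram R B J D d"
begin

lemma D_in: "i \<in> Obj J \<Longrightarrow> D i \<in> B" using diag by (auto simp: is_diagram_def)
lemma D_mod: "i \<in> Obj J \<Longrightarrow> left_module R (D i)" using D_in B_mod by blast
lemma d_hom: "\<lbrakk>i \<in> Obj J; j \<in> Obj J; u \<in> Arr J i j\<rbrakk> \<Longrightarrow> d i j u \<in> lmod_hom R (D i) (D j)"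
  using diag by (auto simp: is_diagram_def)
lemma d_id: "\<lbrakk>i \<in> Obj J; x \<in> carrier (D i)\<rbrakk> \<Longrightarrow> d i i (Idt J i) x = x"
  using diag by (auto simp: is_diagram_def)
lemma d_cmp: "\<lbrakk>i \<in> Obj J; j \<in> Obj J; k \<in> Obj J; u \<in> Arr J i j; v \<in> Arr J j k; x \<in> carrier (D i)\<rbrakk>
  \<Longrightarrow> d i k (Cmp J i j k v u) x = d j k v (d i j u x)"
  using diag by (auto simp: is_diagram_def)
lemmas d_in = lmod_homD(1)[OF d_hom]
lemmas d_add = lmod_homD(2)[OF d_hom]
lemmas d_smult = lmod_homD(3)[OF d_hom]
lemma d_zero: "\<lbrakk>i \<in> Obj J; j \<in> Obj J; u \<in> Arr J i j\<rbrakk> \<Longrightarrow> d i j u \<zero>\<^bsub>D i\<^esub> = \<zero>\<^bsub>D j\<^esub>"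
  by (intro lmod_hom_zero[OF _ _ d_hom] D_mod)

lemma D_group: "i \<in> Obj J \<Longrightarrow> abelian_group (D i)"
  using D_mod left_module.axioms(2) by blast
lemma D_monoid: "i \<in> Obj J \<Longrightarrow> abelian_monoid (D i)"
  using D_group abelian_group.axioms(1) by blast
lemmas D_closed = abelian_monoid.a_closed[OF D_monoid] abelian_monoid.zero_closed[OF D_monoid]
  left_module.smult_closed[OF D_mod] abelian_group.a_inv_closed[OF D_group]

definition rel :: "'o \<Rightarrow> 'b \<Rightarrow> 'o \<Rightarrow> 'b \<Rightarrow> bool" where
  "rel i x j y \<longleftrightarrow> (\<exists>k\<in>Obj J. \<exists>u\<in>Arr J i k. \<exists>v\<in>Arr J j k. d i k u x = d j k v y)"

lemma rel_same:
  assumes "i \<in> Obj J" "x \<in> carrier (D i)" "y \<in> carrier (D i)" "rel i x i y"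
  shows "\<exists>k\<in>Obj J. \<exists>u\<in>Arr J i k. d i k u x = d i k u y"
proof -
  obtain k u v where k: "k \<in> Obj J" "u \<in> Arr J i k" "v \<in> Arr J i k" "d i k u x = d i k v y"
    using assms(4) by (auto simp: rel_def)
  obtain l w where l: "l \<in> Obj J" "w \<in> Arr J k l" "Cmp J i k l w u = Cmp J i k l w v"
    using equalize[OF assms(1) k(1-3)] by blast
  have "d i l (Cmp J i k l w u) x = d i l (Cmp J i k l w u) y"
    using assms k l by (metis d_cmp)
  then show ?thesis using l k assms Cmp_in by blast
qed

lemma rel_d: 
  assumes "i \<in> Obj J" "j \<in> Obj J" "u \<in> Arr J i j" "x \<in> carrier (D i)"
  shows "rel i x j (d i j u x)"
  unfolding rel_def using assms Idt_in d_id d_in by (metis (no_types))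

lemma rel_refl: "\<lbrakk>i \<in> Obj J; x \<in> carrier (D i)\<rbrakk> \<Longrightarrow> rel i x i x"
  unfolding rel_def using Idt_in by blast

lemma rel_sym: "rel i x j y \<Longrightarrow> rel j y i x"
  unfolding rel_def by metis

lemma rel_trans:
  assumes ij: "i \<in> Obj J" "j \<in> Obj J" "k \<in> Obj J"
    and x: "x \<in> carrier (D i)" "y \<in> carrier (D j)" "z \<in> carrier (D k)"
    and "rel i x j y" "rel j y k z"
  shows "rel i x k z"
proof -
  obtain l u v where l: "l \<in> Obj J" "u \<in> Arr J i l" "v \<in> Arr J j l" "d i l u x = d j l v y"
    using assms(7) by (auto simp: rel_def)
  obtain m u' v' where m: "m \<in> Obj J" "u' \<in> Arr J j m" "v' \<in> Arr J k m" "d j m u' y = d k m v' z"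
    using assms(8) by (auto simp: rel_def)
  obtain n a b where n: "n \<in> Obj J" "a \<in> Arr J l n" "b \<in> Arr J m n"
    using upper[OF l(1) m(1)] by blast
  let ?p = "Cmp J j l n a v" and ?q = "Cmp J j m n b u'"
  have "?p \<in> Arr J j n" "?q \<in> Arr J j n" using ij l m n by (auto intro: Cmp_in)
  then obtain e w where e: "e \<in> Obj J" "w \<in> Arr J n e" "Cmp J j n e w ?p = Cmp J j n e w ?q"
    using equalize[OF ij(2) n(1)] by blast
  have pq: "?p \<in> Arr J j n" "?q \<in> Arr J j n" by fact+
  let ?a = "Cmp J l n e w a" and ?b = "Cmp J m n e w b"
  have ab: "?a \<in> Arr J l e" "?b \<in> Arr J m e" using l m n e by (auto intro: Cmp_in)
  have "d i e (Cmp J i l e ?a u) x = d l e ?a (d j l v y)"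
    using ij x l n e ab by (simp add: d_cmp)
  also have "\<dots> = d n e w (d l n a (d j l v y))" using ij x l n e d_in by (simp add: d_cmp)
  also have "\<dots> = d n e w (d j n ?p y)" using ij x l n e by (simp add: d_cmp)
  also have "\<dots> = d j e (Cmp J j n e w ?p) y" by (rule d_cmp[OF ij(2) n(1) e(1) pq(1) e(2) x(2), symmetric])
  also have "\<dots> = d j e (Cmp J j n e w ?q) y" using e by simp
  also have "\<dots> = d n e w (d j n ?q y)" by (rule d_cmp[OF ij(2) n(1) e(1) pq(2) e(2) x(2)])
  also have "\<dots> = d n e w (d m n b (d j m u' y))" using ij x m n by (simp add: d_cmp)
  also have "\<dots> = d m e ?b (d k m v' z)" using ij x m n e d_in by (simp add: d_cmp)
  also have "\<dots> = d k e (Cmp J k m e ?b v') z"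
    using ij x m n e ab by (simp add: d_cmp)
  finally show ?thesis unfolding rel_def using e l m ij ab Cmp_in by metis
qed

text \<open>The standard construction: classes of pairs of an index and an element.\<close>

definition gl :: "'o \<Rightarrow> 'b \<Rightarrow> ('o \<times> 'b) set" where
  "gl i x = {(j, y). j \<in> Obj J \<and> y \<in> carrier (D j) \<and> rel i x j y}"

lemma gl_eq:
  assumes "i \<in> Obj J" "j \<in> Obj J" "x \<in> carrier (D i)" "y \<in> carrier (D j)"
  shows "gl i x = gl j y \<longleftrightarrow> rel i x j y"
proof
  assume "gl i x = gl j y"
  moreover have "(j, y) \<in> gl j y" using assms rel_refl by (simp add: gl_def)
  ultimately show "rel i x j y" by (auto simp: gl_def)
next
  assume "rel i x j y"
  then show "gl i x = gl j y" unfolding gl_def using assms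
    by (auto intro: rel_trans[OF assms(1,2) _ assms(3,4)] rel_trans[OF assms(2,1) _ assms(4,3)] rel_sym)
qed

lemma gl_d: "\<lbrakk>i \<in> Obj J; j \<in> Obj J; u \<in> Arr J i j; x \<in> carrier (D i)\<rbrakk> \<Longrightarrow> gl j (d i j u x) = gl i x"
  using gl_eq d_in rel_d rel_sym by (metis (no_types))

definition germs :: "('o \<times> 'b) set set" where
  "germs = {gl i x | i x. i \<in> Obj J \<and> x \<in> carrier (D i)}"

lemma gl_in: "\<lbrakk>i \<in> Obj J; x \<in> carrier (D i)\<rbrakk> \<Longrightarrow> gl i x \<in> germs"
  by (auto simp: germs_def)

lemma germs_common:
  assumes "X \<in> germs" "i \<in> Obj J"
  obtains k u x where "k \<in> Obj J" "u \<in> Arr J i k" "x \<in> carrier (D k)" "X = gl k x"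
proof -
  obtain j x where j: "j \<in> Obj J" "x \<in> carrier (D j)" "X = gl j x"
    using assms by (auto simp: germs_def)
  obtain k u v where "k \<in> Obj J" "u \<in> Arr J i k" "v \<in> Arr J j k"
    using upper[OF assms(2) j(1)] by blast
  then show ?thesis using that[of k u "d j k v x"] j d_in gl_d by auto
qed

lemma germs_rep1:
  assumes "X \<in> germs"
  obtains k x where "k \<in> Obj J" "x \<in> carrier (D k)" "X = gl k x"
  using assms by (auto simp: germs_def)

lemma germs_rep2:
  assumes "X \<in> germs" "Y \<in> germs"
  obtains k x y where "k \<in> Obj J" "x \<in> carrier (D k)" "X = gl k x" "y \<in> carrier (D k)" "Y = gl k y"
proof -
  obtain j x where j: "j \<in> Obj J" "x \<in> carrier (D j)" "X = gl j x" 
    using germs_rep1[OF assms(1)] .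
  obtain k u y where "k \<in> Obj J" "u \<in> Arr J j k" "y \<in> carrier (D k)" "Y = gl k y"
    using germs_common[OF assms(2) j(1)] .
  then show ?thesis using that[of k "d j k u x" y] j d_in gl_d by auto
qed

lemma germs_rep3:
  assumes "X \<in> germs" "Y \<in> germs" "Z \<in> germs"
  obtains k x y z where "k \<in> Obj J" "x \<in> carrier (D k)" "X = gl k x" "y \<in> carrier (D k)" "Y = gl k y"
    "z \<in> carrier (D k)" "Z = gl k z"
proof -
  obtain j x y where j: "j \<in> Obj J" "x \<in> carrier (D j)" "X = gl j x" "y \<in> carrier (D j)" "Y = gl j y"
    using germs_rep2[OF assms(1,2)] .
  obtain k u z where "k \<in> Obj J" "u \<in> Arr J j k" "z \<in> carrier (D k)" "Z = gl k z"
    using germs_common[OF assms(3) j(1)] .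
  then show ?thesis using that[of k "d j k u x" "d j k u y" z] j d_in gl_d by auto
qed

definition gadd :: "('o \<times> 'b) set \<Rightarrow> ('o \<times> 'b) set \<Rightarrow> ('o \<times> 'b) set" where
  "gadd X Y = (THE Z. \<exists>k\<in>Obj J. \<exists>x\<in>carrier (D k). \<exists>y\<in>carrier (D k).
     X = gl k x \<and> Y = gl k y \<and> Z = gl k (x \<oplus>\<^bsub>D k\<^esub> y))"

definition gsmult :: "'r \<Rightarrow> ('o \<times> 'b) set \<Rightarrow> ('o \<times> 'b) set" where
  "gsmult r X = (THE Z. \<exists>k\<in>Obj J. \<exists>x\<in>carrier (D k). X = gl k x \<and> Z = gl k (r \<odot>\<^bsub>D k\<^esub> x))"

definition gzero :: "('o \<times> 'b) set" where
  "gzero = (let i = SOME i. i \<in> Obj J in gl i \<zero>\<^bsub>D i\<^esub>)"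

lemma gl_same:
  assumes "k \<in> Obj J" "x \<in> carrier (D k)" "x' \<in> carrier (D k)" "gl k x = gl k x'"
  shows "\<exists>l\<in>Obj J. \<exists>u\<in>Arr J k l. d k l u x = d k l u x'"
  using rel_same[OF assms(1-3)] gl_eq assms by metis

lemma gzero_eq: assumes "i \<in> Obj J" shows "gl i \<zero>\<^bsub>D i\<^esub> = gzero"
proof -
  define j where "j = (SOME i. i \<in> Obj J)"
  have j: "j \<in> Obj J" unfolding j_def using assms by (rule someI)
  obtain k u v where k: "k \<in> Obj J" "u \<in> Arr J i k" "v \<in> Arr J j k"
    using upper[OF assms j] by blast
  have "gl i \<zero>\<^bsub>D i\<^esub> = gl k \<zero>\<^bsub>D k\<^esub>"
    using gl_d[OF assms k(1,2), of "\<zero>\<^bsub>D i\<^esub>"] d_zero[OF assms k(1,2)] D_closed(2)[OF assms] by simp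
  moreover have "gl j \<zero>\<^bsub>D j\<^esub> = gl k \<zero>\<^bsub>D k\<^esub>"
    using gl_d[OF j k(1,3), of "\<zero>\<^bsub>D j\<^esub>"] d_zero[OF j k(1,3)] D_closed(2)[OF j] by simp
  ultimately show ?thesis by (simp add: gzero_def j_def)
qed

lemma gl_add_cong:
  assumes k: "k \<in> Obj J" "x \<in> carrier (D k)" "y \<in> carrier (D k)"
    and l: "l \<in> Obj J" "x' \<in> carrier (D l)" "y' \<in> carrier (D l)"
    and eq: "gl k x = gl l x'" "gl k y = gl l y'"
  shows "gl k (x \<oplus>\<^bsub>D k\<^esub> y) = gl l (x' \<oplus>\<^bsub>D l\<^esub> y')"
proof -
  obtain m u v where m: "m \<in> Obj J" "u \<in> Arr J k m" "v \<in> Arr J l m"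
    using upper[OF k(1) l(1)] by blast
  let ?u = "d k m u" and ?v = "d l m v"
  have c: "?u x \<in> carrier (D m)" "?u y \<in> carrier (D m)" "?v x' \<in> carrier (D m)" "?v y' \<in> carrier (D m)"
    using k l m d_in by auto
  have "gl m (?u x) = gl m (?v x')" "gl m (?u y) = gl m (?v y')"
    using k l m eq by (simp_all add: gl_d)
  then obtain n w where n: "n \<in> Obj J" "w \<in> Arr J m n" "d m n w (?u x) = d m n w (?v x')"
    using gl_same[OF m(1) c(1,3)] by blast
  let ?w = "d m n w"
  have c': "?w (?u y) \<in> carrier (D n)" "?w (?v y') \<in> carrier (D n)" "?w (?u x) \<in> carrier (D n)"
    using c m n d_in by auto
  have "gl n (?w (?u y)) = gl n (?w (?v y'))"
    using m n c \<open>gl m (?u y) = gl m (?v y')\<close> by (simp add: gl_d)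
  then obtain p z where p: "p \<in> Obj J" "z \<in> Arr J n p" "d n p z (?w (?u y)) = d n p z (?w (?v y'))"
    using gl_same[OF n(1) c'(1,2)] by blast
  let ?z = "d n p z"
  have "gl k (x \<oplus>\<^bsub>D k\<^esub> y) = gl m (?u x \<oplus>\<^bsub>D m\<^esub> ?u y)"
    using k m gl_d[of k m u "x \<oplus>\<^bsub>D k\<^esub> y"] D_closed(1) d_add by metis
  also have "\<dots> = gl n (?w (?u x) \<oplus>\<^bsub>D n\<^esub> ?w (?u y))"
    using m n c gl_d[of m n w "?u x \<oplus>\<^bsub>D m\<^esub> ?u y"] D_closed(1) d_add by metis
  also have "\<dots> = gl p (?z (?w (?u x)) \<oplus>\<^bsub>D p\<^esub> ?z (?w (?u y)))"
    using n p c' gl_d[of n p z "?w (?u x) \<oplus>\<^bsub>D n\<^esub> ?w (?u y)"] D_closed(1) d_add by metis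
  also have "\<dots> = gl p (?z (?w (?v x')) \<oplus>\<^bsub>D p\<^esub> ?z (?w (?v y')))" using n p by simp
  also have "\<dots> = gl n (?w (?v x') \<oplus>\<^bsub>D n\<^esub> ?w (?v y'))"
    using n p c' gl_d[of n p z "?w (?v x') \<oplus>\<^bsub>D n\<^esub> ?w (?v y')"] D_closed(1) d_add by metis
  also have "\<dots> = gl m (?v x' \<oplus>\<^bsub>D m\<^esub> ?v y')"
    using m n c gl_d[of m n w "?v x' \<oplus>\<^bsub>D m\<^esub> ?v y'"] D_closed(1) d_add by metis
  also have "\<dots> = gl l (x' \<oplus>\<^bsub>D l\<^esub> y')"
    using l m gl_d[of l m v "x' \<oplus>\<^bsub>D l\<^esub> y'"] D_closed(1) d_add by metis
  finally show ?thesis .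
qed

lemma gl_smult_cong:
  assumes r: "r \<in> carrier R" and k: "k \<in> Obj J" "x \<in> carrier (D k)"
    and l: "l \<in> Obj J" "x' \<in> carrier (D l)" and eq: "gl k x = gl l x'"
  shows "gl k (r \<odot>\<^bsub>D k\<^esub> x) = gl l (r \<odot>\<^bsub>D l\<^esub> x')"
proof -
  obtain m u v where m: "m \<in> Obj J" "u \<in> Arr J k m" "v \<in> Arr J l m" "d k m u x = d l m v x'"
    using gl_eq[OF k(1) l(1) k(2) l(2)] eq by (auto simp: rel_def)
  have "gl k (r \<odot>\<^bsub>D k\<^esub> x) = gl m (r \<odot>\<^bsub>D m\<^esub> d k m u x)"
    using r k m gl_d[of k m u "r \<odot>\<^bsub>D k\<^esub> x"] D_closed(3) d_smult by metis
  also have "\<dots> = gl l (r \<odot>\<^bsub>D l\<^esub> x')"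
    using r l m gl_d[of l m v "r \<odot>\<^bsub>D l\<^esub> x'"] D_closed(3) d_smult by metis
  finally show ?thesis .
qed

lemma gadd_eq:
  assumes k: "k \<in> Obj J" "x \<in> carrier (D k)" "y \<in> carrier (D k)"
  shows "gadd (gl k x) (gl k y) = gl k (x \<oplus>\<^bsub>D k\<^esub> y)"
  unfolding gadd_def using k by (intro the_equality) (blast, metis gl_add_cong)

lemma gsmult_eq:
  assumes "r \<in> carrier R" "k \<in> Obj J" "x \<in> carrier (D k)"
  shows "gsmult r (gl k x) = gl k (r \<odot>\<^bsub>D k\<^esub> x)"
  unfolding gsmult_def using assms by (intro the_equality) (blast, metis gl_smult_cong)

definition germ_module :: "('r, ('o \<times> 'b) set) module" where
  "germ_module = \<lparr>carrier = germs, mult = gadd, one = gzero, zero = gzero,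
     add = gadd, smult = gsmult\<rparr>"

lemma germ_left_module: "left_module R germ_module"
proof -
  interpret ring R by (rule R)
  show ?thesis
  proof (intro left_module.intro left_module_axioms.intro abelian_groupI ring_axioms)
    fix x y assume "x \<in> carrier germ_module" "y \<in> carrier germ_module"
    then show "x \<oplus>\<^bsub>germ_module\<^esub> y \<in> carrier germ_module"
      by (auto simp: germ_module_def elim!: germs_rep2[of x y] simp: gadd_eq gl_in D_closed)
  next
    show "\<zero>\<^bsub>germ_module\<^esub> \<in> carrier germ_module"
      using Obj_nonempty gzero_eq gl_in D_closed(2) by (force simp: germ_module_def)
  next
    fix x y z assume "x \<in> carrier germ_module" "y \<in> carrier germ_module" "z \<in> carrier germ_module"
    then show "x \<oplus>\<^bsub>germ_module\<^esub> y \<oplus>\<^bsub>germ_module\<^esub> z = x \<oplus>\<^bsub>germ_module\<^esub> (y \<oplus>\<^bsub>germ_module\<^esub> z)"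
      by (auto simp: germ_module_def elim!: germs_rep3[of x y z]
          simp: gadd_eq gl_in D_closed abelian_monoid.a_assoc[OF D_monoid])
  next
    fix x y assume "x \<in> carrier germ_module" "y \<in> carrier germ_module"
    then show "x \<oplus>\<^bsub>germ_module\<^esub> y = y \<oplus>\<^bsub>germ_module\<^esub> x"
      by (auto simp: germ_module_def elim!: germs_rep2[of x y]
          simp: gadd_eq gl_in D_closed abelian_monoid.a_comm[OF D_monoid])
  next
    fix x assume "x \<in> carrier germ_module"
    then obtain k a where k: "k \<in> Obj J" "a \<in> carrier (D k)" "x = gl k a"
      by (auto simp: germ_module_def elim: germs_rep1)
    show "\<zero>\<^bsub>germ_module\<^esub> \<oplus>\<^bsub>germ_module\<^esub> x = x"
      using k gadd_eq[of k "\<zero>\<^bsub>D k\<^esub>" a] gzero_eq[of k] D_closed(2) 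
      by (simp add: germ_module_def abelian_monoid.l_zero[OF D_monoid])
    show "\<exists>y\<in>carrier germ_module. y \<oplus>\<^bsub>germ_module\<^esub> x = \<zero>\<^bsub>germ_module\<^esub>"
      using k gadd_eq[of k "\<ominus>\<^bsub>D k\<^esub> a" a] gzero_eq[of k] D_closed(4) gl_in[of k "\<ominus>\<^bsub>D k\<^esub> a"]
      by (intro bexI[of _ "gl k (\<ominus>\<^bsub>D k\<^esub> a)"]) (auto simp: germ_module_def abelian_group.l_neg[OF D_group])
    show "\<one>\<^bsub>R\<^esub> \<odot>\<^bsub>germ_module\<^esub> x = x"
      using k by (simp add: germ_module_def gsmult_eq left_module.smult_one[OF D_mod])
    fix r assume r: "r \<in> carrier R"
    show "r \<odot>\<^bsub>germ_module\<^esub> x \<in> carrier germ_module"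
      using k r by (simp add: germ_module_def gsmult_eq gl_in D_closed)
    fix s assume s: "s \<in> carrier R"
    show "(r \<oplus>\<^bsub>R\<^esub> s) \<odot>\<^bsub>germ_module\<^esub> x = r \<odot>\<^bsub>germ_module\<^esub> x \<oplus>\<^bsub>germ_module\<^esub> s \<odot>\<^bsub>germ_module\<^esub> x"
      using k r s by (simp add: germ_module_def gsmult_eq gadd_eq D_closed left_module.smult_l_distr[OF D_mod])
    show "(r \<otimes>\<^bsub>R\<^esub> s) \<odot>\<^bsub>germ_module\<^esub> x = r \<odot>\<^bsub>germ_module\<^esub> (s \<odot>\<^bsub>germ_module\<^esub> x)"
      using k r s by (simp add: germ_module_def gsmult_eq D_closed left_module.smult_assoc1[OF D_mod])
  next
    fix r x y assume "r \<in> carrier R" "x \<in> carrier germ_module" "y \<in> carrier germ_module"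
    then show "r \<odot>\<^bsub>germ_module\<^esub> (x \<oplus>\<^bsub>germ_module\<^esub> y) =
        r \<odot>\<^bsub>germ_module\<^esub> x \<oplus>\<^bsub>germ_module\<^esub> r \<odot>\<^bsub>germ_module\<^esub> y"
      by (auto simp: germ_module_def elim!: germs_rep2[of x y]
          simp: gadd_eq gsmult_eq gl_in D_closed left_module.smult_r_distr[OF D_mod])
  qed
qed

lemma germ_explicit: "explicit_colimit R J D d germ_module gl"
  unfolding explicit_colimit_def is_cocone_def
proof (intro conjI ballI impI germ_left_module)
  fix i assume "i \<in> Obj J"
  then show "gl i \<in> lmod_hom R (D i) germ_module"
    by (intro lmod_homI) (auto simp: germ_module_def gl_in gadd_eq gsmult_eq)
next
  fix i x assume i: "i \<in> Obj J" "x \<in> carrier (D i)" "gl i x = \<zero>\<^bsub>germ_module\<^esub>"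
  then have "gl i x = gl i \<zero>\<^bsub>D i\<^esub>" using gzero_eq by (simp add: germ_module_def)
  then obtain l u where "l \<in> Obj J" "u \<in> Arr J i l" "d i l u x = d i l u \<zero>\<^bsub>D i\<^esub>"
    using gl_same i D_closed(2) by metis
  then show "\<exists>j\<in>Obj J. \<exists>u\<in>Arr J i j. d i j u x = \<zero>\<^bsub>D j\<^esub>" using i d_zero by metis
next
  fix y assume "y \<in> carrier germ_module"
  then have "y \<in> germs" by (simp add: germ_module_def)
  then show "\<exists>i\<in>Obj J. \<exists>x\<in>carrier (D i). gl i x = y" by (rule germs_rep1) blast
qed (auto simp: gl_d)

lemma explicit_kill:
  assumes "explicit_colimit R J D d M c" "i \<in> Obj J" "x \<in> carrier (D i)" "c i x = \<zero>\<^bsub>M\<^esub>"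
  shows "\<exists>j\<in>Obj J. \<exists>u\<in>Arr J i j. d i j u x = \<zero>\<^bsub>D j\<^esub>"
  using assms unfolding explicit_colimit_def by blast

lemma cocone_d:
  assumes "is_cocone R J D d T t" "i \<in> Obj J" "j \<in> Obj J" "u \<in> Arr J i j" "x \<in> carrier (D i)"
  shows "t j (d i j u x) = t i x"
  using assms unfolding is_cocone_def by blast

lemma cocone_rel:
  assumes "is_cocone R J D d T t" "i \<in> Obj J" "j \<in> Obj J" "x \<in> carrier (D i)" "y \<in> carrier (D j)"
    "rel i x j y"
  shows "t i x = t j y"
  using assms unfolding rel_def is_cocone_def by metis

lemma explicit_rel:
  assumes e: "explicit_colimit R J D d M c" and i: "i \<in> Obj J" "j \<in> Obj J"
    and x: "x \<in> carrier (D i)" "y \<in> carrier (D j)" and eq: "c i x = c j y"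
  shows "rel i x j y"
proof -
  have co: "is_cocone R J D d M c" using e by (simp add: explicit_colimit_def)
  then have M: "left_module R M" by (simp add: is_cocone_def)
  interpret M: left_module R M by fact
  obtain k u v where k: "k \<in> Obj J" "u \<in> Arr J i k" "v \<in> Arr J j k" using upper[OF i] by blast
  interpret Dk: left_module R "D k" using D_mod k by blast
  let ?x = "d i k u x" and ?y = "d j k v y"
  have xy: "?x \<in> carrier (D k)" "?y \<in> carrier (D k)" using i x k d_in by auto
  have ch: "c k \<in> lmod_hom R (D k) M" using co k by (auto simp: is_cocone_def)
  have "c k ?x = c k ?y" using co i x k eq by (simp add: is_cocone_def)
  then have "c k (?x \<oplus>\<^bsub>D k\<^esub> \<ominus>\<^bsub>D k\<^esub> ?y) = \<zero>\<^bsub>M\<^esub>"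
    using xy lmod_homD[OF ch] lmod_hom_a_inv[OF Dk.left_module_axioms M ch] by (simp add: M.M.r_neg)
  then obtain l w where l: "l \<in> Obj J" "w \<in> Arr J k l" "d k l w (?x \<oplus>\<^bsub>D k\<^esub> \<ominus>\<^bsub>D k\<^esub> ?y) = \<zero>\<^bsub>D l\<^esub>"
    using e k(1) Dk.M.a_closed[OF xy(1) Dk.M.a_inv_closed[OF xy(2)]]
    unfolding explicit_colimit_def by blast
  interpret Dl: left_module R "D l" using D_mod l by blast
  have dh: "d k l w \<in> lmod_hom R (D k) (D l)" using d_hom k l by auto
  have "d k l w ?x \<oplus>\<^bsub>D l\<^esub> \<ominus>\<^bsub>D l\<^esub> d k l w ?y = \<zero>\<^bsub>D l\<^esub>"
    using l xy lmod_homD[OF dh] lmod_hom_a_inv[OF Dk.left_module_axioms Dl.left_module_axioms dh]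
    by simp
  then have "d k l w ?x = d k l w ?y"
    using lmod_homD(1)[OF dh] xy by (metis Dl.M.minus_equality Dl.M.minus_minus Dl.M.a_inv_closed)
  then have "d i l (Cmp J i k l w u) x = d j l (Cmp J j k l w v) y"
    using i x k l by (simp add: d_cmp)
  then show ?thesis unfolding rel_def using i k l Cmp_in by metis
qed

lemma explicit_universal:
  assumes e: "explicit_colimit R J D d M c" and t: "is_cocone R J D d T t"
  shows "unique_factorization R J D M c T t"
proof -
  have co: "is_cocone R J D d M c" using e by (simp add: explicit_colimit_def)
  have M: "left_module R M" and T: "left_module R T" using co t by (auto simp: is_cocone_def)
  have ch: "c i \<in> lmod_hom R (D i) M" if "i \<in> Obj J" for i using co that by (auto simp: is_cocone_def)
  have th: "t i \<in> lmod_hom R (D i) T" if "i \<in> Obj J" for i using t that by (auto simp: is_cocone_def)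
  have sur: "\<exists>i\<in>Obj J. \<exists>x\<in>carrier (D i). c i x = y" if "y \<in> carrier M" for y
    using e that by (auto simp: explicit_colimit_def)
  define h where "h y = (SOME z. \<exists>i\<in>Obj J. \<exists>x\<in>carrier (D i). c i x = y \<and> z = t i x)" for y
  have h: "h (c i x) = t i x" if "i \<in> Obj J" "x \<in> carrier (D i)" for i x
    unfolding h_def
  proof (rule some_equality)
    show "\<exists>j\<in>Obj J. \<exists>x'\<in>carrier (D j). c j x' = c i x \<and> t i x = t j x'" using that by blast
  qed (use that explicit_rel[OF e] cocone_rel[OF t] in metis)
  have two: "\<exists>k\<in>Obj J. \<exists>x\<in>carrier (D k). \<exists>x'\<in>carrier (D k). c k x = y \<and> c k x' = y'"
    if y: "y \<in> carrier M" "y' \<in> carrier M" for y y'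
  proof -
    obtain i x where i: "i \<in> Obj J" "x \<in> carrier (D i)" "c i x = y" using sur y by blast
    obtain j x' where j: "j \<in> Obj J" "x' \<in> carrier (D j)" "c j x' = y'" using sur y by blast
    obtain k u v where k: "k \<in> Obj J" "u \<in> Arr J i k" "v \<in> Arr J j k" using upper i j by blast
    have "c k (d i k u x) = y" "c k (d j k v x') = y'" using co i j k by (simp_all add: is_cocone_def)
    then show ?thesis using i j k d_in by metis
  qed
  have "h \<in> lmod_hom R M T"
  proof (rule lmod_homI)
    fix y assume "y \<in> carrier M"
    then obtain i x where i: "i \<in> Obj J" "x \<in> carrier (D i)" "c i x = y" using sur by blast
    then show "h y \<in> carrier T" using h lmod_homD(1)[OF th] by metis
    fix r assume "r \<in> carrier R"
    then show "h (r \<odot>\<^bsub>M\<^esub> y) = r \<odot>\<^bsub>T\<^esub> h y"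
      using i h lmod_homD(3)[OF ch] lmod_homD(3)[OF th] D_closed(3) by metis
  next
    fix y y' assume "y \<in> carrier M" "y' \<in> carrier M"
    then obtain k x x' where "k \<in> Obj J" "x \<in> carrier (D k)" "x' \<in> carrier (D k)" "c k x = y" "c k x' = y'"
      using two by blast
    then show "h (y \<oplus>\<^bsub>M\<^esub> y') = h y \<oplus>\<^bsub>T\<^esub> h y'"
      using h lmod_homD(2)[OF ch] lmod_homD(2)[OF th] D_closed(1) by metis
  qed
  then show ?thesis unfolding unique_factorization_def using h sur by (smt (verit))
qed

end

definition transport :: "('t \<Rightarrow> 's) \<Rightarrow> ('r, 't) module \<Rightarrow> ('r, 's) module" where
  "transport \<phi> T = \<lparr>carrier = \<phi> ` carrier T,
     mult = (\<lambda>x y. \<phi> (inv_into UNIV \<phi> x \<otimes>\<^bsub>T\<^esub> inv_into UNIV \<phi> y)), one = \<phi> \<one>\<^bsub>T\<^esub>, zero = \<phi> \<zero>\<^bsub>T\<^esub>,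
     add = (\<lambda>x y. \<phi> (inv_into UNIV \<phi> x \<oplus>\<^bsub>T\<^esub> inv_into UNIV \<phi> y)), smult = (\<lambda>r x. \<phi> (r \<odot>\<^bsub>T\<^esub> inv_into UNIV \<phi> x))\<rparr>"

lemma transport_left_module:
  assumes T: "left_module R T" and inj: "inj \<phi>"
  shows "left_module R (transport \<phi> T)" "\<phi> \<in> lmod_hom R T (transport \<phi> T)"
    "inv_into UNIV \<phi> \<in> lmod_hom R (transport \<phi> T) T"
proof -
  interpret T: left_module R T by fact
  show "left_module R (transport \<phi> T)"
    by (intro left_module.intro left_module_axioms.intro abelian_groupI T.ring_axioms)
      (auto simp: transport_def inj T.M.a_assoc T.M.a_comm T.M.a_lcomm T.M.r_neg T.smult_l_distr T.smult_r_distr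
        T.smult_assoc1 intro!: bexI[of _ "\<ominus>\<^bsub>T\<^esub> x" for x] T.M.l_neg)
  show "\<phi> \<in> lmod_hom R T (transport \<phi> T)" "inv_into UNIV \<phi> \<in> lmod_hom R (transport \<phi> T) T"
    by (auto intro!: lmod_homI simp: transport_def inj)
qed

lemma (in filtered_diagram) colimit_test:
  fixes M :: "('r, 'm) module" and T :: "('r, 't) module" and \<phi> :: "'t \<Rightarrow> ('m + 'o \<times> 'b) set"
  assumes c: "is_colimit R J D d M c" and t: "is_cocone R J D d T t" and inj: "inj \<phi>"
  shows "unique_factorization R J D M c T t"
proof -
  have T: "left_module R T" using t by (simp add: is_cocone_def)
  note tr = transport_left_module[OF T inj]
  let ?T = "transport \<phi> T"
  have th: "t i \<in> lmod_hom R (D i) T" if "i \<in> Obj J" for i using t that by (auto simp: is_cocone_def)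
  have "is_cocone R J D d ?T (\<lambda>i x. \<phi> (t i x))"
    using t tr lmod_hom_comp[OF th tr(2)] by (simp add: is_cocone_def)
  then have u: "unique_factorization R J D M c ?T (\<lambda>i x. \<phi> (t i x))"
    using c by (simp add: is_colimit_def)
  show ?thesis unfolding unique_factorization_def
  proof (intro conjI ballI impI)
    obtain h where h: "h \<in> lmod_hom R M ?T" "\<forall>i\<in>Obj J. \<forall>x\<in>carrier (D i). h (c i x) = \<phi> (t i x)"
      using u by (auto simp: unique_factorization_def)
    then show "\<exists>h\<in>lmod_hom R M T. \<forall>i\<in>Obj J. \<forall>x\<in>carrier (D i). h (c i x) = t i x"
      by (intro bexI[OF _ lmod_hom_comp[OF h(1) tr(3)]]) (simp add: inj)
  next
    fix h h' y assume h: "h \<in> lmod_hom R M T" "h' \<in> lmod_hom R M T"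
      "\<forall>i\<in>Obj J. \<forall>x\<in>carrier (D i). h (c i x) = t i x" "\<forall>i\<in>Obj J. \<forall>x\<in>carrier (D i). h' (c i x) = t i x"
      "y \<in> carrier M"
    have "\<phi> (h y) = \<phi> (h' y)"
      using u lmod_hom_comp[OF h(1) tr(2)] lmod_hom_comp[OF h(2) tr(2)] h(3-)
      unfolding unique_factorization_def by (elim conjE) (drule bspec, assumption, drule bspec, assumption, simp)
    then show "h y = h' y" using inj by (simp add: inj_def)
  qed
qed

lemma (in filtered_diagram) colimit_explicit:
  fixes M :: "('r, 'm) module"
  assumes c: "is_colimit R J D d M c"
  shows "explicit_colimit R J D d M c"
proof -
  have co: "is_cocone R J D d M c" using c by (simp add: is_colimit_def)
  have M: "left_module R M" using co by (simp add: is_cocone_def)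
  let ?G = germ_module
  have ge: "is_cocone R J D d ?G gl" using germ_explicit by (simp add: explicit_colimit_def)
  have "inj (\<lambda>X. Inr ` X :: ('m + 'o \<times> 'b) set)" by (auto simp: inj_def inj_image_eq_iff)
  from colimit_test[OF c ge this] obtain g where
    g: "g \<in> lmod_hom R M ?G" "\<And>i x. i \<in> Obj J \<Longrightarrow> x \<in> carrier (D i) \<Longrightarrow> g (c i x) = gl i x"
    by (auto simp: unique_factorization_def)
  from explicit_universal[OF germ_explicit co] obtain h where
    h: "h \<in> lmod_hom R ?G M" "\<And>i x. i \<in> Obj J \<Longrightarrow> x \<in> carrier (D i) \<Longrightarrow> h (gl i x) = c i x"
    by (auto simp: unique_factorization_def)
  have "inj (\<lambda>y. {Inl y} :: ('m + 'o \<times> 'b) set)" by (auto simp: inj_def)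
  from colimit_test[OF c co this]
  have u: "h' y = h'' y" if "h' \<in> lmod_hom R M M" "h'' \<in> lmod_hom R M M" "y \<in> carrier M"
    "\<forall>i\<in>Obj J. \<forall>x\<in>carrier (D i). h' (c i x) = c i x" "\<forall>i\<in>Obj J. \<forall>x\<in>carrier (D i). h'' (c i x) = c i x"
    for h' h'' y using that by (auto simp: unique_factorization_def)
  have hg: "h (g y) = y" if "y \<in> carrier M" for y
    using u[OF lmod_hom_comp[OF g(1) h(1)], of "\<lambda>x. x" y] that g h by (auto intro: lmod_homI)
  show ?thesis unfolding explicit_colimit_def
  proof (intro conjI co ballI impI)
    fix y assume y: "y \<in> carrier M"
    then have "g y \<in> germs" using lmod_homD(1)[OF g(1)] by (auto simp: germ_module_def)
    then obtain i x where "i \<in> Obj J" "x \<in> carrier (D i)" "g y = gl i x" by (rule germs_rep1)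
    then show "\<exists>i\<in>Obj J. \<exists>x\<in>carrier (D i). c i x = y" using hg[OF y] h by force
  next
    fix i x assume i: "i \<in> Obj J" "x \<in> carrier (D i)" "c i x = \<zero>\<^bsub>M\<^esub>"
    then have "gl i x = \<zero>\<^bsub>?G\<^esub>" using g lmod_hom_zero[OF M germ_left_module g(1)] by metis
    then show "\<exists>j\<in>Obj J. \<exists>u\<in>Arr J i j. d i j u x = \<zero>\<^bsub>D j\<^esub>"
      using germ_explicit i by (auto simp: explicit_colimit_def)
  qed
qed

theorem (in filtered_diagram) is_colimit_universal:
  assumes "is_colimit R J D d M c" "is_cocone R J D d T t"
  shows "unique_factorization R J D M c T t"
  using explicit_universal[OF colimit_explicit] assms by blast

lemma (in filtered_diagram) explicit_imp_colimit:
  "explicit_colimit R J D d M c \<Longrightarrow> is_colimit R J D d M c"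
  using explicit_universal by (auto simp: is_colimit_def explicit_colimit_def)

lemma (in filtered_diagram) finite_lift:
  assumes co: "is_cocone R J D d M c" and M: "\<And>y. y \<in> Y \<Longrightarrow> \<exists>i\<in>Obj J. \<exists>x\<in>carrier (D i). c i x = y"
    and fin: "finite Y"
  shows "\<exists>i\<in>Obj J. \<forall>y\<in>Y. \<exists>x\<in>carrier (D i). c i x = y"
  using fin M
proof (induction Y rule: finite_induct)
  case empty
  obtain i where "i \<in> Obj J" using Obj_nonempty by blast
  then show ?case by (intro bexI[of _ i]) simp_all
next
  case (insert y Y)
  have "\<exists>i\<in>Obj J. \<forall>y\<in>Y. \<exists>x\<in>carrier (D i). c i x = y"
    by (rule insert.IH, rule insert.prems, erule insertI2)
  then obtain i where i: "i \<in> Obj J" "\<forall>y\<in>Y. \<exists>x\<in>carrier (D i). c i x = y" by (elim bexE)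
  obtain j x where j: "j \<in> Obj J" "x \<in> carrier (D j)" "c j x = y"
    using insert.prems[OF insertI1] by (elim bexE)
  obtain k u v where k: "k \<in> Obj J" "u \<in> Arr J i k" "v \<in> Arr J j k"
    using upper[OF i(1) j(1)] by blast
  have cc: "c k (d i k u x) = c i x" if "x \<in> carrier (D i)" for x
    by (rule cocone_d[OF co i(1) k(1,2) that])
  have cc': "c k (d j k v x) = c j x" if "x \<in> carrier (D j)" for x
    by (rule cocone_d[OF co j(1) k(1,3) that])
  have "\<exists>x\<in>carrier (D k). c k x = z" if "z \<in> insert y Y" for z
  proof (cases "z = y")
    case True
    then show ?thesis using cc'[OF j(2)] j(3) by (intro bexI[OF _ d_in[OF j(1) k(1,3) j(2)]]) simp
  next
    case False
    with that have "z \<in> Y" by simp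
    from bspec[OF i(2) this] obtain x' where x': "x' \<in> carrier (D i)" "c i x' = z"
      by (elim bexE)
    then show ?thesis using cc[OF x'(1)] by (intro bexI[OF _ d_in[OF i(1) k(1,2) x'(1)]]) simp
  qed
  then show ?case by (intro bexI[OF _ k(1)] ballI)
qed

lemma (in filtered_diagram) finite_kill:
  assumes i: "i \<in> Obj J" and fin: "finite Y" and Y: "Y \<subseteq> carrier (D i)"
    and kill: "\<And>y. y \<in> Y \<Longrightarrow> \<exists>j\<in>Obj J. \<exists>u\<in>Arr J i j. d i j u y = \<zero>\<^bsub>D j\<^esub>"
  shows "\<exists>j\<in>Obj J. \<exists>u\<in>Arr J i j. \<forall>y\<in>Y. d i j u y = \<zero>\<^bsub>D j\<^esub>"
  using fin Y kill
proof (induction Y rule: finite_induct)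
  case empty show ?case using i Idt_in[OF i] by blast
next
  case (insert y Y)
  have "Y \<subseteq> carrier (D i)" using insert.prems(1) by simp
  then have "\<exists>j\<in>Obj J. \<exists>u\<in>Arr J i j. \<forall>y\<in>Y. d i j u y = \<zero>\<^bsub>D j\<^esub>"
    by (rule insert.IH) (intro insert.prems(2), erule insertI2)
  then obtain j u where j: "j \<in> Obj J" "u \<in> Arr J i j" "\<forall>y\<in>Y. d i j u y = \<zero>\<^bsub>D j\<^esub>" by blast
  obtain k v where k: "k \<in> Obj J" "v \<in> Arr J i k" "d i k v y = \<zero>\<^bsub>D k\<^esub>"
    using insert.prems(2)[OF insertI1] by blast
  have yc: "y \<in> carrier (D i)" using insert.prems(1) by simp
  have yj: "d i j u y \<in> carrier (D j)" by (rule d_in[OF i j(1,2) yc])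
  note zc = D_closed(2)
  have "rel j (d i j u y) i y" by (rule rel_sym[OF rel_d[OF i j(1,2) yc]])
  moreover have "rel i y k \<zero>\<^bsub>D k\<^esub>" using rel_d[OF i k(1,2) yc] k(3) by simp
  ultimately have "rel j (d i j u y) k \<zero>\<^bsub>D k\<^esub>"
    by (rule rel_trans[OF j(1) i k(1) yj yc zc[OF k(1)]])
  moreover have "rel k \<zero>\<^bsub>D k\<^esub> j \<zero>\<^bsub>D j\<^esub>"
    using gl_eq[OF k(1) j(1) zc[OF k(1)] zc[OF j(1)]] gzero_eq[OF j(1)] gzero_eq[OF k(1)] by simp
  ultimately have "rel j (d i j u y) j \<zero>\<^bsub>D j\<^esub>"
    by (rule rel_trans[OF j(1) k(1) j(1) yj zc[OF k(1)] zc[OF j(1)]])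
  then obtain l w where l: "l \<in> Obj J" "w \<in> Arr J j l" "d j l w (d i j u y) = d j l w \<zero>\<^bsub>D j\<^esub>"
    using rel_same[OF j(1) yj zc[OF j(1)]] by blast
  have z: "d j l w \<zero>\<^bsub>D j\<^esub> = \<zero>\<^bsub>D l\<^esub>" using d_zero j l by blast
  have "d i l (Cmp J i j l w u) z = \<zero>\<^bsub>D l\<^esub>" if "z \<in> insert y Y" for z
  proof -
    have zi: "z \<in> carrier (D i)" using that insert.prems(1) by auto
    have "d j l w (d i j u z) = \<zero>\<^bsub>D l\<^esub>" using that j(3) l(3) z by auto
    then show ?thesis using d_cmp[OF i j(1) l(1) j(2) l(2) zi] by simp
  qed
  then show ?case using Cmp_in[OF i j(1) l(1) j(2) l(2)] l(1) by blast
qed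

lemma (in filtered_diagram) fp_equalize:
  assumes e: "explicit_colimit R J D d M c" and X: "finitely_presented R X" and i: "i \<in> Obj J"
    and f: "f \<in> lmod_hom R X (D i)" and g: "g \<in> lmod_hom R X (D i)"
    and eq: "\<And>x. x \<in> carrier X \<Longrightarrow> c i (f x) = c i (g x)"
  shows "\<exists>j\<in>Obj J. \<exists>u\<in>Arr J i j. \<forall>x\<in>carrier X. d i j u (f x) = d i j u (g x)"
proof -
  obtain n p where p: "p \<in> lmod_hom R (free_module R n) X"
    and sur: "p ` carrier (free_module R n) = carrier X" and Xm: "left_module R X"
    using X by (auto simp: finitely_presented_def)
  let ?x = "\<lambda>l. p (unit_vec R n l)"
  have xc: "?x l \<in> carrier X" for l by (intro lmod_homD(1)[OF p] unit_vec_closed R)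
  interpret Di: left_module R "D i" using D_mod i .
  let ?Y = "(\<lambda>l. f (?x l) \<oplus>\<^bsub>D i\<^esub> \<ominus>\<^bsub>D i\<^esub> g (?x l)) ` {..<n}"
  have fc: "f (?x l) \<in> carrier (D i)" "g (?x l) \<in> carrier (D i)" for l 
    using lmod_homD(1)[OF f xc] lmod_homD(1)[OF g xc] by auto
  have dsub: "d i j u (a \<oplus>\<^bsub>D i\<^esub> \<ominus>\<^bsub>D i\<^esub> b) = \<zero>\<^bsub>D j\<^esub> \<longleftrightarrow> d i j u a = d i j u b"
    if j: "j \<in> Obj J" "u \<in> Arr J i j" and a: "a \<in> carrier (D i)" "b \<in> carrier (D i)" for j u a b
  proof -
    interpret Dj: left_module R "D j" by (rule D_mod[OF j(1)])
    have dh: "d i j u \<in> lmod_hom R (D i) (D j)" by (rule d_hom[OF i j])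
    have "d i j u (a \<oplus>\<^bsub>D i\<^esub> \<ominus>\<^bsub>D i\<^esub> b) = d i j u a \<oplus>\<^bsub>D j\<^esub> \<ominus>\<^bsub>D j\<^esub> d i j u b"
      using a lmod_homD[OF dh] lmod_hom_a_inv[OF Di.left_module_axioms Dj.left_module_axioms dh] by simp
    then show ?thesis using Dj.diff_zero_iff[OF lmod_homD(1)[OF dh a(1)] lmod_homD(1)[OF dh a(2)]] by simp
  qed
  have "\<exists>j\<in>Obj J. \<exists>u\<in>Arr J i j. \<forall>y\<in>?Y. d i j u y = \<zero>\<^bsub>D j\<^esub>"
  proof (rule finite_kill[OF i])
    fix y assume "y \<in> ?Y"
    then obtain l where y: "y = f (?x l) \<oplus>\<^bsub>D i\<^esub> \<ominus>\<^bsub>D i\<^esub> g (?x l)" by auto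
    have "rel i (f (?x l)) i (g (?x l))"
      by (rule explicit_rel[OF e i i fc eq[OF xc]])
    from rel_same[OF i fc this] obtain k u where
      k: "k \<in> Obj J" "u \<in> Arr J i k" "d i k u (f (?x l)) = d i k u (g (?x l))"
      by (elim bexE)
    have "d i k u y = \<zero>\<^bsub>D k\<^esub>" unfolding y by (rule dsub[OF k(1,2) fc, THEN iffD2, OF k(3)])
    then show "\<exists>j\<in>Obj J. \<exists>u\<in>Arr J i j. d i j u y = \<zero>\<^bsub>D j\<^esub>" by (intro bexI[OF _ k(1)] bexI[OF _ k(2)])
  next
    show "?Y \<subseteq> carrier (D i)" using fc by (intro image_subsetI Di.M.a_closed Di.M.a_inv_closed)
  qed simp
  then obtain j u where j: "j \<in> Obj J" "u \<in> Arr J i j" "\<forall>y\<in>?Y. d i j u y = \<zero>\<^bsub>D j\<^esub>"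
    by (elim bexE)
  have gen: "d i j u (f (?x l)) = d i j u (g (?x l))" if "l < n" for l
    using that by (intro dsub[OF j(1,2) fc, THEN iffD1] bspec[OF j(3)] imageI) simp
  have Dj: "left_module R (D j)" by (rule D_mod[OF j(1)])
  interpret Dj: left_module R "D j" by fact
  have hf: "(\<lambda>r. d i j u (f (p r))) \<in> lmod_hom R (free_module R n) (D j)"
    and hg: "(\<lambda>r. d i j u (g (p r))) \<in> lmod_hom R (free_module R n) (D j)"
    by (intro lmod_hom_comp[OF lmod_hom_comp[OF p f] d_hom[OF i j(1,2)]]
        lmod_hom_comp[OF lmod_hom_comp[OF p g] d_hom[OF i j(1,2)]])+
  have "d i j u (f x) = d i j u (g x)" if x: "x \<in> carrier X" for x
  proof -
    obtain r where r: "r \<in> carrier (free_module R n)" "x = p r" using x sur by blast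
    have rc: "r l \<in> carrier R" if "l < n" for l
      using r that by (auto simp: free_module_def prod_module_def regular_module_def)
    have "(\<Oplus>\<^bsub>D j\<^esub>l\<in>{..<n}. r l \<odot>\<^bsub>D j\<^esub> d i j u (f (?x l))) = (\<Oplus>\<^bsub>D j\<^esub>l\<in>{..<n}. r l \<odot>\<^bsub>D j\<^esub> d i j u (g (?x l)))"
    proof (rule Dj.add.finprod_cong')
      show "(\<lambda>l. r l \<odot>\<^bsub>D j\<^esub> d i j u (g (?x l))) \<in> {..<n} \<rightarrow> carrier (D j)"
        using rc lmod_homD(1)[OF hg unit_vec_closed[OF R]] by auto
    qed (simp_all add: gen)
    then show ?thesis
      unfolding r(2) free_hom_expand[OF Dj hf r(1)] free_hom_expand[OF Dj hg r(1)] .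
  qed
  then show ?thesis by (intro bexI[OF _ j(1)] bexI[OF _ j(2)] ballI)
qed

lemma (in filtered_diagram) fp_factor:
  assumes e: "explicit_colimit R J D d M c" and X: "finitely_presented R X"
    and f: "f \<in> lmod_hom R X M"
  shows "\<exists>i\<in>Obj J. \<exists>h\<in>lmod_hom R X (D i). \<forall>x\<in>carrier X. c i (h x) = f x"
proof -
  obtain n p S where p: "p \<in> lmod_hom R (free_module R n) X"
    and sur: "p ` carrier (free_module R n) = carrier X" and Xm: "left_module R X"
    and S: "finite S" "S \<subseteq> carrier (free_module R n)"
    and ker: "a_kernel (free_module R n) X p = submodule_span R (free_module R n) S"
    using X by (auto simp: finitely_presented_def)
  let ?F = "free_module R n"
  have F: "left_module R ?F" by (intro free_left_module R)
  interpret F: left_module R ?F by fact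
  interpret X: left_module R X by fact
  have co: "is_cocone R J D d M c" using e by (simp add: explicit_colimit_def)
  have M: "left_module R M" using co by (simp add: is_cocone_def)
  interpret M: left_module R M by fact
  have ch: "c i \<in> lmod_hom R (D i) M" if "i \<in> Obj J" for i using co that by (auto simp: is_cocone_def)
  let ?x = "\<lambda>l. p (unit_vec R n l)"
  have xc: "?x l \<in> carrier X" for l by (intro lmod_homD(1)[OF p] unit_vec_closed R)
  have "\<exists>i\<in>Obj J. \<forall>y\<in>(\<lambda>l. f (?x l)) ` {..<n}. \<exists>x\<in>carrier (D i). c i x = y"
  proof (rule finite_lift[OF co])
    fix y assume "y \<in> (\<lambda>l. f (?x l)) ` {..<n}"
    then have "y \<in> carrier M" using lmod_homD(1)[OF f xc] by auto
    then show "\<exists>i\<in>Obj J. \<exists>x\<in>carrier (D i). c i x = y"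
      using e unfolding explicit_colimit_def by blast
  qed simp
  then obtain i where i: "i \<in> Obj J"
    and i': "\<forall>y\<in>(\<lambda>l. f (?x l)) ` {..<n}. \<exists>x\<in>carrier (D i). c i x = y" by (elim bexE)
  have "\<exists>x. x \<in> carrier (D i) \<and> c i x = f (?x l)" if "l < n" for l
    using i' that by auto
  then obtain y where y: "\<And>l. l < n \<Longrightarrow> y l \<in> carrier (D i)"
    "\<And>l. l < n \<Longrightarrow> c i (y l) = f (?x l)" by metis
  have Di: "left_module R (D i)" using D_mod i .
  interpret Di: left_module R "D i" by fact
  define q where "q = (\<lambda>r. \<Oplus>\<^bsub>D i\<^esub>l\<in>{..<n}. r l \<odot>\<^bsub>D i\<^esub> y l)"
  have q: "q \<in> lmod_hom R ?F (D i)" unfolding q_def by (intro free_hom_exists Di y)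
  have qu: "q (unit_vec R n l) = y l" if "l < n" for l
  proof -
    have "q (unit_vec R n l) = (\<Oplus>\<^bsub>D i\<^esub>k\<in>{..<n}. if l = k then y k else \<zero>\<^bsub>D i\<^esub>)"
      unfolding q_def using y by (intro Di.add.finprod_cong') (auto simp: unit_vec_def Di.zero_smult)
    also have "\<dots> = y l" using that y Di.M.finsum_singleton[of l "{..<n}" y] by auto
    finally show ?thesis .
  qed
  have cq: "c i (q r) = f (p r)" if r: "r \<in> carrier ?F" for r
  proof -
    have rc: "r l \<in> carrier R" if "l < n" for l
      using r that by (auto simp: free_module_def prod_module_def regular_module_def)
    have tc: "(\<lambda>l. r l \<odot>\<^bsub>M\<^esub> f (?x l)) \<in> {..<n} \<rightarrow> carrier M"
      using rc lmod_homD(1)[OF f xc] by auto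
    have "c i (q r) = (\<Oplus>\<^bsub>M\<^esub>l\<in>{..<n}. r l \<odot>\<^bsub>M\<^esub> c i (q (unit_vec R n l)))"
      by (rule free_hom_expand[OF M lmod_hom_comp[OF q ch[OF i]] r])
    also have "\<dots> = (\<Oplus>\<^bsub>M\<^esub>l\<in>{..<n}. r l \<odot>\<^bsub>M\<^esub> f (p (unit_vec R n l)))"
      by (rule M.add.finprod_cong'[OF refl tc]) (simp add: qu y)
    also have "\<dots> = f (p r)" by (rule free_hom_expand[OF M lmod_hom_comp[OF p f] r, symmetric])
    finally show ?thesis .
  qed
  have "S \<subseteq> submodule_span R ?F S" by (auto simp: submodule_span_def)
  then have pS: "p s = \<zero>\<^bsub>X\<^esub>" if "s \<in> S" for s
    using that ker unfolding a_kernel_def kernel_def by auto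
  have "\<exists>j\<in>Obj J. \<exists>u\<in>Arr J i j. \<forall>y\<in>q ` S. d i j u y = \<zero>\<^bsub>D j\<^esub>"
  proof (rule finite_kill[OF i])
    fix z assume "z \<in> q ` S"
    then obtain s where s: "s \<in> S" "z = q s" by auto
    have sF: "s \<in> carrier ?F" using s(1) S(2) by blast
    have "c i z = \<zero>\<^bsub>M\<^esub>" using cq[OF sF] pS[OF s(1)] lmod_hom_zero[OF Xm M f] s(2) by simp
    then show "\<exists>j\<in>Obj J. \<exists>u\<in>Arr J i j. d i j u z = \<zero>\<^bsub>D j\<^esub>"
      unfolding s(2) by (rule explicit_kill[OF e i lmod_homD(1)[OF q sF]])
  next
    show "q ` S \<subseteq> carrier (D i)" using S(2) lmod_homD(1)[OF q] by blast
  qed (use S(1) in simp)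
  then obtain j u where j: "j \<in> Obj J" "u \<in> Arr J i j"
    and j': "\<forall>y\<in>q ` S. d i j u y = \<zero>\<^bsub>D j\<^esub>" by (elim bexE)
  have Dj: "left_module R (D j)" by (rule D_mod[OF j(1)])
  interpret Dj: left_module R "D j" by fact
  let ?q = "\<lambda>r. d i j u (q r)"
  have q': "?q \<in> lmod_hom R ?F (D j)" by (intro lmod_hom_comp[OF q] d_hom i j)
  have kq: "?q r = \<zero>\<^bsub>D j\<^esub>" if "r \<in> carrier ?F" "p r = \<zero>\<^bsub>X\<^esub>" for r
  proof -
    have rS: "r \<in> submodule_span R ?F S" using that ker unfolding a_kernel_def kernel_def by auto
    show ?thesis by (rule free_hom_kernel[OF Dj q' S(2) _ rS]) (rule bspec[OF j' imageI])
  qed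
  have wd: "?q r = ?q r'" if r: "r \<in> carrier ?F" "r' \<in> carrier ?F" "p r = p r'" for r r'
  proof -
    have "p (r \<oplus>\<^bsub>?F\<^esub> \<ominus>\<^bsub>?F\<^esub> r') = \<zero>\<^bsub>X\<^esub>"
      using r lmod_homD[OF p] lmod_hom_a_inv[OF F Xm p] by (simp add: X.M.r_neg)
    then have "?q (r \<oplus>\<^bsub>?F\<^esub> \<ominus>\<^bsub>?F\<^esub> r') = \<zero>\<^bsub>D j\<^esub>"
      using kq F.M.a_closed[OF r(1) F.M.a_inv_closed[OF r(2)]] by blast
    then have "?q r \<oplus>\<^bsub>D j\<^esub> \<ominus>\<^bsub>D j\<^esub> ?q r' = \<zero>\<^bsub>D j\<^esub>"
      using r lmod_homD[OF q'] lmod_hom_a_inv[OF F Dj q'] by simp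
    then show ?thesis
      using Dj.diff_zero_iff[OF lmod_homD(1)[OF q' r(1)] lmod_homD(1)[OF q' r(2)]] by simp
  qed
  define g where "g x = (SOME r. r \<in> carrier ?F \<and> p r = x)" for x
  have g: "g x \<in> carrier ?F" "p (g x) = x" if "x \<in> carrier X" for x
  proof -
    have "x \<in> p ` carrier ?F" using that sur by simp
    then have "\<exists>r. r \<in> carrier ?F \<and> p r = x" by auto
    from someI_ex[OF this] show "g x \<in> carrier ?F" "p (g x) = x" by (auto simp: g_def)
  qed
  define h where "h x = ?q (g x)" for x
  have hh: "h \<in> lmod_hom R X (D j)"
  proof (rule lmod_homI)
    fix x assume x: "x \<in> carrier X"
    show "h x \<in> carrier (D j)" unfolding h_def by (rule lmod_homD(1)[OF q' g(1)[OF x]])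
    fix r assume r: "r \<in> carrier R"
    have "h (r \<odot>\<^bsub>X\<^esub> x) = ?q (r \<odot>\<^bsub>?F\<^esub> g x)"
      unfolding h_def
    proof (rule wd)
      show "p (g (r \<odot>\<^bsub>X\<^esub> x)) = p (r \<odot>\<^bsub>?F\<^esub> g x)"
        unfolding g(2)[OF X.smult_closed[OF r x]] lmod_homD(3)[OF p r g(1)[OF x]] g(2)[OF x] ..
    qed (use r g(1)[OF x] g(1)[OF X.smult_closed[OF r x]] F.smult_closed in blast)+
    also have "\<dots> = r \<odot>\<^bsub>D j\<^esub> h x"
      unfolding h_def by (rule lmod_homD(3)[OF q' r g(1)[OF x]])
    finally show "h (r \<odot>\<^bsub>X\<^esub> x) = r \<odot>\<^bsub>D j\<^esub> h x" .
  next
    fix x x' assume x: "x \<in> carrier X" "x' \<in> carrier X"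
    have "h (x \<oplus>\<^bsub>X\<^esub> x') = ?q (g x \<oplus>\<^bsub>?F\<^esub> g x')"
      unfolding h_def
    proof (rule wd)
      show "p (g (x \<oplus>\<^bsub>X\<^esub> x')) = p (g x \<oplus>\<^bsub>?F\<^esub> g x')"
        unfolding g(2)[OF X.M.a_closed[OF x]] lmod_homD(2)[OF p g(1)[OF x(1)] g(1)[OF x(2)]]
          g(2)[OF x(1)] g(2)[OF x(2)] ..
    qed (use g(1)[OF x(1)] g(1)[OF x(2)] g(1)[OF X.M.a_closed[OF x]] F.M.a_closed in blast)+
    also have "\<dots> = h x \<oplus>\<^bsub>D j\<^esub> h x'"
      unfolding h_def by (rule lmod_homD(2)[OF q' g(1)[OF x(1)] g(1)[OF x(2)]])
    finally show "h (x \<oplus>\<^bsub>X\<^esub> x') = h x \<oplus>\<^bsub>D j\<^esub> h x'" .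
  qed
  have "c j (h x) = f x" if "x \<in> carrier X" for x
  proof -
    have "c j (h x) = c i (q (g x))"
      unfolding h_def by (rule cocone_d[OF co i j(1,2) lmod_homD(1)[OF q g(1)[OF that]]])
    then show ?thesis using cq[OF g(1)[OF that]] g(2)[OF that] by simp
  qed
  then show ?thesis by (intro bexI[OF _ j(1)] bexI[OF _ hh] ballI)
qed

text \<open>The canonical index category of \<open>M\<close>.\<close>

definition canonical_cat :: "('r, 'x) ring_scheme \<Rightarrow> ('r, 'b) module set \<Rightarrow> ('r, 'm) module \<Rightarrow>
  (('r, 'b) module \<times> ('b \<Rightarrow> 'm), 'b \<Rightarrow> 'b) small_cat" where
  "canonical_cat R B M = \<lparr>Obj = {(X, f). X \<in> B \<and> f \<in> lmod_hom R X M},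
     Arr = (\<lambda>(X, f) (Y, g). {u \<in> lmod_hom R X Y. u \<in> extensional (carrier X) \<and> (\<forall>x\<in>carrier X. g (u x) = f x)}),
     Idt = (\<lambda>(X, f). \<lambda>x\<in>carrier X. x),
     Cmp = (\<lambda>(X, f) _ _ v u. \<lambda>x\<in>carrier X. v (u x))\<rparr>"

theorem lim_classI:
  fixes J :: "('o, 'a) small_cat" and B :: "('r, 'b) module set" and M :: "('r, 'm) module"
  assumes R: "ring R" and fp: "\<And>X. X \<in> B \<Longrightarrow> finitely_presented R X"
    and J: "filtered_category J" and dg: "is_diagram R B J D d" and c: "is_colimit R J D d M c"
  shows "M \<in> lim_class R B"
proof -
  have Bm: "left_module R X" if "X \<in> B" for X using fp that by (simp add: finitely_presented_def)
  interpret filtered_diagram J R B D d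
    using J R Bm dg by (intro filtered_diagram.intro filtered_diagram_axioms.intro)
  have e: "explicit_colimit R J D d M c" using colimit_explicit[OF c] .
  have co: "is_cocone R J D d M c" using e by (simp add: explicit_colimit_def)
  have M: "left_module R M" using co by (simp add: is_cocone_def)
  have ch: "c i \<in> lmod_hom R (D i) M" if "i \<in> Obj J" for i using co that by (auto simp: is_cocone_def)
  have cd: "c j (d i j u x) = c i x" if "i \<in> Obj J" "j \<in> Obj J" "u \<in> Arr J i j" "x \<in> carrier (D i)" for i j u x
    using co that by (simp add: is_cocone_def)
  let ?C = "canonical_cat R B M"
  have obj: "(X, f) \<in> Obj ?C \<longleftrightarrow> X \<in> B \<and> f \<in> lmod_hom R X M" for X f by (simp add: canonical_cat_def)
  have arr: "u \<in> Arr ?C (X, f) (Y, g) \<longleftrightarrow>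
      u \<in> lmod_hom R X Y \<and> u \<in> extensional (carrier X) \<and> (\<forall>x\<in>carrier X. g (u x) = f x)"
    for u X f Y g by (simp add: canonical_cat_def)
  have cmp: "Cmp ?C (X, f) q k v u = (\<lambda>x\<in>carrier X. v (u x))" for X f q k v u
    by (simp add: canonical_cat_def)
  have idt: "Idt ?C (X, f) = (\<lambda>x\<in>carrier X. x)" for X f by (simp add: canonical_cat_def)
  have Dobj: "(D i, c i) \<in> Obj ?C" if "i \<in> Obj J" for i using that D_in ch by (simp add: obj)
  have rh: "restrict u (carrier X) \<in> lmod_hom R X Y" if "X \<in> B" "u \<in> lmod_hom R X Y"
    for u and X :: "('r, 'b) module" and Y :: "('r, 'b) module"
  proof -
    interpret X: left_module R X using Bm that by blast
    show ?thesis by (rule lmod_homI) (simp_all add: lmod_homD[OF that(2)])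
  qed
  have idh: "(\<lambda>x. x) \<in> lmod_hom R X X" for X :: "('r, 'b) module"
    by (rule lmod_homI) simp_all
  have ext_arr: "restrict (\<lambda>x. d i j u (h x)) (carrier X) \<in> Arr ?C (X, f) (D j, c j)"
    if "X \<in> B" "i \<in> Obj J" "j \<in> Obj J" "u \<in> Arr J i j" "h \<in> lmod_hom R X (D i)"
      "\<forall>x\<in>carrier X. c i (h x) = f x" for X f i j u h
    unfolding arr using rh[OF that(1) lmod_hom_comp[OF that(5) d_hom[OF that(2-4)]]] that(6)
    by (simp add: cd[OF that(2-4) lmod_homD(1)[OF that(5)]])
  have cat: "filtered_category ?C"
  proof (unfold_locales, goal_cases)
    case (1 p)
    then show ?case by (cases p) (auto simp: obj arr idt intro!: rh idh)
  next
    case (2 p q k u v)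
    then obtain X f Y g Z h where p: "p = (X, f)" "q = (Y, g)" "k = (Z, h)" "X \<in> B"
      by (cases p; cases q; cases k) (auto simp: obj)
    have u: "u \<in> lmod_hom R X Y" "\<forall>x\<in>carrier X. g (u x) = f x"
      and v: "v \<in> lmod_hom R Y Z" "\<forall>x\<in>carrier Y. h (v x) = g x"
      using 2(4,5) by (auto simp: p arr)
    show ?case
      unfolding p(1-3) arr cmp using rh[OF p(4) lmod_hom_comp[OF u(1) v(1)]] u(2) v(2)
      by (simp add: lmod_homD(1)[OF u(1)])
  next
    case (3 p q u)
    then show ?case
      by (cases p; cases q) (auto simp: obj arr cmp idt extensional_def fun_eq_iff)
  next
    case (4 p q u)
    then show ?case
      by (cases p; cases q) (auto simp: obj arr cmp idt extensional_def fun_eq_iff lmod_homD(1))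
  next
    case (5 p q k l u v w)
    then show ?case
      by (cases p; cases q; cases k; cases l) (auto simp: obj arr cmp fun_eq_iff lmod_homD(1))
  next
    case 6
    show ?case using Obj_nonempty Dobj by blast
  next
    case (7 p q)
    then obtain X f Y g where X: "p = (X, f)" "X \<in> B" "f \<in> lmod_hom R X M"
      and Y: "q = (Y, g)" "Y \<in> B" "g \<in> lmod_hom R Y M" by (cases p; cases q) (auto simp: obj)
    obtain i h where i: "i \<in> Obj J" "h \<in> lmod_hom R X (D i)" "\<forall>x\<in>carrier X. c i (h x) = f x"
      using fp_factor[OF e fp[OF X(2)] X(3)] by blast
    obtain j k where j: "j \<in> Obj J" "k \<in> lmod_hom R Y (D j)" "\<forall>x\<in>carrier Y. c j (k x) = g x"
      using fp_factor[OF e fp[OF Y(2)] Y(3)] by blast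
    obtain l u v where l: "l \<in> Obj J" "u \<in> Arr J i l" "v \<in> Arr J j l"
      using upper[OF i(1) j(1)] by blast
    have "restrict (\<lambda>x. d i l u (h x)) (carrier X) \<in> Arr ?C p (D l, c l)"
      unfolding X(1) by (rule ext_arr[OF X(2) i(1) l(1,2) i(2,3)])
    moreover have "restrict (\<lambda>x. d j l v (k x)) (carrier Y) \<in> Arr ?C q (D l, c l)"
      unfolding Y(1) by (rule ext_arr[OF Y(2) j(1) l(1,3) j(2,3)])
    ultimately show ?case using Dobj[OF l(1)] by blast
  next
    case (8 p q u v)
    then obtain X f Y g where X: "p = (X, f)" "X \<in> B" "f \<in> lmod_hom R X M"
      and Y: "q = (Y, g)" "Y \<in> B" "g \<in> lmod_hom R Y M"
      and u: "u \<in> lmod_hom R X Y" "\<forall>x\<in>carrier X. g (u x) = f x"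
      and v: "v \<in> lmod_hom R X Y" "\<forall>x\<in>carrier X. g (v x) = f x"
      by (cases p; cases q) (auto simp: obj arr)
    obtain i h where i: "i \<in> Obj J" "h \<in> lmod_hom R Y (D i)" "\<forall>x\<in>carrier Y. c i (h x) = g x"
      using fp_factor[OF e fp[OF Y(2)] Y(3)] by blast
    have "\<exists>j\<in>Obj J. \<exists>w\<in>Arr J i j. \<forall>x\<in>carrier X. d i j w (h (u x)) = d i j w (h (v x))"
    proof (rule fp_equalize[OF e fp[OF X(2)] i(1) lmod_hom_comp[OF u(1) i(2)] lmod_hom_comp[OF v(1) i(2)]])
      fix x assume "x \<in> carrier X"
      then show "c i (h (u x)) = c i (h (v x))"
        using i(3) u(2) v(2) lmod_homD(1)[OF u(1)] lmod_homD(1)[OF v(1)] by simp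
    qed
    then obtain j w where j: "j \<in> Obj J" "w \<in> Arr J i j" "\<forall>x\<in>carrier X. d i j w (h (u x)) = d i j w (h (v x))"
      by blast
    let ?w = "restrict (\<lambda>x. d i j w (h x)) (carrier Y)"
    have "?w \<in> Arr ?C q (D j, c j)"
      unfolding Y(1) by (rule ext_arr[OF Y(2) i(1) j(1,2) i(2,3)])
    moreover have "Cmp ?C p q (D j, c j) ?w u = Cmp ?C p q (D j, c j) ?w v"
      unfolding X(1) cmp using j(3) lmod_homD(1)[OF u(1)] lmod_homD(1)[OF v(1)]
      by (intro restrict_ext) simp
    ultimately show ?case using Dobj[OF j(1)] by blast
  qed
  let ?d = "\<lambda>(p :: ('r, 'b) module \<times> ('b \<Rightarrow> 'm)) (q :: ('r, 'b) module \<times> ('b \<Rightarrow> 'm)) (u :: 'b \<Rightarrow> 'b). u"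
  have dg': "is_diagram R B ?C fst ?d"
    unfolding is_diagram_def by (auto simp: obj arr idt cmp)
  interpret C: filtered_diagram ?C R B fst ?d
    using cat R Bm dg' by (intro filtered_diagram.intro filtered_diagram_axioms.intro)
  have "explicit_colimit R ?C fst ?d M snd"
    unfolding explicit_colimit_def is_cocone_def
  proof (intro conjI ballI impI M)
    fix y assume "y \<in> carrier M"
    then obtain i x where "i \<in> Obj J" "x \<in> carrier (D i)" "c i x = y"
      using e by (auto simp: explicit_colimit_def)
    then show "\<exists>p\<in>Obj ?C. \<exists>x\<in>carrier (fst p). snd p x = y"
      by (intro bexI[of _ "(D i, c i)"] bexI[of _ x] Dobj) auto
  next
    fix p x assume "p \<in> Obj ?C" and x: "x \<in> carrier (fst p)" "snd p x = \<zero>\<^bsub>M\<^esub>"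
    then obtain X f where X: "p = (X, f)" "X \<in> B" "f \<in> lmod_hom R X M" by (cases p) (auto simp: obj)
    obtain i h where i: "i \<in> Obj J" "h \<in> lmod_hom R X (D i)" "\<forall>x\<in>carrier X. c i (h x) = f x"
      using fp_factor[OF e fp[OF X(2)] X(3)] by blast
    have "c i (h x) = \<zero>\<^bsub>M\<^esub>" "h x \<in> carrier (D i)"
      using i(3) x X(1) lmod_homD(1)[OF i(2)] by auto
    then obtain j u where j: "j \<in> Obj J" "u \<in> Arr J i j" "d i j u (h x) = \<zero>\<^bsub>D j\<^esub>"
      using e i(1) unfolding explicit_colimit_def by blast
    let ?w = "restrict (\<lambda>x. d i j u (h x)) (carrier X)"
    have "?w \<in> Arr ?C p (D j, c j)"
      unfolding X(1) by (rule ext_arr[OF X(2) i(1) j(1,2) i(2,3)])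
    moreover have "?w x = \<zero>\<^bsub>fst (D j, c j)\<^esub>" using x(1) X(1) j(3) by simp
    ultimately show "\<exists>q\<in>Obj ?C. \<exists>u\<in>Arr ?C p q. u x = \<zero>\<^bsub>fst q\<^esub>"
      by (intro bexI[OF _ Dobj[OF j(1)]] bexI[of _ ?w])
  qed (auto simp: obj arr)
  then have "is_colimit R ?C fst ?d M snd" by (rule C.explicit_imp_colimit)
  then show ?thesis unfolding lim_class_def using cat dg' by blast
qed

end

theory Submission
  imports Defs "HOL-Algebra.Product_Groups" "HOL-Analysis.Function_Topology"
begin

text \<open>
  Write \<open>T\<close> for the unit circle, \<open>M* = Hom(M, T)\<close> for the character group of a left module
  \<open>M\<close>, and \<open>M** = Hom(M*, T)\<close> for the double character module, which is again a left module.

  Membership in \<open>lim B\<close> is a lifting property: \<open>M\<close> is in \<open>lim B\<close> iff every homomorphism \<open>X \<rightarrow> M\<close>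
  with \<open>X\<close> in \<open>B\<close> that kills a finite set \<open>S \<subseteq> X\<close> factors through some \<open>X \<rightarrow> Z\<close> with \<open>Z\<close> in \<open>B\<close>
  that already kills \<open>S\<close> (\<open>lim_class_lifts\<close>, \<open>lim_class_criterion\<close>).  Given such factorizations, the
  pairs \<open>(X, X \<rightarrow> M)\<close> form a filtered category with colimit \<open>M\<close>; that the images of the \<open>X\<close> cover
  \<open>M\<close> follows from \<open>R\<close> being in \<open>lim B\<close>.  The property passes to retracts, and to quotients
  \<open>P/F\<close> by pure submodules because homomorphisms from finitely presented modules to \<open>P/F\<close> lift to
  \<open>P\<close> (\<open>lifts_through_pure_quotient\<close>).  So it is enough to treat the envelope itself.

  Coherence, applied to the product of all homomorphisms from \<open>X\<close> to members of \<open>B\<close> that kill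
  \<open>S\<close>, turns the factorizations into a single one (\<open>left_approximation\<close>): there is
  \<open>g : X \<rightarrow> Y\<close> killing \<open>S\<close>, with \<open>Y\<close> in \<open>B\<close>, such that for \<open>M\<close> in \<open>lim B\<close> every \<open>X \<rightarrow> M\<close> killing
  \<open>S\<close> extends along \<open>g\<close>.  In coordinates this says that every solution in \<open>M\<close> of one finite linear
  system admits a compatible solution of another one.  Since \<open>T\<close> is divisible, taking double characters is exact on
  abelian groups, and therefore implications of this kind pass from \<open>M\<close> to \<open>M**\<close>
  (\<open>bidual_transfer\<close>).  Hence \<open>M**\<close> has the lifting property when \<open>M\<close> does
  (\<open>bidual_lifts_through\<close>).

  Finally, let \<open>G\<close> be the copy of \<open>F\<close> inside its envelope \<open>PE\<close>.  The evaluation map \<open>G \<rightarrow> G**\<close> is a pure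
  monomorphism (\<open>evaluation_pure\<close>), so the inclusion \<open>G \<rightarrow> PE\<close> extends along it to \<open>G** \<rightarrow> PE\<close>.  In the
  other direction evaluation extends along \<open>G \<rightarrow> PE\<close> to \<open>PE \<rightarrow> G**\<close>, because a homomorphism to \<open>G**\<close>
  is a point of a compact space cut out by closed conditions, any finitely many of which are
  satisfiable by purity (\<open>pure_extension_to_bidual\<close>).  The composite \<open>PE \<rightarrow> G** \<rightarrow> PE\<close> fixes \<open>G\<close> and is
  thus bijective by the minimality of the envelope, so \<open>PE\<close> is a retract of \<open>G**\<close>.
\<close>

section \<open>Characters of abelian groups\<close>

definition character :: "('g, 'x) monoid_scheme \<Rightarrow> ('g \<Rightarrow> complex) \<Rightarrow> bool" where
  "character G \<chi> \<longleftrightarrow> (\<forall>x\<in>carrier G. norm (\<chi> x) = 1) \<and>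
     (\<forall>x\<in>carrier G. \<forall>y\<in>carrier G. \<chi> (x \<otimes>\<^bsub>G\<^esub> y) = \<chi> x * \<chi> y)"

lemma characterD:
  assumes "character G \<chi>"
  shows "x \<in> carrier G \<Longrightarrow> norm (\<chi> x) = 1"
    and "x \<in> carrier G \<Longrightarrow> y \<in> carrier G \<Longrightarrow> \<chi> (x \<otimes>\<^bsub>G\<^esub> y) = \<chi> x * \<chi> y"
    and "x \<in> carrier G \<Longrightarrow> \<chi> x \<noteq> 0"
  using assms by (auto simp: character_def)

lemma (in group) character_one:
  assumes "character G \<chi>" shows "\<chi> \<one> = 1"
proof -
  have "\<chi> \<one> * \<chi> \<one> = \<chi> \<one>" using characterD(2)[OF assms, of \<one> \<one>] by simp
  then show ?thesis using characterD(3)[OF assms, of \<one>] by simp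
qed

lemma (in group) character_inv:
  assumes "character G \<chi>" "x \<in> carrier G" shows "\<chi> (inv x) = inverse (\<chi> x)"
proof -
  have "\<chi> (inv x) * \<chi> x = 1"
    using characterD(2)[OF assms(1), of "inv x" x] assms(2) character_one[OF assms(1)] by simp
  then show ?thesis by (metis inverse_unique mult.commute)
qed

lemma (in comm_monoid) character_finprod:
  assumes "character G \<chi>" "\<chi> \<one> = 1" "f \<in> A \<rightarrow> carrier G"
  shows "\<chi> (finprod G f A) = (\<Prod>i\<in>A. \<chi> (f i))"
  using assms(3)
proof (induction A rule: infinite_finite_induct)
  case (insert i A)
  then have "f i \<in> carrier G" "f \<in> A \<rightarrow> carrier G" by auto
  then show ?case using insert characterD(2)[OF assms(1)] by simp
qed (simp_all add: assms(2))

lemma unit_root_exists: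
  fixes z :: complex
  assumes "norm z = 1" "0 < n"
  shows "\<exists>w. norm w = 1 \<and> w ^ n = z"
proof (intro exI conjI)
  show "cis (Arg z / n) ^ n = z"
    using assms rcis_cmod_Arg[of z] by (simp add: DeMoivre rcis_def)
qed simp

text \<open>
  The inductive step in extending a partial character, given by its graph \<open>\<Gamma>\<close>, to a new element
  \<open>g\<close>.  The value at \<open>g\<close> is constrained only by those powers of \<open>g\<close> that already lie in the domain.
  These are the multiples of one power \<open>g ^ n\<close>, so any \<open>n\<close>-th root of the prescribed value will do.
\<close>

lemma (in comm_group) character_step:
  assumes mult: "\<And>x y a b. \<lbrakk>(x, a) \<in> \<Gamma>; (y, b) \<in> \<Gamma>\<rbrakk> \<Longrightarrow> (x \<otimes> y, a * b) \<in> \<Gamma>"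
    and inv: "\<And>x a. (x, a) \<in> \<Gamma> \<Longrightarrow> (inv x, inverse a) \<in> \<Gamma>"
    and sub: "\<Gamma> \<subseteq> carrier G \<times> {z::complex. norm z = 1}"
    and one: "(\<one>, 1) \<in> \<Gamma>" and sv: "\<And>z. (\<one>, z) \<in> \<Gamma> \<Longrightarrow> z = 1"
    and g: "g \<in> carrier G"
  shows "\<exists>w. norm w = 1 \<and> (\<forall>k::int. \<forall>z. (g [^] k, z) \<in> \<Gamma> \<longrightarrow> z = w powi k)"
proof -
  have npow: "(x [^] n, a ^ n) \<in> \<Gamma>" if "(x, a) \<in> \<Gamma>" for x a and n :: nat
  proof (induction n)
    case (Suc n) then show ?case using mult[OF Suc that] by (simp add: mult.commute)
  qed (use one in simp)
  have ipow: "(x [^] k, a powi k) \<in> \<Gamma>" if "(x, a) \<in> \<Gamma>" for x a and k :: int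
  proof (cases "k \<ge> 0")
    case True
    then obtain n where "k = int n" using nonneg_int_cases by blast
    then show ?thesis using npow[OF that] by (simp add: int_pow_int)
  next
    case False
    then obtain n where k: "k = - int n" by (metis linorder_le_cases neg_0_le_iff_le nonneg_int_cases minus_minus)
    have "x \<in> carrier G" using that sub by auto
    then show ?thesis using inv[OF npow[OF that, of n]]
      by (simp add: k int_pow_neg int_pow_int power_int_minus)
  qed
  show ?thesis
  proof (cases "\<exists>n::nat. 0 < n \<and> (\<exists>z. (g [^] n, z) \<in> \<Gamma>)")
    case False
    have "z = 1" if "(g [^] k, z) \<in> \<Gamma>" for k :: int and z
    proof -
      have "k = 0"
      proof (rule ccontr)
        assume "k \<noteq> 0"
        then consider n where "k = int n" "0 < n" | n where "k = - int n" "0 < n"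
          by (metis int_cases2 neq0_conv of_nat_0 neg_equal_0_iff_equal)
        then show False
        proof cases
          case 1
          then have "(g [^] n, z) \<in> \<Gamma>" using that by (simp add: int_pow_int)
          then show False using False 1 by blast
        next
          case 2
          then have "(g [^] n, inverse z) \<in> \<Gamma>" using inv[OF that] g by (simp add: int_pow_neg int_pow_int)
          then show False using False 2 by blast
        qed
      qed
      then show ?thesis using that sv by simp
    qed
    then show ?thesis by (intro exI[of _ 1]) auto
  next
    case True
    define n where "n = (LEAST n::nat. 0 < n \<and> (\<exists>z. (g [^] n, z) \<in> \<Gamma>))"
    have "0 < n \<and> (\<exists>z. (g [^] n, z) \<in> \<Gamma>)" unfolding n_def by (rule LeastI_ex[OF True])
    then obtain z0 where n: "0 < n" "(g [^] n, z0) \<in> \<Gamma>" by blast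
    obtain w where w: "norm w = 1" "w ^ n = z0" using unit_root_exists[of z0 n] n sub by auto
    have w0: "w \<noteq> 0" using w(1) by auto
    have "z = w powi k" if k: "(g [^] k, z) \<in> \<Gamma>" for k :: int and z
    proof -
      define q r where "q = k div int n" and "r = nat (k mod int n)"
      have r: "r < n" "k = int n * q + int r" using n by (auto simp: q_def r_def nat_less_iff)
      have "(g [^] k \<otimes> (g [^] n) [^] (- q), z * z0 powi (- q)) \<in> \<Gamma>" by (intro mult k ipow n)
      moreover have "g [^] k \<otimes> (g [^] n) [^] (- q) = g [^] int r"
      proof -
        have "(g [^] n) [^] (- q) = g [^] (int n * (- q))"
          using g by (metis int_pow_int int_pow_pow)
        then show ?thesis using g by (simp add: int_pow_mult[symmetric] r(2))
      qed
      ultimately have *: "(g [^] r, z * z0 powi (- q)) \<in> \<Gamma>" by (simp add: int_pow_int)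
      have "r = 0"
        using not_less_Least[of r "\<lambda>n. 0 < n \<and> (\<exists>z. (g [^] n, z) \<in> \<Gamma>)"] r(1) * unfolding n_def[symmetric] by auto
      then have "z * z0 powi (- q) = 1" using * sv by simp
      moreover have "z0 \<noteq> 0" using w0 w(2) by auto
      ultimately have "z = z0 powi q" by (simp add: power_int_minus field_simps)
      also have "\<dots> = w powi (int n * q)" by (simp add: w(2)[symmetric] power_int_mult)
      finally show ?thesis using r \<open>r = 0\<close> by simp
    qed
    then show ?thesis using w(1) by blast
  qed
qed

text \<open>
  The circle is divisible, hence injective as an abelian group.  Zorn's lemma is applied to
  graphs, for which unions of chains need no gluing.
\<close>

lemma (in comm_group) character_extension:
  assumes H: "subgroup H G" and \<chi>: "character (G\<lparr>carrier := H\<rparr>) \<chi>"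
  shows "\<exists>\<theta>. character G \<theta> \<and> (\<forall>h\<in>H. \<theta> h = \<chi> h)"
proof -
  interpret H: subgroup H G by fact
  interpret GH: group "G\<lparr>carrier := H\<rparr>" by (rule subgroup.subgroup_is_group[OF H is_group])
  have \<chi>1: "\<chi> \<one> = 1" using GH.character_one[OF \<chi>] by simp
  define gr where "gr = (\<lambda>h. (h, \<chi> h)) ` H"
  define partial where "partial = {\<Gamma>. gr \<subseteq> \<Gamma> \<and> \<Gamma> \<subseteq> carrier G \<times> {z. norm z = 1} \<and>
    (\<forall>x a y b. (x, a) \<in> \<Gamma> \<longrightarrow> (y, b) \<in> \<Gamma> \<longrightarrow> (x \<otimes> y, a * b) \<in> \<Gamma>) \<and>
    (\<forall>x a. (x, a) \<in> \<Gamma> \<longrightarrow> (inv x, inverse a) \<in> \<Gamma>) \<and> (\<forall>z. (\<one>, z) \<in> \<Gamma> \<longrightarrow> z = 1)}"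
  have "gr \<in> partial"
    using characterD[OF \<chi>] \<chi>1 H.subset GH.character_inv[OF \<chi>] m_inv_consistent[OF H]
    by (auto simp: partial_def gr_def H.m_inv_closed)
  then have ne: "partial \<noteq> {}" by blast
  have "\<exists>\<Gamma>\<in>partial. \<forall>\<Delta>\<in>partial. \<Gamma> \<subseteq> \<Delta> \<longrightarrow> \<Delta> = \<Gamma>"
  proof (rule subset_Zorn_nonempty[OF ne])
    fix \<C> assume C: "\<C> \<noteq> {}" "subset.chain partial \<C>"
    have el: "\<Gamma> \<in> partial" if "\<Gamma> \<in> \<C>" for \<Gamma> using C(2) that by (auto simp: subset.chain_def)
    have two: "\<exists>\<Gamma>\<in>\<C>. p \<in> \<Gamma> \<and> q \<in> \<Gamma>" if pq: "p \<in> \<Union>\<C>" "q \<in> \<Union>\<C>" for p q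
    proof -
      obtain \<Gamma> \<Delta> where "\<Gamma> \<in> \<C>" "\<Delta> \<in> \<C>" "p \<in> \<Gamma>" "q \<in> \<Delta>" using pq by blast
      moreover have "\<Gamma> \<subseteq> \<Delta> \<or> \<Delta> \<subseteq> \<Gamma>"
        using C(2) calculation(1,2) by (simp add: subset_chain_def)
      ultimately show ?thesis by blast
    qed
    have m: "(x \<otimes> y, a * b) \<in> \<Union>\<C>" if xy: "(x, a) \<in> \<Union>\<C>" "(y, b) \<in> \<Union>\<C>" for x a y b
      using two[OF xy] el unfolding partial_def by blast
    have "\<exists>\<Gamma>. \<Gamma> \<in> \<C>" using C by blast
    then have "gr \<subseteq> \<Union>\<C>" using el unfolding partial_def by blast
    moreover have "\<Union>\<C> \<subseteq> carrier G \<times> {z. norm z = 1}" using el by (force simp: partial_def)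
    moreover have "(inv x, inverse a) \<in> \<Union>\<C>" if "(x, a) \<in> \<Union>\<C>" for x a
      using that el unfolding partial_def by blast
    moreover have "z = 1" if "(\<one>, z) \<in> \<Union>\<C>" for z
      using that el unfolding partial_def by blast
    ultimately show "\<Union>\<C> \<in> partial" using m unfolding partial_def by blast
  qed
  then obtain \<Gamma> where \<Gamma>: "\<Gamma> \<in> partial" and max: "\<And>\<Delta>. \<Delta> \<in> partial \<Longrightarrow> \<Gamma> \<subseteq> \<Delta> \<Longrightarrow> \<Delta> = \<Gamma>" by blast
  have gr: "gr \<subseteq> \<Gamma>" and sub: "\<Gamma> \<subseteq> carrier G \<times> {z. norm z = 1}"
    and mult: "\<And>x a y b. (x, a) \<in> \<Gamma> \<Longrightarrow> (y, b) \<in> \<Gamma> \<Longrightarrow> (x \<otimes> y, a * b) \<in> \<Gamma>"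
    and inv: "\<And>x a. (x, a) \<in> \<Gamma> \<Longrightarrow> (inv x, inverse a) \<in> \<Gamma>"
    and sv: "\<And>z. (\<one>, z) \<in> \<Gamma> \<Longrightarrow> z = 1" using \<Gamma> unfolding partial_def by blast+
  have one: "(\<one>, 1) \<in> \<Gamma>" using gr \<chi>1 H.one_closed unfolding gr_def by force
  have total: "\<exists>w. (g, w) \<in> \<Gamma>" if g: "g \<in> carrier G" for g
  proof -
    obtain w where w: "norm w = 1" "\<And>(k::int) z. (g [^] k, z) \<in> \<Gamma> \<Longrightarrow> z = w powi k"
      using character_step[OF mult inv sub one sv g] by blast
    have w0: "w \<noteq> 0" using w(1) by auto
    define \<Delta> where "\<Delta> = {(x \<otimes> g [^] k, a * w powi k) | x a (k::int). (x, a) \<in> \<Gamma>}"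
    have \<Delta>I: "(x \<otimes> g [^] k, a * w powi k) \<in> \<Delta>" if "(x, a) \<in> \<Gamma>" for x a and k :: int
      using that unfolding \<Delta>_def by blast
    have in_G: "x \<in> carrier G" "norm a = 1" if "(x, a) \<in> \<Gamma>" for x a using that sub by auto
    have le: "\<Gamma> \<subseteq> \<Delta>"
    proof
      fix p assume p: "p \<in> \<Gamma>"
      obtain x a where xa: "p = (x, a)" by (cases p)
      then show "p \<in> \<Delta>" using \<Delta>I[of x a 0] p in_G by simp
    qed
    have "\<Delta> \<in> partial"
      unfolding partial_def mem_Collect_eq
    proof (intro conjI allI impI)
      show "gr \<subseteq> \<Delta>" using gr le by blast
      show "\<Delta> \<subseteq> carrier G \<times> {z. norm z = 1}"
        using in_G g w(1) by (auto simp: \<Delta>_def norm_mult norm_power_int)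
    next
      fix x a y b assume "(x, a) \<in> \<Delta>" "(y, b) \<in> \<Delta>"
      then obtain x' a' y' b' and k l :: int where
        x: "x = x' \<otimes> g [^] k" "a = a' * w powi k" "(x', a') \<in> \<Gamma>" and
        y: "y = y' \<otimes> g [^] l" "b = b' * w powi l" "(y', b') \<in> \<Gamma>"
        unfolding \<Delta>_def by blast
      have "x \<otimes> y = (x' \<otimes> y') \<otimes> g [^] (k + l)"
        using in_G(1)[OF x(3)] in_G(1)[OF y(3)] g by (simp add: x y int_pow_mult m_ac)
      moreover have "a * b = (a' * b') * w powi (k + l)" by (simp add: x y power_int_add w0)
      ultimately show "(x \<otimes> y, a * b) \<in> \<Delta>" using \<Delta>I[OF mult[OF x(3) y(3)], of "k + l"] by simp
    next
      fix x a assume "(x, a) \<in> \<Delta>"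
      then obtain x' a' and k :: int where x: "x = x' \<otimes> g [^] k" "a = a' * w powi k" "(x', a') \<in> \<Gamma>"
        unfolding \<Delta>_def by blast
      have "inv x = inv x' \<otimes> g [^] (- k)"
        using in_G(1)[OF x(3)] g by (simp add: x inv_mult int_pow_neg)
      moreover have "inverse a = inverse a' * w powi (- k)" by (simp add: x power_int_minus)
      ultimately show "(inv x, inverse a) \<in> \<Delta>" using \<Delta>I[OF inv[OF x(3)], of "- k"] by simp
    next
      fix z assume "(\<one>, z) \<in> \<Delta>"
      then obtain x a and k :: int where x: "\<one> = x \<otimes> g [^] k" "z = a * w powi k" "(x, a) \<in> \<Gamma>"
        unfolding \<Delta>_def by blast
      have "x = inv (g [^] k)" using x(1) in_G(1)[OF x(3)] g by (metis int_pow_closed inv_equality)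
      then have "x = g [^] (- k)" using g by (simp add: int_pow_neg)
      then have "a = w powi (- k)" using w(2) x(3) by blast
      then show "z = 1" using w0 by (simp add: x(2) power_int_minus)
    qed
    then have "\<Delta> = \<Gamma>" using max le by blast
    moreover have "(g, w) \<in> \<Delta>" using \<Delta>I[OF one, of 1] g by simp
    ultimately show ?thesis by blast
  qed
  have unique: "a = b" if "(x, a) \<in> \<Gamma>" "(x, b) \<in> \<Gamma>" for x a b
  proof -
    have x: "x \<in> carrier G" "a \<noteq> 0" "b \<noteq> 0" using that sub by force+
    have "(\<one>, a * inverse b) \<in> \<Gamma>" using mult[OF that(1) inv[OF that(2)]] x by simp
    then show ?thesis using sv[of "a * inverse b"] x by (simp add: field_simps)
  qed
  define \<theta> where "\<theta> x = (SOME a. (x, a) \<in> \<Gamma>)" for x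
  have \<theta>: "(x, \<theta> x) \<in> \<Gamma>" if "x \<in> carrier G" for x
    unfolding \<theta>_def by (rule someI_ex[OF total[OF that]])
  have "character G \<theta>"
    unfolding character_def
  proof (intro conjI ballI)
    fix x assume "x \<in> carrier G" then show "norm (\<theta> x) = 1" using \<theta> sub by auto
  next
    fix x y assume xy: "x \<in> carrier G" "y \<in> carrier G"
    show "\<theta> (x \<otimes> y) = \<theta> x * \<theta> y" by (rule unique[OF \<theta> mult[OF \<theta> \<theta>]]) (use xy in auto)
  qed
  moreover have "\<theta> h = \<chi> h" if "h \<in> H" for h
    using unique[OF \<theta>, of h "\<chi> h"] gr that H.subset by (auto simp: gr_def)
  ultimately show ?thesis by blast
qed

text \<open>
  Injectivity of the circle in the form in which it is used: a character that vanishes on the kernel of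
  \<open>u\<close> factors through \<open>u\<close>.
\<close>

lemma character_along_hom:
  assumes S: "group S" and G: "comm_group G" and u: "u \<in> hom S G" and \<chi>: "character S \<chi>"
    and ker: "\<And>s. \<lbrakk>s \<in> carrier S; u s = \<one>\<^bsub>G\<^esub>\<rbrakk> \<Longrightarrow> \<chi> s = 1"
  shows "\<exists>\<theta>. character G \<theta> \<and> (\<forall>s\<in>carrier S. \<chi> s = \<theta> (u s))"
proof -
  interpret S: group S by fact
  interpret G: comm_group G by fact
  interpret u: group_hom S G u by unfold_locales (rule u)
  have eq: "\<chi> s = \<chi> t" if "s \<in> carrier S" "t \<in> carrier S" "u s = u t" for s t
  proof -
    have "\<chi> (s \<otimes>\<^bsub>S\<^esub> inv\<^bsub>S\<^esub> t) = 1" using that by (intro ker) simp_all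
    then show ?thesis
      using that characterD[OF \<chi>] S.character_inv[OF \<chi>] by (simp add: field_simps)
  qed
  define \<phi> where "\<phi> x = \<chi> (SOME s. s \<in> carrier S \<and> u s = x)" for x
  have \<phi>: "\<phi> (u s) = \<chi> s" if "s \<in> carrier S" for s
  proof -
    have "\<exists>t. t \<in> carrier S \<and> u t = u s" using that by blast
    from someI_ex[OF this] show ?thesis unfolding \<phi>_def using eq that by blast
  qed
  have "character (G\<lparr>carrier := u ` carrier S\<rparr>) \<phi>"
    unfolding character_def
  proof (intro conjI ballI; simp; elim imageE; simp)
    fix s t assume st: "s \<in> carrier S" "t \<in> carrier S"
    show "norm (\<phi> (u s)) = 1" using characterD(1)[OF \<chi>] st by (simp add: \<phi>)
    have "\<phi> (u (s \<otimes>\<^bsub>S\<^esub> t)) = \<phi> (u s) * \<phi> (u t)"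
      using characterD(2)[OF \<chi>] st by (simp only: \<phi> S.m_closed)
    then show "\<phi> (u s \<otimes>\<^bsub>G\<^esub> u t) = \<phi> (u s) * \<phi> (u t)" using st by simp
  qed
  from G.character_extension[OF u.img_is_subgroup this]
  obtain \<theta> where "character G \<theta>" "\<And>s. s \<in> carrier S \<Longrightarrow> \<theta> (u s) = \<phi> (u s)" by blast
  then show ?thesis using \<phi> by metis
qed

text \<open>
  The same for a homomorphism \<open>S \<rightarrow> G\<^sup>I\<close> with finite \<open>I\<close>, whose target has as characters exactly the
  \<open>I\<close>-indexed families of characters of \<open>G\<close>.  Induction on \<open>I\<close> avoids that identification: after
  restriction to the kernel of one component the other components suffice, and what is left over
  factors through that component.
\<close>

lemma character_along_family:
  assumes I: "finite I" and S: "group S" and G: "comm_group G"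
    and u: "\<And>i. i \<in> I \<Longrightarrow> u i \<in> hom S G" and \<chi>: "character S \<chi>"
    and ker: "\<And>s. \<lbrakk>s \<in> carrier S; \<And>i. i \<in> I \<Longrightarrow> u i s = \<one>\<^bsub>G\<^esub>\<rbrakk> \<Longrightarrow> \<chi> s = 1"
  shows "\<exists>\<theta>. (\<forall>i\<in>I. character G (\<theta> i)) \<and> (\<forall>s\<in>carrier S. \<chi> s = (\<Prod>i\<in>I. \<theta> i (u i s)))"
  using I S u \<chi> ker
proof (induction I arbitrary: S rule: finite_induct)
  case empty
  then show ?case by simp
next
  case (insert i I)
  interpret S: group S by (rule insert.prems(1))
  interpret G: comm_group G by (rule G)
  interpret ui: group_hom S G "u i" by unfold_locales (use insert.prems(2) in simp)
  let ?K = "S\<lparr>carrier := kernel S G (u i)\<rparr>"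
  have K: "kernel S G (u i) \<subseteq> carrier S" by (auto simp: kernel_def)
  have "\<exists>\<theta>. (\<forall>j\<in>I. character G (\<theta> j)) \<and> (\<forall>s\<in>carrier ?K. \<chi> s = (\<Prod>j\<in>I. \<theta> j (u j s)))"
  proof (rule insert.IH)
    show "group ?K" by (rule subgroup.subgroup_is_group[OF ui.subgroup_kernel S.is_group])
    show "u j \<in> hom ?K G" if "j \<in> I" for j
      using insert.prems(2)[of j] that K by (auto simp: hom_def)
    show "character ?K \<chi>" using characterD(1,2)[OF insert.prems(3)] subsetD[OF K] by (simp add: character_def)
    show "\<chi> s = 1" if "s \<in> carrier ?K" "\<And>j. j \<in> I \<Longrightarrow> u j s = \<one>\<^bsub>G\<^esub>" for s
      using that K by (intro insert.prems(4)) (auto simp: kernel_def)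
  qed
  then obtain \<theta> where \<theta>: "\<And>j. j \<in> I \<Longrightarrow> character G (\<theta> j)"
    "\<And>s. s \<in> kernel S G (u i) \<Longrightarrow> \<chi> s = (\<Prod>j\<in>I. \<theta> j (u j s))" by auto
  let ?P = "\<lambda>s. \<Prod>j\<in>I. \<theta> j (u j s)"
  have uc: "u j s \<in> carrier G" if "j \<in> I" "s \<in> carrier S" for j s
    using insert.prems(2)[of j] that by (auto simp: hom_def)
  have um: "u j (s \<otimes>\<^bsub>S\<^esub> t) = u j s \<otimes>\<^bsub>G\<^esub> u j t" if "j \<in> I" "s \<in> carrier S" "t \<in> carrier S" for j s t
    using insert.prems(2)[of j] that by (auto simp: hom_def)
  have P0: "?P s \<noteq> 0" if "s \<in> carrier S" for s
    using insert.hyps(1) that characterD(3)[OF \<theta>(1) uc] by simp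
  have "character S (\<lambda>s. \<chi> s / ?P s)"
    using characterD[OF insert.prems(3)] characterD(1,2)[OF \<theta>(1)] uc um
    by (simp add: character_def norm_divide prod_norm[symmetric] prod.distrib)
  moreover have "\<chi> s / ?P s = 1" if "s \<in> carrier S" "u i s = \<one>\<^bsub>G\<^esub>" for s
    using \<theta>(2)[of s] P0[of s] that by (simp add: kernel_def)
  ultimately obtain \<omega> where \<omega>: "character G \<omega>" "\<And>s. s \<in> carrier S \<Longrightarrow> \<chi> s / ?P s = \<omega> (u i s)"
    using character_along_hom[OF S.is_group G ui.homh] by blast
  show ?case
  proof (intro exI[of _ "\<theta>(i := \<omega>)"] conjI ballI)
    fix j assume "j \<in> insert i I" then show "character G ((\<theta>(i := \<omega>)) j)" using \<theta>(1) \<omega>(1) by auto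
  next
    fix s assume s: "s \<in> carrier S"
    have "(\<Prod>j\<in>insert i I. (\<theta>(i := \<omega>)) j (u j s)) = \<omega> (u i s) * ?P s"
      using insert.hyps by (auto intro!: prod.cong arg_cong2[where f="(*)"])
    also have "\<dots> = \<chi> s" using \<omega>(2)[OF s, symmetric] P0[OF s] by simp
    finally show "\<chi> s = (\<Prod>j\<in>insert i I. (\<theta>(i := \<omega>)) j (u j s))" by simp
  qed
qed

definition char_group :: "('g, 'x) monoid_scheme \<Rightarrow> ('g \<Rightarrow> complex) monoid" where
  "char_group G = \<lparr>carrier = {\<chi>. character G \<chi> \<and> \<chi> \<in> extensional (carrier G)},
     mult = (\<lambda>\<chi> \<psi>. \<lambda>x\<in>carrier G. \<chi> x * \<psi> x), one = (\<lambda>x\<in>carrier G. 1)\<rparr>"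

lemma char_groupD:
  assumes "\<chi> \<in> carrier (char_group G)"
  shows "character G \<chi>" "\<chi> \<in> extensional (carrier G)"
  using assms by (auto simp: char_group_def)

lemma char_group_mult: "x \<in> carrier G \<Longrightarrow> (\<chi> \<otimes>\<^bsub>char_group G\<^esub> \<psi>) x = \<chi> x * \<psi> x"
  by (simp add: char_group_def)

lemma char_group_one: "x \<in> carrier G \<Longrightarrow> \<one>\<^bsub>char_group G\<^esub> x = 1"
  by (simp add: char_group_def)

lemma char_group_eqI:
  assumes "\<chi> \<in> carrier (char_group G)" "\<psi> \<in> carrier (char_group G)"
    and "\<And>x. x \<in> carrier G \<Longrightarrow> \<chi> x = \<psi> x"
  shows "\<chi> = \<psi>"
  using extensionalityI[OF char_groupD(2)[OF assms(1)] char_groupD(2)[OF assms(2)]] assms(3) by blast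

lemma restrict_character:
  assumes "group G" "character G \<chi>" shows "restrict \<chi> (carrier G) \<in> carrier (char_group G)"
proof -
  interpret group G by fact
  show ?thesis using characterD[OF assms(2)] by (auto simp: char_group_def character_def)
qed

lemma char_group_comm_group:
  assumes "group G" shows "comm_group (char_group G)"
proof -
  interpret group G by fact
  note cl = restrict_character[OF assms]
  have m: "\<chi> \<otimes>\<^bsub>char_group G\<^esub> \<psi> \<in> carrier (char_group G)"
    if "\<chi> \<in> carrier (char_group G)" "\<psi> \<in> carrier (char_group G)" for \<chi> \<psi>
    using cl[of "\<lambda>x. \<chi> x * \<psi> x"] characterD[OF char_groupD(1)[OF that(1)]]
      characterD[OF char_groupD(1)[OF that(2)]]
    by (simp add: char_group_def character_def norm_mult)
  have o: "\<one>\<^bsub>char_group G\<^esub> \<in> carrier (char_group G)"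
    using cl[of "\<lambda>x. 1"] by (simp add: char_group_def character_def)
  have i: "(\<lambda>x\<in>carrier G. inverse (\<chi> x)) \<in> carrier (char_group G)"
    if "\<chi> \<in> carrier (char_group G)" for \<chi>
    using characterD[OF char_groupD(1)[OF that]]
    by (intro cl) (simp add: character_def norm_inverse)
  show ?thesis
  proof (rule comm_groupI)
    fix \<chi> assume \<chi>: "\<chi> \<in> carrier (char_group G)"
    show "\<exists>\<psi>\<in>carrier (char_group G). \<psi> \<otimes>\<^bsub>char_group G\<^esub> \<chi> = \<one>\<^bsub>char_group G\<^esub>"
      using characterD(3)[OF char_groupD(1)[OF \<chi>]]
      by (intro bexI[OF _ i[OF \<chi>]] char_group_eqI[OF m[OF i[OF \<chi>] \<chi>] o])
        (simp add: char_group_mult char_group_one)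
    show "\<one>\<^bsub>char_group G\<^esub> \<otimes>\<^bsub>char_group G\<^esub> \<chi> = \<chi>"
      by (rule char_group_eqI[OF m[OF o \<chi>] \<chi>]) (simp add: char_group_mult char_group_one)
  next
    fix \<chi> \<psi> assume *: "\<chi> \<in> carrier (char_group G)" "\<psi> \<in> carrier (char_group G)"
    show "\<chi> \<otimes>\<^bsub>char_group G\<^esub> \<psi> = \<psi> \<otimes>\<^bsub>char_group G\<^esub> \<chi>"
      by (rule char_group_eqI[OF m[OF *] m[OF *(2,1)]]) (simp add: char_group_mult)
  next
    fix \<chi> \<psi> \<rho>
    assume *: "\<chi> \<in> carrier (char_group G)" "\<psi> \<in> carrier (char_group G)" "\<rho> \<in> carrier (char_group G)"
    show "\<chi> \<otimes>\<^bsub>char_group G\<^esub> \<psi> \<otimes>\<^bsub>char_group G\<^esub> \<rho> = \<chi> \<otimes>\<^bsub>char_group G\<^esub> (\<psi> \<otimes>\<^bsub>char_group G\<^esub> \<rho>)"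
      by (rule char_group_eqI[OF m[OF m[OF *(1,2)] *(3)] m[OF *(1) m[OF *(2,3)]]])
        (simp add: char_group_mult)
  qed (use m o in auto)
qed

lemma char_group_finprod:
  assumes G: "group G" and f: "f \<in> A \<rightarrow> carrier (char_group G)" and x: "x \<in> carrier G"
  shows "finprod (char_group G) f A x = (\<Prod>i\<in>A. f i x)"
proof -
  interpret C: comm_group "char_group G" by (rule char_group_comm_group[OF G])
  show ?thesis
    using f
  proof (induction A rule: infinite_finite_induct)
    case (insert i A)
    then have "f i \<in> carrier (char_group G)" "f \<in> A \<rightarrow> carrier (char_group G)" by auto
    then show ?case using insert by (simp add: char_group_mult[OF x])
  qed (simp_all add: char_group_one[OF x])
qed

section \<open>Linear combinations\<close>

definition lin_comb :: "('r, 'm) module \<Rightarrow> nat \<Rightarrow> (nat \<Rightarrow> 'm) \<Rightarrow> (nat \<Rightarrow> 'r) \<Rightarrow> 'm" where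
  "lin_comb M n a r = (\<Oplus>\<^bsub>M\<^esub>l\<in>{..<n}. r l \<odot>\<^bsub>M\<^esub> a l)"

lemma free_module_coeff: "r \<in> carrier (free_module R n) \<Longrightarrow> l < n \<Longrightarrow> r l \<in> carrier R"
  by (auto simp: free_module_def prod_module_def regular_module_def)

lemma lin_comb_hom:
  assumes "left_module R M" "\<And>l. l < n \<Longrightarrow> a l \<in> carrier M"
  shows "lin_comb M n a \<in> lmod_hom R (free_module R n) M"
  using free_hom_exists[OF assms] by (simp add: lin_comb_def[abs_def])

lemmas lin_comb_closed = lmod_homD(1)[OF lin_comb_hom]

lemma free_hom_lin_comb:
  assumes "left_module R M" "s \<in> lmod_hom R (free_module R n) M" "r \<in> carrier (free_module R n)"
  shows "s r = lin_comb M n (\<lambda>l. s (unit_vec R n l)) r"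
  using free_hom_expand[OF assms] by (simp add: lin_comb_def)

lemma lin_comb_cong:
  assumes M: "left_module R M" and a: "\<And>l. l < n \<Longrightarrow> a l \<in> carrier M"
    and b: "\<And>l. l < n \<Longrightarrow> a l = b l" and r: "r \<in> carrier (free_module R n)"
  shows "lin_comb M n a r = lin_comb M n b r"
proof -
  interpret M: left_module R M by fact
  show ?thesis
    unfolding lin_comb_def
  proof (intro M.add.finprod_cong')
    have "b l \<in> carrier M" if "l < n" for l using a[OF that] b[OF that] by simp
    then show "(\<lambda>l. r l \<odot>\<^bsub>M\<^esub> b l) \<in> {..<n} \<rightarrow> carrier M" using free_module_coeff[OF r] by auto
  qed (use b in auto)
qed

lemma lin_comb_single:
  assumes M: "left_module R M" and r: "r \<in> carrier (free_module R n)" and l: "l < n"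
    and y: "y \<in> carrier M"
  shows "lin_comb M n (\<lambda>i. if i = l then y else \<zero>\<^bsub>M\<^esub>) r = r l \<odot>\<^bsub>M\<^esub> y"
proof -
  interpret M: left_module R M by fact
  have rc: "r i \<in> carrier R" if "i < n" for i using free_module_coeff[OF r that] .
  have "lin_comb M n (\<lambda>i. if i = l then y else \<zero>\<^bsub>M\<^esub>) r =
      (\<Oplus>\<^bsub>M\<^esub>i\<in>{..<n}. if l = i then r i \<odot>\<^bsub>M\<^esub> y else \<zero>\<^bsub>M\<^esub>)"
    unfolding lin_comb_def using rc y by (intro M.add.finprod_cong') (auto simp: M.smult_zero)
  also have "\<dots> = r l \<odot>\<^bsub>M\<^esub> y"
    using rc y l by (intro M.add.finprod_singleton) auto
  finally show ?thesis .
qed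

lemma lin_comb_unit:
  assumes M: "left_module R M" and a: "\<And>i. i < n \<Longrightarrow> a i \<in> carrier M" and l: "l < n"
  shows "lin_comb M n a (unit_vec R n l) = a l"
proof -
  interpret M: left_module R M by fact
  have "lin_comb M n a (unit_vec R n l) = (\<Oplus>\<^bsub>M\<^esub>i\<in>{..<n}. if l = i then a i else \<zero>\<^bsub>M\<^esub>)"
    unfolding lin_comb_def using a by (intro M.add.finprod_cong') (auto simp: unit_vec_def M.zero_smult)
  also have "\<dots> = a l" using a l by (intro M.add.finprod_singleton) auto
  finally show ?thesis .
qed

lemma hom_lin_comb:
  assumes M: "left_module R M" and N: "left_module R N" and f: "f \<in> lmod_hom R M N"
    and a: "\<And>l. l < n \<Longrightarrow> a l \<in> carrier M" and r: "r \<in> carrier (free_module R n)"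
  shows "f (lin_comb M n a r) = lin_comb N n (\<lambda>l. f (a l)) r"
proof -
  let ?s = "\<lambda>r. f (lin_comb M n a r)"
  have "?s \<in> lmod_hom R (free_module R n) N"
    by (rule lmod_hom_comp[OF lin_comb_hom[OF M] f]) (rule a)
  from free_hom_lin_comb[OF N this r]
  have "?s r = lin_comb N n (\<lambda>l. ?s (unit_vec R n l)) r" .
  also have "\<dots> = lin_comb N n (\<lambda>l. f (a l)) r"
    using lin_comb_unit[OF M a] lmod_homD(1)[OF f] a by (intro lin_comb_cong[OF N _ _ r]) auto
  finally show ?thesis .
qed

lemma lin_comb_add:
  assumes M: "left_module R M" and r: "r \<in> carrier (free_module R n)"
    and a: "\<And>l. l < n \<Longrightarrow> a l \<in> carrier M" and b: "\<And>l. l < n \<Longrightarrow> b l \<in> carrier M"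
  shows "lin_comb M n (\<lambda>l. a l \<oplus>\<^bsub>M\<^esub> b l) r = lin_comb M n a r \<oplus>\<^bsub>M\<^esub> lin_comb M n b r"
proof -
  interpret M: left_module R M by fact
  have rc: "r i \<in> carrier R" if "i < n" for i using free_module_coeff[OF r that] .
  have "lin_comb M n (\<lambda>l. a l \<oplus>\<^bsub>M\<^esub> b l) r =
      (\<Oplus>\<^bsub>M\<^esub>l\<in>{..<n}. r l \<odot>\<^bsub>M\<^esub> a l \<oplus>\<^bsub>M\<^esub> r l \<odot>\<^bsub>M\<^esub> b l)"
    unfolding lin_comb_def using rc a b by (intro M.add.finprod_cong') (auto simp: M.smult_r_distr)
  also have "\<dots> = lin_comb M n a r \<oplus>\<^bsub>M\<^esub> lin_comb M n b r"
    unfolding lin_comb_def using rc a b by (intro M.M.finsum_addf) auto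
  finally show ?thesis .
qed

section \<open>The double character module\<close>

abbreviation dual :: "('r, 'm) module \<Rightarrow> ('m \<Rightarrow> complex) monoid" where
  "dual M \<equiv> char_group (add_monoid M)"

text \<open>
  The right action of the ring on characters.
\<close>

definition act :: "('r, 'm) module \<Rightarrow> ('m \<Rightarrow> complex) \<Rightarrow> 'r \<Rightarrow> 'm \<Rightarrow> complex" where
  "act M \<chi> r = (\<lambda>x\<in>carrier M. \<chi> (r \<odot>\<^bsub>M\<^esub> x))"

definition bidual :: "('r, 'm) module \<Rightarrow> ('r, ('m \<Rightarrow> complex) \<Rightarrow> complex) module" where
  "bidual M = \<lparr>carrier = carrier (char_group (dual M)),
     mult = (\<otimes>\<^bsub>char_group (dual M)\<^esub>), one = \<one>\<^bsub>char_group (dual M)\<^esub>,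
     zero = \<one>\<^bsub>char_group (dual M)\<^esub>, add = (\<otimes>\<^bsub>char_group (dual M)\<^esub>),
     smult = (\<lambda>r \<xi>. \<lambda>\<chi>\<in>carrier (dual M). \<xi> (act M \<chi> r))\<rparr>"

definition evaluation :: "('r, 'm) module \<Rightarrow> 'm \<Rightarrow> ('m \<Rightarrow> complex) \<Rightarrow> complex" where
  "evaluation M x = (\<lambda>\<chi>\<in>carrier (dual M). \<chi> x)"

lemma (in left_module) dual_comm_group: "comm_group (dual M)"
  by (intro char_group_comm_group M.a_group)

lemma (in left_module) dualD:
  assumes "\<chi> \<in> carrier (dual M)"
  shows "x \<in> carrier M \<Longrightarrow> norm (\<chi> x) = 1"
    and "x \<in> carrier M \<Longrightarrow> y \<in> carrier M \<Longrightarrow> \<chi> (x \<oplus>\<^bsub>M\<^esub> y) = \<chi> x * \<chi> y"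
    and "\<chi> \<zero>\<^bsub>M\<^esub> = 1"
  using characterD[OF char_groupD(1)[OF assms]] group.character_one[OF M.a_group char_groupD(1)[OF assms]]
  by simp_all

lemma (in left_module) dualI:
  assumes "\<chi> \<in> extensional (carrier M)" "\<And>x. x \<in> carrier M \<Longrightarrow> norm (\<chi> x) = 1"
    and "\<And>x y. x \<in> carrier M \<Longrightarrow> y \<in> carrier M \<Longrightarrow> \<chi> (x \<oplus>\<^bsub>M\<^esub> y) = \<chi> x * \<chi> y"
  shows "\<chi> \<in> carrier (dual M)"
  using assms by (simp add: char_group_def character_def)

lemma dual_eqI:
  assumes "\<chi> \<in> carrier (dual M)" "\<psi> \<in> carrier (dual M)" "\<And>x. x \<in> carrier M \<Longrightarrow> \<chi> x = \<psi> x"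
  shows "\<chi> = \<psi>"
  using char_group_eqI[OF assms(1,2)] assms(3) by simp

lemma dual_ops:
  assumes "x \<in> carrier M"
  shows "(\<chi> \<otimes>\<^bsub>dual M\<^esub> \<psi>) x = \<chi> x * \<psi> x" "\<one>\<^bsub>dual M\<^esub> x = 1"
  using assms by (simp_all add: char_group_def)

lemma act_apply: "x \<in> carrier M \<Longrightarrow> act M \<chi> r x = \<chi> (r \<odot>\<^bsub>M\<^esub> x)"
  by (simp add: act_def)

lemma (in left_module) act_closed:
  assumes \<chi>: "\<chi> \<in> carrier (dual M)" and r: "r \<in> carrier R"
  shows "act M \<chi> r \<in> carrier (dual M)"
  using r by (intro dualI) (simp_all add: act_def dualD[OF \<chi>] smult_r_distr)

lemma (in left_module) act_mult:
  assumes \<chi>: "\<chi> \<in> carrier (dual M)" "\<psi> \<in> carrier (dual M)" and r: "r \<in> carrier R"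
  shows "act M (\<chi> \<otimes>\<^bsub>dual M\<^esub> \<psi>) r = act M \<chi> r \<otimes>\<^bsub>dual M\<^esub> act M \<psi> r"
proof -
  interpret D: comm_group "dual M" by (rule dual_comm_group)
  show ?thesis
    using \<chi> r by (intro dual_eqI[where M=M] act_closed D.m_closed) (simp_all add: act_apply dual_ops)
qed

lemma bidualD:
  assumes M: "left_module R M" and \<xi>: "\<xi> \<in> carrier (bidual M)"
  shows "character (dual M) \<xi>"
    and "\<chi> \<in> carrier (dual M) \<Longrightarrow> norm (\<xi> \<chi>) = 1"
    and "\<chi> \<in> carrier (dual M) \<Longrightarrow> \<psi> \<in> carrier (dual M) \<Longrightarrow> \<xi> (\<chi> \<otimes>\<^bsub>dual M\<^esub> \<psi>) = \<xi> \<chi> * \<xi> \<psi>"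
    and "\<xi> \<one>\<^bsub>dual M\<^esub> = 1"
proof -
  interpret D: comm_group "dual M" using left_module.dual_comm_group[OF M] .
  show *: "character (dual M) \<xi>" using char_groupD(1)[of \<xi> "dual M"] \<xi> by (simp add: bidual_def)
  show "\<xi> \<one>\<^bsub>dual M\<^esub> = 1" by (rule D.character_one[OF *])
  show "\<chi> \<in> carrier (dual M) \<Longrightarrow> norm (\<xi> \<chi>) = 1" by (rule characterD(1)[OF *])
  show "\<chi> \<in> carrier (dual M) \<Longrightarrow> \<psi> \<in> carrier (dual M) \<Longrightarrow> \<xi> (\<chi> \<otimes>\<^bsub>dual M\<^esub> \<psi>) = \<xi> \<chi> * \<xi> \<psi>"
    by (rule characterD(2)[OF *])
qed

lemma bidualI:
  assumes "\<xi> \<in> extensional (carrier (dual M))" "\<And>\<chi>. \<chi> \<in> carrier (dual M) \<Longrightarrow> norm (\<xi> \<chi>) = 1"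
    and "\<And>\<chi> \<psi>. \<chi> \<in> carrier (dual M) \<Longrightarrow> \<psi> \<in> carrier (dual M) \<Longrightarrow>
      \<xi> (\<chi> \<otimes>\<^bsub>dual M\<^esub> \<psi>) = \<xi> \<chi> * \<xi> \<psi>"
  shows "\<xi> \<in> carrier (bidual M)"
proof -
  have "character (dual M) \<xi>" using assms(2,3) by (simp add: character_def)
  then show ?thesis using assms(1) by (simp add: bidual_def) (simp add: char_group_def[of "dual M"])
qed

lemma bidual_ops:
  assumes "\<chi> \<in> carrier (dual M)"
  shows "(\<xi> \<oplus>\<^bsub>bidual M\<^esub> \<eta>) \<chi> = \<xi> \<chi> * \<eta> \<chi>" "\<zero>\<^bsub>bidual M\<^esub> \<chi> = 1" "(r \<odot>\<^bsub>bidual M\<^esub> \<xi>) \<chi> = \<xi> (act M \<chi> r)"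
  using char_group_mult[OF assms] char_group_one[OF assms] assms by (simp_all add: bidual_def)

lemma bidual_eqI:
  assumes "\<xi> \<in> carrier (bidual M)" "\<eta> \<in> carrier (bidual M)" "\<And>\<chi>. \<chi> \<in> carrier (dual M) \<Longrightarrow> \<xi> \<chi> = \<eta> \<chi>"
  shows "\<xi> = \<eta>"
  using char_group_eqI[of \<xi> "dual M" \<eta>] assms by (simp add: bidual_def)

lemma bidual_left_module:
  assumes M: "left_module R M" shows "left_module R (bidual M)"
proof -
  interpret left_module R M by fact
  interpret D: comm_group "dual M" by (rule dual_comm_group)
  interpret C: comm_group "char_group (dual M)" by (intro char_group_comm_group D.is_group)
  have ag: "abelian_group (bidual M)"
    using C.l_inv_ex by (intro abelian_groupI) (simp_all add: bidual_def C.m_ac)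
  interpret N: abelian_group "bidual M" by (rule ag)
  have sm: "r \<odot>\<^bsub>bidual M\<^esub> \<xi> \<in> carrier (bidual M)" if "r \<in> carrier R" "\<xi> \<in> carrier (bidual M)" for r \<xi>
    using act_closed[OF _ that(1)] act_mult[OF _ _ that(1)]
    by (intro bidualI) (simp_all add: bidual_ops bidualD[OF M that(2)], simp add: bidual_def)
  show ?thesis
  proof (intro left_module.intro left_module_axioms.intro R.ring_axioms ag)
    fix a b x assume ab: "a \<in> carrier R" "b \<in> carrier R" and x: "x \<in> carrier (bidual M)"
    show "a \<odot>\<^bsub>bidual M\<^esub> x \<in> carrier (bidual M)" by (rule sm[OF ab(1) x])
    have [simp]: "act M \<chi> (a \<oplus>\<^bsub>R\<^esub> b) = act M \<chi> a \<otimes>\<^bsub>dual M\<^esub> act M \<chi> b" if "\<chi> \<in> carrier (dual M)" for \<chi>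
      using ab act_closed that
      by (intro dual_eqI[where M=M]) (simp_all add: act_apply dual_ops smult_l_distr dualD[OF that])
    show "(a \<oplus>\<^bsub>R\<^esub> b) \<odot>\<^bsub>bidual M\<^esub> x = a \<odot>\<^bsub>bidual M\<^esub> x \<oplus>\<^bsub>bidual M\<^esub> b \<odot>\<^bsub>bidual M\<^esub> x"
      using ab x by (intro bidual_eqI[where M=M] N.a_closed sm R.a_closed) (simp_all add: bidual_ops bidualD[OF M x] act_closed)
    have [simp]: "act M \<chi> (a \<otimes>\<^bsub>R\<^esub> b) = act M (act M \<chi> a) b" if "\<chi> \<in> carrier (dual M)" for \<chi>
      using ab act_closed that
      by (intro dual_eqI[where M=M]) (simp_all add: act_apply smult_assoc1)
    show "(a \<otimes>\<^bsub>R\<^esub> b) \<odot>\<^bsub>bidual M\<^esub> x = a \<odot>\<^bsub>bidual M\<^esub> (b \<odot>\<^bsub>bidual M\<^esub> x)"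
      using ab x by (intro bidual_eqI[where M=M] sm R.m_closed) (simp_all add: bidual_ops act_closed)
    fix y assume y: "y \<in> carrier (bidual M)"
    show "a \<odot>\<^bsub>bidual M\<^esub> (x \<oplus>\<^bsub>bidual M\<^esub> y) = a \<odot>\<^bsub>bidual M\<^esub> x \<oplus>\<^bsub>bidual M\<^esub> a \<odot>\<^bsub>bidual M\<^esub> y"
      using ab x y by (intro bidual_eqI[where M=M] sm N.a_closed) (simp_all add: bidual_ops act_closed)
  next
    fix x assume x: "x \<in> carrier (bidual M)"
    have [simp]: "act M \<chi> \<one>\<^bsub>R\<^esub> = \<chi>" if "\<chi> \<in> carrier (dual M)" for \<chi>
      using act_closed that by (intro dual_eqI[where M=M]) (simp_all add: act_apply)
    show "\<one>\<^bsub>R\<^esub> \<odot>\<^bsub>bidual M\<^esub> x = x"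
      using x by (intro bidual_eqI[where M=M] sm R.one_closed) (simp_all add: bidual_ops)
  qed
qed

lemma bidual_finsum:
  assumes M: "left_module R M" and f: "f \<in> A \<rightarrow> carrier (bidual M)" and \<chi>: "\<chi> \<in> carrier (dual M)"
  shows "finsum (bidual M) f A \<chi> = (\<Prod>i\<in>A. f i \<chi>)"
proof -
  interpret N: left_module R "bidual M" by (rule bidual_left_module[OF M])
  show ?thesis
    using f
  proof (induction A rule: infinite_finite_induct)
    case (insert i A)
    then have "f i \<in> carrier (bidual M)" "f \<in> A \<rightarrow> carrier (bidual M)" by auto
    then show ?case using insert by (simp add: bidual_ops[OF \<chi>] N.M.finsum_insert)
  qed (simp_all add: bidual_ops[OF \<chi>])
qed

text \<open>
  Together with \<open>character_lin_comb\<close> this exchanges linear combinations in \<open>M\<close> and \<open>M**\<close> with products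
  over the transposed action on \<open>M*\<close>; all duality arguments below consist of rearranging such
  products.
\<close>

lemma lin_comb_bidual:
  assumes M: "left_module R M" and \<xi>: "\<And>l. l < n \<Longrightarrow> \<xi> l \<in> carrier (bidual M)"
    and r: "r \<in> carrier (free_module R n)" and \<chi>: "\<chi> \<in> carrier (dual M)"
  shows "lin_comb (bidual M) n \<xi> r \<chi> = (\<Prod>l<n. \<xi> l (act M \<chi> (r l)))"
proof -
  interpret N: left_module R "bidual M" by (rule bidual_left_module[OF M])
  show ?thesis
    unfolding lin_comb_def using \<xi> free_module_coeff[OF r]
    by (subst bidual_finsum[OF M _ \<chi>]) (auto simp: bidual_ops[OF \<chi>])
qed

lemma character_lin_comb:
  assumes M: "left_module R M" and a: "\<And>l. l < n \<Longrightarrow> a l \<in> carrier M"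
    and r: "r \<in> carrier (free_module R n)" and \<chi>: "\<chi> \<in> carrier (dual M)"
  shows "\<chi> (lin_comb M n a r) = (\<Prod>l<n. act M \<chi> (r l) (a l))"
proof -
  interpret M: left_module R M by fact
  have "\<chi> (lin_comb M n a r) = (\<Prod>l<n. \<chi> (r l \<odot>\<^bsub>M\<^esub> a l))"
    unfolding lin_comb_def finsum_def
    using a free_module_coeff[OF r] M.dualD(3)[OF \<chi>]
    by (intro comm_monoid.character_finprod[OF M.M.a_comm_monoid char_groupD(1)[OF \<chi>]]) auto
  then show ?thesis using a by (simp add: act_apply)
qed

lemma evaluation_hom:
  assumes M: "left_module R M" shows "evaluation M \<in> lmod_hom R M (bidual M)"
proof -
  interpret M: left_module R M by fact
  interpret N: left_module R "bidual M" by (rule bidual_left_module[OF M])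
  interpret D: comm_group "dual M" by (rule M.dual_comm_group)
  have cl: "evaluation M x \<in> carrier (bidual M)" if "x \<in> carrier M" for x
    using that by (intro bidualI) (auto simp: evaluation_def M.dualD dual_ops)
  show ?thesis
  proof (rule lmod_homI)
    fix x assume x: "x \<in> carrier M" show "evaluation M x \<in> carrier (bidual M)" by (rule cl[OF x])
    fix r assume r: "r \<in> carrier R"
    show "evaluation M (r \<odot>\<^bsub>M\<^esub> x) = r \<odot>\<^bsub>bidual M\<^esub> evaluation M x"
      using r x by (intro bidual_eqI[OF cl[OF M.smult_closed[OF r x]] N.smult_closed[OF r cl[OF x]]])
        (simp add: bidual_ops, simp add: evaluation_def M.act_closed act_apply)
  next
    fix x y assume x: "x \<in> carrier M" "y \<in> carrier M"
    show "evaluation M (x \<oplus>\<^bsub>M\<^esub> y) = evaluation M x \<oplus>\<^bsub>bidual M\<^esub> evaluation M y"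
      using x by (intro bidual_eqI[OF cl[OF M.M.a_closed[OF x]] N.M.a_closed[OF cl[OF x(1)] cl[OF x(2)]]])
        (simp add: bidual_ops, simp add: evaluation_def M.dualD)
  qed
qed

section \<open>Transfer of solvability to the double character module\<close>

lemma character_prod:
  assumes "\<And>i. i \<in> A \<Longrightarrow> character G (\<chi> i)"
  shows "character G (\<lambda>x. \<Prod>i\<in>A. \<chi> i x)"
  using characterD(1,2)[OF assms] by (simp add: character_def prod_norm[symmetric] prod.distrib)

lemma character_comp:
  assumes "u \<in> hom S G" "character G \<chi>" shows "character S (\<lambda>s. \<chi> (u s))"
  using characterD(1,2)[OF assms(2)] assms(1) by (simp add: character_def hom_def Pi_iff)

lemma product_group_proj_hom:
  "i \<in> I \<Longrightarrow> (\<lambda>x. x i) \<in> hom (product_group I G) (G i)"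
  by (auto simp: hom_def)

lemma lin_comb_group_hom:
  assumes M: "left_module R M" and r: "r \<in> carrier (free_module R n)"
  shows "(\<lambda>a. lin_comb M n a r) \<in> hom (product_group {..<n} (\<lambda>_. add_monoid M)) (add_monoid M)"
proof -
  have "lin_comb M n (\<lambda>l\<in>{..<n}. a l \<oplus>\<^bsub>M\<^esub> b l) r = lin_comb M n a r \<oplus>\<^bsub>M\<^esub> lin_comb M n b r"
    if "a \<in> {..<n} \<rightarrow>\<^sub>E carrier M" "b \<in> {..<n} \<rightarrow>\<^sub>E carrier M" for a b
  proof -
    interpret left_module R M by fact
    have "lin_comb M n (\<lambda>l\<in>{..<n}. a l \<oplus>\<^bsub>M\<^esub> b l) r = lin_comb M n (\<lambda>l. a l \<oplus>\<^bsub>M\<^esub> b l) r"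
      using that by (intro lin_comb_cong[OF M _ _ r]) auto
    then show ?thesis using that by (subst lin_comb_add[OF M r, symmetric]) auto
  qed
  then show ?thesis using lin_comb_closed[OF M _ r] by (auto simp: hom_def)
qed

text \<open>
  Suppose that, in \<open>M\<close>, every solution \<open>a\<close> of the system \<open>T\<close> admits a \<open>b\<close> related to it by the
  system \<open>E\<close>.  For a solution \<open>\<xi>\<close> of \<open>T\<close> in \<open>M**\<close>, a related \<open>\<eta>\<close> is a family of characters of \<open>M*\<close> with
  prescribed composite along the transpose \<open>u : (M*)\<^sup>E \<rightarrow> (M*)\<^sup>m\<close> of the \<open>b\<close>-part of \<open>E\<close>, so it
  exists once the prescribed character \<open>\<chi>\<close> vanishes on the kernel of \<open>u\<close>.  If \<open>u \<theta>\<close> vanishes, then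
  by assumption the transpose \<open>\<psi>\<close> of the \<open>a\<close>-part at \<open>\<theta>\<close> vanishes on all solutions of \<open>T\<close> in \<open>M\<close>.
  Hence \<open>\<psi>\<close> is a combination of the equations in \<open>T\<close>, and the value of \<open>\<xi>\<close> there is trivial.
\<close>

lemma bidual_transfer:
  fixes M :: "('r, 'm) module"
  assumes M: "left_module R M"
    and T: "finite T" "T \<subseteq> carrier (free_module R n)"
    and E: "finite E" "E \<subseteq> carrier (free_module R n) \<times> carrier (free_module R m)"
    and imp: "\<And>a. \<lbrakk>\<And>l. l < n \<Longrightarrow> a l \<in> carrier M; \<And>t. t \<in> T \<Longrightarrow> lin_comb M n a t = \<zero>\<^bsub>M\<^esub>\<rbrakk> \<Longrightarrow>
      \<exists>b. (\<forall>j<m. b j \<in> carrier M) \<and> (\<forall>(s, k)\<in>E. lin_comb M n a s = lin_comb M m b k)"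
    and \<xi>: "\<And>l. l < n \<Longrightarrow> \<xi> l \<in> carrier (bidual M)"
    and \<xi>T: "\<And>t. t \<in> T \<Longrightarrow> lin_comb (bidual M) n \<xi> t = \<zero>\<^bsub>bidual M\<^esub>"
  shows "\<exists>\<eta>. (\<forall>j<m. \<eta> j \<in> carrier (bidual M)) \<and>
    (\<forall>(s, k)\<in>E. lin_comb (bidual M) n \<xi> s = lin_comb (bidual M) m \<eta> k)"
proof -
  interpret M: left_module R M by fact
  have MM: "left_module R (bidual M)" by (rule bidual_left_module[OF M])
  interpret MM: left_module R "bidual M" by fact
  let ?D = "dual M" and ?A = "add_monoid M"
  interpret D: comm_group ?D by (rule M.dual_comm_group)
  have A: "comm_group ?A" by (rule M.M.a_comm_group)
  let ?S = "product_group E (\<lambda>_. ?D)" and ?P = "product_group {..<n} (\<lambda>_. ?A)"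
  have S: "group ?S" by (simp add: D.is_group)
  have P: "group ?P" by (simp add: M.M.a_group)
  have Ec: "fst e \<in> carrier (free_module R n)" "snd e \<in> carrier (free_module R m)" if "e \<in> E" for e
    using E(2) that by auto
  have e1: "fst e l \<in> carrier R" if "e \<in> E" "l < n" for e l using free_module_coeff Ec that by blast
  have e2: "snd e j \<in> carrier R" if "e \<in> E" "j < m" for e j using free_module_coeff Ec that by blast
  have tc: "t l \<in> carrier R" if "t \<in> T" "l < n" for t l using free_module_coeff T(2) that by blast
  have \<theta>c: "\<theta> e \<in> carrier ?D" if "\<theta> \<in> carrier ?S" "e \<in> E" for \<theta> e using that by auto
  define u where "u j \<theta> = finprod ?D (\<lambda>e. act M (\<theta> e) (snd e j)) E" for j \<theta>
  have uc: "u j \<theta> \<in> carrier ?D" if "j < m" "\<theta> \<in> carrier ?S" for j \<theta>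
    unfolding u_def using M.act_closed[OF \<theta>c[OF that(2)] e2[OF _ that(1)]] by (intro D.finprod_closed) auto
  have ux: "u j \<theta> x = (\<Prod>e\<in>E. \<theta> e (snd e j \<odot>\<^bsub>M\<^esub> x))" if "j < m" "\<theta> \<in> carrier ?S" "x \<in> carrier M" for j \<theta> x
    unfolding u_def using M.act_closed[OF \<theta>c[OF that(2)] e2[OF _ that(1)]] that(3) M.M.a_group
    by (subst char_group_finprod) (auto simp: act_apply)
  have uh: "u j \<in> hom ?S ?D" if j: "j < m" for j
  proof (rule homI)
    fix \<theta> \<phi> assume \<theta>: "\<theta> \<in> carrier ?S" "\<phi> \<in> carrier ?S"
    have \<theta>\<phi>: "\<theta> \<otimes>\<^bsub>?S\<^esub> \<phi> \<in> carrier ?S" using monoid.m_closed[OF group.is_monoid[OF S] \<theta>] .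
    show "u j (\<theta> \<otimes>\<^bsub>?S\<^esub> \<phi>) = u j \<theta> \<otimes>\<^bsub>?D\<^esub> u j \<phi>"
      using \<theta> e2[OF _ j]
      by (intro dual_eqI[where M=M] uc[OF j] D.m_closed \<theta> \<theta>\<phi>)
        (simp only: ux[OF j \<theta>\<phi>] ux[OF j \<theta>(1)] ux[OF j \<theta>(2)] dual_ops, simp add: prod.distrib[symmetric] dual_ops)
  qed (rule uc[OF j])
  define \<chi> where "\<chi> \<theta> = (\<Prod>e\<in>E. lin_comb (bidual M) n \<xi> (fst e) (\<theta> e))" for \<theta>
  have lc: "lin_comb (bidual M) n \<xi> (fst e) \<in> carrier (bidual M)" if "e \<in> E" for e
    by (rule lin_comb_closed[OF MM \<xi> Ec(1)[OF that]])
  have \<chi>: "character ?S \<chi>"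
    unfolding \<chi>_def
    by (intro character_prod character_comp[OF product_group_proj_hom] bidualD(1)[OF M lc])
  have ker: "\<chi> \<theta> = 1" if \<theta>: "\<theta> \<in> carrier ?S" and u1: "\<And>j. j \<in> {..<m} \<Longrightarrow> u j \<theta> = \<one>\<^bsub>?D\<^esub>" for \<theta>
  proof -
    define \<psi> where "\<psi> a = (\<Prod>e\<in>E. \<theta> e (lin_comb M n a (fst e)))" for a
    have "\<exists>\<omega>. (\<forall>t\<in>T. character ?A (\<omega> t)) \<and> (\<forall>a\<in>carrier ?P. \<psi> a = (\<Prod>t\<in>T. \<omega> t (lin_comb M n a t)))"
    proof (rule character_along_family[OF T(1) P A])
      show "(\<lambda>a. lin_comb M n a t) \<in> hom ?P ?A" if "t \<in> T" for t
        using lin_comb_group_hom[OF M] T(2) that by blast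
      show "character ?P \<psi>"
        unfolding \<psi>_def
        by (intro character_prod character_comp[OF lin_comb_group_hom[OF M]] Ec char_groupD(1) \<theta>c[OF \<theta>])
      fix a assume a: "a \<in> carrier ?P" and aT: "\<And>t. t \<in> T \<Longrightarrow> lin_comb M n a t = \<one>\<^bsub>?A\<^esub>"
      have "\<exists>b. (\<forall>j<m. b j \<in> carrier M) \<and> (\<forall>(s, k)\<in>E. lin_comb M n a s = lin_comb M m b k)"
        using a aT by (intro imp) auto
      then obtain b where "\<forall>j<m. b j \<in> carrier M"
        "\<forall>(s, k)\<in>E. lin_comb M n a s = lin_comb M m b k" by blast
      then have b: "\<And>j. j < m \<Longrightarrow> b j \<in> carrier M"
        "\<And>e. e \<in> E \<Longrightarrow> lin_comb M n a (fst e) = lin_comb M m b (snd e)" by auto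
      have "\<psi> a = (\<Prod>e\<in>E. \<Prod>j<m. act M (\<theta> e) (snd e j) (b j))"
        unfolding \<psi>_def using b(1) Ec \<theta>c[OF \<theta>]
        by (intro prod.cong refl) (simp only: b(2), rule character_lin_comb[OF M], auto)
      also have "\<dots> = (\<Prod>j<m. \<Prod>e\<in>E. act M (\<theta> e) (snd e j) (b j))" by (rule prod.swap)
      also have "\<dots> = (\<Prod>j<m. u j \<theta> (b j))"
        using b(1) \<theta> by (intro prod.cong refl) (simp add: ux act_apply)
      also have "\<dots> = 1" using u1 b(1) by (simp add: dual_ops)
      finally show "\<psi> a = 1" .
    qed
    then obtain \<omega>' where \<omega>': "\<And>t. t \<in> T \<Longrightarrow> character ?A (\<omega>' t)"
      "\<And>a. a \<in> carrier ?P \<Longrightarrow> \<psi> a = (\<Prod>t\<in>T. \<omega>' t (lin_comb M n a t))" by blast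
    define \<omega> where "\<omega> t = restrict (\<omega>' t) (carrier M)" for t
    have \<omega>: "\<omega> t \<in> carrier ?D" if "t \<in> T" for t
      using restrict_character[OF M.M.a_group \<omega>'(1)[OF that]] by (simp add: \<omega>_def)
    have ae: "act M (\<theta> e) (fst e l) \<in> carrier ?D" if "e \<in> E" "l < n" for e l
      by (intro M.act_closed \<theta>c[OF \<theta>] e1 that)
    have at: "act M (\<omega> t) (t l) \<in> carrier ?D" if "t \<in> T" "l < n" for t l
      by (intro M.act_closed \<omega> tc that)
    have eq: "finprod ?D (\<lambda>e. act M (\<theta> e) (fst e l)) E = finprod ?D (\<lambda>t. act M (\<omega> t) (t l)) T"
      if l: "l < n" for l
    proof (rule dual_eqI[where M=M])
      fix y assume y: "y \<in> carrier M"
      let ?a = "\<lambda>i. if i = l then y else \<zero>\<^bsub>M\<^esub>" and ?a' = "\<lambda>i\<in>{..<n}. if i = l then y else \<zero>\<^bsub>M\<^esub>"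
      have single: "lin_comb M n ?a' r = r l \<odot>\<^bsub>M\<^esub> y" if r: "r \<in> carrier (free_module R n)" for r
      proof -
        have "lin_comb M n ?a' r = lin_comb M n ?a r" using y by (intro lin_comb_cong[OF M _ _ r]) auto
        then show ?thesis using lin_comb_single[OF M r l y] by simp
      qed
      have "(\<Prod>e\<in>E. act M (\<theta> e) (fst e l) y) = \<psi> ?a'"
        unfolding \<psi>_def using Ec(1) y by (intro prod.cong refl) (simp add: single act_apply)
      also have "\<dots> = (\<Prod>t\<in>T. \<omega>' t (lin_comb M n ?a' t))" using y by (intro \<omega>'(2)) auto
      also have "\<dots> = (\<Prod>t\<in>T. act M (\<omega> t) (t l) y)"
        using T(2) y tc[OF _ l] by (intro prod.cong refl) (auto simp add: single act_apply \<omega>_def)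
      finally show "finprod ?D (\<lambda>e. act M (\<theta> e) (fst e l)) E y = finprod ?D (\<lambda>t. act M (\<omega> t) (t l)) T y"
        using ae[OF _ l] at[OF _ l] y M.M.a_group by (simp add: char_group_finprod Pi_iff)
    qed (use ae[OF _ l] at[OF _ l] in \<open>auto intro!: D.finprod_closed\<close>)
    have "\<chi> \<theta> = (\<Prod>e\<in>E. \<Prod>l<n. \<xi> l (act M (\<theta> e) (fst e l)))"
      unfolding \<chi>_def using \<xi> Ec \<theta>c[OF \<theta>] by (intro prod.cong refl lin_comb_bidual[OF M]) auto
    also have "\<dots> = (\<Prod>l<n. \<Prod>e\<in>E. \<xi> l (act M (\<theta> e) (fst e l)))" by (rule prod.swap)
    also have "\<dots> = (\<Prod>l<n. \<xi> l (finprod ?D (\<lambda>e. act M (\<theta> e) (fst e l)) E))"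
      using ae by (intro prod.cong refl D.character_finprod[OF bidualD(1,4)[OF M \<xi>], symmetric]) auto
    also have "\<dots> = (\<Prod>l<n. \<xi> l (finprod ?D (\<lambda>t. act M (\<omega> t) (t l)) T))"
      by (intro prod.cong refl arg_cong[where f="\<xi> _"] eq) simp
    also have "\<dots> = (\<Prod>l<n. \<Prod>t\<in>T. \<xi> l (act M (\<omega> t) (t l)))"
      using at by (intro prod.cong refl D.character_finprod[OF bidualD(1,4)[OF M \<xi>]]) auto
    also have "\<dots> = (\<Prod>t\<in>T. \<Prod>l<n. \<xi> l (act M (\<omega> t) (t l)))" by (rule prod.swap)
    also have "\<dots> = (\<Prod>t\<in>T. lin_comb (bidual M) n \<xi> t (\<omega> t))"
      using \<xi> T(2) \<omega> by (intro prod.cong refl lin_comb_bidual[OF M, symmetric]) auto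
    also have "\<dots> = 1" by (simp add: \<xi>T bidual_ops \<omega>)
    finally show ?thesis .
  qed
  have "\<exists>\<eta>. (\<forall>j\<in>{..<m}. character ?D (\<eta> j)) \<and> (\<forall>\<theta>\<in>carrier ?S. \<chi> \<theta> = (\<Prod>j<m. \<eta> j (u j \<theta>)))"
    by (rule character_along_family[OF finite_lessThan S D.comm_group_axioms uh \<chi> ker]) simp_all
  then obtain \<eta>' where \<eta>': "\<And>j. j < m \<Longrightarrow> character ?D (\<eta>' j)"
    "\<And>\<theta>. \<theta> \<in> carrier ?S \<Longrightarrow> \<chi> \<theta> = (\<Prod>j<m. \<eta>' j (u j \<theta>))"
    by auto
  define \<eta> where "\<eta> j = restrict (\<eta>' j) (carrier ?D)" for j
  have \<eta>: "\<eta> j \<in> carrier (bidual M)" if "j < m" for j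
    using restrict_character[OF D.is_group \<eta>'(1)[OF that]] by (simp add: \<eta>_def bidual_def)
  have "lin_comb (bidual M) n \<xi> (fst e) = lin_comb (bidual M) m \<eta> (snd e)" if e: "e \<in> E" for e
  proof (rule bidual_eqI[OF lc[OF e] lin_comb_closed[OF MM \<eta> Ec(2)[OF e]]])
    fix \<rho> assume \<rho>: "\<rho> \<in> carrier ?D"
    \<comment> \<open>Testing at a family concentrated at \<open>e\<close> recovers the single equation \<open>e\<close>.\<close>
    let ?\<theta> = "\<lambda>e'\<in>E. if e' = e then \<rho> else \<one>\<^bsub>?D\<^esub>"
    have \<theta>: "?\<theta> \<in> carrier ?S" using \<rho> by auto
    have "\<chi> ?\<theta> = (\<Prod>e'\<in>E. if e' = e then lin_comb (bidual M) n \<xi> (fst e') \<rho> else 1)"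
      unfolding \<chi>_def by (intro prod.cong refl) (simp add: bidualD(4)[OF M lc])
    also have "\<dots> = lin_comb (bidual M) n \<xi> (fst e) \<rho>" using E(1) e by simp
    finally have 1: "\<chi> ?\<theta> = lin_comb (bidual M) n \<xi> (fst e) \<rho>" .
    have "u j ?\<theta> = act M \<rho> (snd e j)" if j: "j < m" for j
    proof (rule dual_eqI[OF uc[OF j \<theta>] M.act_closed[OF \<rho> e2[OF e j]]])
      fix x assume x: "x \<in> carrier M"
      have "u j ?\<theta> x = (\<Prod>e'\<in>E. if e' = e then \<rho> (snd e' j \<odot>\<^bsub>M\<^esub> x) else 1)"
        unfolding ux[OF j \<theta> x] using x e2[OF _ j] by (intro prod.cong refl) (simp add: dual_ops)
      also have "\<dots> = act M \<rho> (snd e j) x" using E(1) e x by (simp add: act_apply)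
      finally show "u j ?\<theta> x = act M \<rho> (snd e j) x" .
    qed
    then have "\<chi> ?\<theta> = (\<Prod>j<m. \<eta> j (act M \<rho> (snd e j)))"
      unfolding \<eta>'(2)[OF \<theta>] using M.act_closed[OF \<rho> e2[OF e]] by (intro prod.cong refl) (simp add: \<eta>_def)
    also have "\<dots> = lin_comb (bidual M) m \<eta> (snd e) \<rho>"
      using lin_comb_bidual[OF M \<eta> Ec(2)[OF e] \<rho>] by simp
    finally show "lin_comb (bidual M) n \<xi> (fst e) \<rho> = lin_comb (bidual M) m \<eta> (snd e) \<rho>" using 1 by simp
  qed
  then show ?thesis using \<eta> by (intro exI[of _ \<eta>]) (auto simp: case_prod_beta)
qed

section \<open>Purity of the evaluation map\<close>

text \<open>
  The characters of the integers are \<open>z \<mapsto> w powi z\<close>, and a proper subgroup is contained in some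
  \<open>n\<int>\<close> with \<open>n > 1\<close>; so a nontrivial \<open>n\<close>-th root of unity separates it from \<open>1\<close>.
\<close>

lemma int_subgroup_separation:
  fixes P :: "int \<Rightarrow> bool"
  assumes zero: "P 0" and diff: "\<And>x y. P x \<Longrightarrow> P y \<Longrightarrow> P (x - y)" and one: "\<not> P 1"
  shows "\<exists>w::complex. norm w = 1 \<and> w \<noteq> 1 \<and> (\<forall>z. P z \<longrightarrow> w powi z = 1)"
proof -
  have neg: "P (- x)" if "P x" for x using diff[OF zero that] by simp
  have add: "P (x + y)" if "P x" "P y" for x y using diff[OF that(1) neg[OF that(2)]] by simp
  obtain n :: nat where n: "1 < n" "\<And>z. P z \<Longrightarrow> int n dvd z"
  proof (cases "\<exists>n::nat. 0 < n \<and> P (int n)")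
    case False
    have "z = 0" if "P z" for z
    proof (rule ccontr)
      assume "z \<noteq> 0"
      then have "0 < nat \<bar>z\<bar> \<and> P (int (nat \<bar>z\<bar>))" using that neg[OF that] by (simp add: abs_if)
      then show False using False by blast
    qed
    then have "\<And>z. P z \<Longrightarrow> int 2 dvd z" by (metis dvd_0_right)
    then show ?thesis using that[of 2] by simp
  next
    case True
    define n where "n = (LEAST n::nat. 0 < n \<and> P (int n))"
    have n: "0 < n" "P (int n)" using LeastI_ex[OF True] by (auto simp: n_def)
    then have "n \<noteq> 1" using one by auto
    have mult: "P (int n * int k)" for k :: nat
      by (induction k) (simp_all add: zero add n(2) distrib_left)
    have mult': "P (int n * k)" for k
    proof (cases "k \<ge> 0")
      case True then show ?thesis using mult[of "nat k"] by simp
    next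
      case False then show ?thesis using neg[OF mult[of "nat (- k)"]] by simp
    qed
    have "int n dvd z" if "P z" for z
    proof -
      have "P (z mod int n)" using diff[OF that mult'[of "z div int n"]] by (simp add: minus_mult_div_eq_mod)
      then have "P (int (nat (z mod int n)))" "nat (z mod int n) < n" using n by (simp_all add: nat_less_iff)
      then have "nat (z mod int n) = 0"
        using not_less_Least[of "nat (z mod int n)" "\<lambda>n. 0 < n \<and> P (int n)"] unfolding n_def[symmetric] by auto
      then have "z mod int n = 0" using n(1) by (smt (verit) nat_eq_iff2 of_nat_0_less_iff pos_mod_sign of_nat_0)
      then show ?thesis by auto
    qed
    then show ?thesis using that[of n] n(1) \<open>n \<noteq> 1\<close> by simp
  qed
  have "card {z::complex. z ^ n = 1} = n" using n(1) by (intro card_roots_unity_eq) simp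
  then have "{z::complex. z ^ n = 1} \<noteq> {1}" using n(1) by auto
  moreover have "(1::complex) \<in> {z. z ^ n = 1}" by simp
  ultimately obtain w :: complex where w: "w ^ n = 1" "w \<noteq> 1" by blast
  have "norm w ^ n = 1" using w(1) by (metis norm_one norm_power)
  then have "norm w = 1" using n(1) power_eq_imp_eq_base[of "norm w" n 1] by simp
  moreover have "w powi z = 1" if z: "P z" for z
  proof -
    obtain k where "z = int n * k" using n(2)[OF z] by (elim dvdE)
    then have "w powi z = (w powi int n) powi k" by (simp add: power_int_mult)
    then show ?thesis using w(1) by simp
  qed
  ultimately show ?thesis using w(2) by blast
qed

text \<open>
  If the right-hand sides do not lie in the subgroup of values of the system over \<open>M\<close>, a family
  \<open>\<theta>\<close> of characters separates them from it.  Being trivial on all values means that the transposed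
  system kills \<open>\<theta>\<close>, so the solution \<open>\<xi>\<close> over \<open>M**\<close> forces \<open>\<theta>\<close> to be trivial on the right-hand
  sides as well.  The family is obtained from a character of \<open>M\<^sup>n \<times> \<int>\<close>, where the integer factor
  records multiples of the right-hand sides.
\<close>

lemma evaluation_solvable:
  fixes M :: "('r, 'm) module"
  assumes M: "left_module R M"
    and T: "finite T" "T \<subseteq> carrier (free_module R n) \<times> carrier M"
    and \<xi>: "\<And>l. l < n \<Longrightarrow> \<xi> l \<in> carrier (bidual M)"
    and sol: "\<And>t. t \<in> T \<Longrightarrow> lin_comb (bidual M) n \<xi> (fst t) = evaluation M (snd t)"
  shows "\<exists>y. (\<forall>l<n. y l \<in> carrier M) \<and> (\<forall>t\<in>T. lin_comb M n y (fst t) = snd t)"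
proof (rule ccontr)
  assume contr: "\<not> ?thesis"
  interpret M: left_module R M by fact
  let ?D = "dual M"
  define A where "A = add_monoid M"
  have A_simps [simp]: "carrier A = carrier M" "mult A = add M" "one A = zero M" by (simp_all add: A_def)
  interpret D: comm_group ?D by (rule M.dual_comm_group)
  interpret A: comm_group A unfolding A_def by (rule M.M.a_comm_group)
  let ?P = "product_group {..<n} (\<lambda>_. A)"
  interpret P: group ?P by (simp add: A.is_group)
  have Tc: "fst t \<in> carrier (free_module R n)" "snd t \<in> carrier A" if "t \<in> T" for t using T(2) that by auto
  have vh: "group_hom ?P A (\<lambda>y. lin_comb M n y (fst t))" if "t \<in> T" for t
    using lin_comb_group_hom[OF M Tc(1)[OF that], folded A_def]
    by (intro group_hom.intro group_hom_axioms.intro P.is_group A.is_group)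
  \<comment> \<open>The multiples of the right-hand sides that are values of the system.\<close>
  define Q where "Q z \<longleftrightarrow> (\<exists>y\<in>carrier ?P. \<forall>t\<in>T. lin_comb M n y (fst t) = snd t [^]\<^bsub>A\<^esub> z)" for z :: int
  have "\<exists>w::complex. norm w = 1 \<and> w \<noteq> 1 \<and> (\<forall>z. Q z \<longrightarrow> w powi z = 1)"
  proof (rule int_subgroup_separation)
    show "Q 0" unfolding Q_def
      using group_hom.hom_one[OF vh] by (intro bexI[OF _ P.one_closed]) simp
    show "\<not> Q 1"
    proof
      assume "Q 1"
      then obtain y where y: "y \<in> carrier ?P" "\<forall>t\<in>T. lin_comb M n y (fst t) = snd t [^]\<^bsub>A\<^esub> (1::int)"
        unfolding Q_def by blast
      have "\<forall>t\<in>T. lin_comb M n y (fst t) = snd t" using y(2) A.int_pow_1[OF Tc(2)] by simp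
      then show False using contr y(1) by auto
    qed
    fix x z assume "Q x" "Q z"
    then obtain y y' where y: "y \<in> carrier ?P" "\<And>t. t \<in> T \<Longrightarrow> lin_comb M n y (fst t) = snd t [^]\<^bsub>A\<^esub> x"
      and y': "y' \<in> carrier ?P" "\<And>t. t \<in> T \<Longrightarrow> lin_comb M n y' (fst t) = snd t [^]\<^bsub>A\<^esub> z"
      unfolding Q_def by blast
    have "lin_comb M n (y \<otimes>\<^bsub>?P\<^esub> inv\<^bsub>?P\<^esub> y') (fst t) = snd t [^]\<^bsub>A\<^esub> (x - z)" if t: "t \<in> T" for t
    proof -
      interpret v: group_hom ?P A "\<lambda>y. lin_comb M n y (fst t)" by (rule vh[OF t])
      show ?thesis
        using v.hom_mult[OF y(1) P.inv_closed[OF y'(1)]] v.hom_inv[OF y'(1)]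
          A.int_pow_diff[OF Tc(2)[OF t], of x z] y(2)[OF t] y'(2)[OF t] by (simp only:)
    qed
    then show "Q (x - z)" unfolding Q_def by (intro bexI[OF _ P.m_closed[OF y(1) P.inv_closed[OF y'(1)]]]) blast
  qed
  then obtain w :: complex where w: "norm w = 1" "w \<noteq> 1" "\<And>z. Q z \<Longrightarrow> w powi z = 1" by blast
  have w0: "w \<noteq> 0" using w(1) by auto
  let ?S = "?P \<times>\<times> integer_group"
  have S: "group ?S" by (intro DirProd_group P.is_group group_integer_group)
  define u where "u t s = lin_comb M n (fst s) (fst t) \<otimes>\<^bsub>A\<^esub> snd t [^]\<^bsub>A\<^esub> (snd s)"
    for t and s :: "(nat \<Rightarrow> 'm) \<times> int"
  have vc: "lin_comb M n y (fst t) \<in> carrier A" if "t \<in> T" "y \<in> carrier ?P" for t y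
    using group_hom.hom_closed[OF vh[OF that(1)] that(2)] .
  have "\<exists>\<theta>. (\<forall>t\<in>T. character A (\<theta> t)) \<and> (\<forall>s\<in>carrier ?S. w powi snd s = (\<Prod>t\<in>T. \<theta> t (u t s)))"
  proof (rule character_along_family[OF T(1) S A.comm_group_axioms])
    show "u t \<in> hom ?S A" if t: "t \<in> T" for t
    proof (rule homI)
      fix s assume s: "s \<in> carrier ?S"
      then show "u t s \<in> carrier A" unfolding u_def
        by (intro A.m_closed vc[OF t] A.int_pow_closed[OF Tc(2)[OF t]]) (cases s, simp)
      fix s' assume s': "s' \<in> carrier ?S"
      have c: "fst s \<in> carrier ?P" "fst s' \<in> carrier ?P" using s s' by (cases s; cases s'; simp)+
      have "lin_comb M n (fst s \<otimes>\<^bsub>?P\<^esub> fst s') (fst t) = lin_comb M n (fst s) (fst t) \<otimes>\<^bsub>A\<^esub> lin_comb M n (fst s') (fst t)"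
        by (rule group_hom.hom_mult[OF vh[OF t] c])
      moreover have "snd t [^]\<^bsub>A\<^esub> (snd s + snd s') = snd t [^]\<^bsub>A\<^esub> snd s \<otimes>\<^bsub>A\<^esub> snd t [^]\<^bsub>A\<^esub> snd s'"
        by (rule A.int_pow_mult[OF Tc(2)[OF t]])
      moreover have "fst (s \<otimes>\<^bsub>?S\<^esub> s') = fst s \<otimes>\<^bsub>?P\<^esub> fst s'" "snd (s \<otimes>\<^bsub>?S\<^esub> s') = snd s + snd s'"
        by (cases s; cases s'; simp add: integer_group_def)+
      ultimately show "u t (s \<otimes>\<^bsub>?S\<^esub> s') = u t s \<otimes>\<^bsub>A\<^esub> u t s'"
        unfolding u_def using vc[OF t c(1)] vc[OF t c(2)] A.int_pow_closed[OF Tc(2)[OF t]]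
        by (simp only: A.m_ac A.m_closed)
    qed
    show "character ?S (\<lambda>s. w powi snd s)"
      using w(1) w0 by (auto simp: character_def norm_power_int power_int_add integer_group_def DirProd_def)
    fix s assume s: "s \<in> carrier ?S" and u1: "\<And>t. t \<in> T \<Longrightarrow> u t s = \<one>\<^bsub>A\<^esub>"
    have c: "fst s \<in> carrier ?P" using s by (cases s) simp
    have "lin_comb M n (fst s) (fst t) = snd t [^]\<^bsub>A\<^esub> (- snd s)" if t: "t \<in> T" for t
    proof -
      have "lin_comb M n (fst s) (fst t) = inv\<^bsub>A\<^esub> (snd t [^]\<^bsub>A\<^esub> snd s)"
        using A.inv_equality[OF u1[OF t, unfolded u_def] A.int_pow_closed[OF Tc(2)[OF t]] vc[OF t c]] ..
      then show ?thesis using A.int_pow_neg[OF Tc(2)[OF t]] by (simp only:)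
    qed
    then have "Q (- snd s)" unfolding Q_def using c by blast
    then show "w powi snd s = 1" using w(3)[of "- snd s"] by (simp add: power_int_minus)
  qed
  then obtain \<theta>' where \<theta>': "\<And>t. t \<in> T \<Longrightarrow> character A (\<theta>' t)"
    "\<And>s. s \<in> carrier ?S \<Longrightarrow> w powi snd s = (\<Prod>t\<in>T. \<theta>' t (u t s))" by blast
  define \<theta> where "\<theta> t = restrict (\<theta>' t) (carrier M)" for t
  have \<theta>: "\<theta> t \<in> carrier ?D" if "t \<in> T" for t
    using restrict_character[OF A.is_group \<theta>'(1)[OF that]] by (simp add: \<theta>_def A_def)
  have tc: "fst t l \<in> carrier R" if "t \<in> T" "l < n" for t l by (rule free_module_coeff[OF Tc(1)[OF that(1)] that(2)])
  have at: "act M (\<theta> t) (fst t l) \<in> carrier ?D" if "t \<in> T" "l < n" for t l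
    by (intro M.act_closed \<theta> tc that)
  have one: "finprod ?D (\<lambda>t. act M (\<theta> t) (fst t l)) T = \<one>\<^bsub>?D\<^esub>" if l: "l < n" for l
  proof (rule dual_eqI[where M=M])
    fix x assume x: "x \<in> carrier M"
    let ?y = "\<lambda>i\<in>{..<n}. if i = l then x else \<zero>\<^bsub>M\<^esub>"
    have y: "?y \<in> carrier ?P" using x by auto
    have "u t (?y, 0) = fst t l \<odot>\<^bsub>M\<^esub> x" if t: "t \<in> T" for t
    proof -
      have "lin_comb M n ?y (fst t) = lin_comb M n (\<lambda>i. if i = l then x else \<zero>\<^bsub>M\<^esub>) (fst t)"
        using x by (intro lin_comb_cong[OF M _ _ Tc(1)[OF t]]) auto
      also have "\<dots> = fst t l \<odot>\<^bsub>M\<^esub> x" by (rule lin_comb_single[OF M Tc(1)[OF t] l x])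
      finally show ?thesis using tc[OF t l] x by (simp add: u_def)
    qed
    then have "(\<Prod>t\<in>T. act M (\<theta> t) (fst t l) x) = (\<Prod>t\<in>T. \<theta>' t (u t (?y, 0)))"
      using x tc[OF _ l] by (intro prod.cong refl) (simp add: act_apply \<theta>_def)
    also have "\<dots> = 1" using \<theta>'(2)[of "(?y, 0)"] y by simp
    finally show "finprod ?D (\<lambda>t. act M (\<theta> t) (fst t l)) T x = \<one>\<^bsub>?D\<^esub> x"
      using at[OF _ l] x M.M.a_group by (simp add: char_group_finprod Pi_iff dual_ops)
  qed (use at[OF _ l] in \<open>auto intro!: D.finprod_closed\<close>)
  have "w = (\<Prod>t\<in>T. \<theta>' t (u t (\<one>\<^bsub>?P\<^esub>, 1)))"
    using \<theta>'(2)[of "(\<one>\<^bsub>?P\<^esub>, 1)"] P.one_closed by simp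
  also have "\<dots> = (\<Prod>t\<in>T. \<theta> t (snd t))"
  proof (intro prod.cong refl)
    fix t assume t: "t \<in> T"
    have "u t (\<one>\<^bsub>?P\<^esub>, 1) = snd t"
      using group_hom.hom_one[OF vh[OF t]] A.int_pow_1[OF Tc(2)[OF t]] Tc(2)[OF t] A.l_one
      unfolding u_def fst_conv snd_conv by (simp only:)
    then show "\<theta>' t (u t (\<one>\<^bsub>?P\<^esub>, 1)) = \<theta> t (snd t)" using Tc(2)[OF t] by (simp add: \<theta>_def)
  qed
  also have "\<dots> = (\<Prod>t\<in>T. lin_comb (bidual M) n \<xi> (fst t) (\<theta> t))"
    by (intro prod.cong refl) (simp add: sol evaluation_def \<theta>)
  also have "\<dots> = (\<Prod>t\<in>T. \<Prod>l<n. \<xi> l (act M (\<theta> t) (fst t l)))"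
    using \<xi> Tc(1) \<theta> by (intro prod.cong refl lin_comb_bidual[OF M]) auto
  also have "\<dots> = (\<Prod>l<n. \<Prod>t\<in>T. \<xi> l (act M (\<theta> t) (fst t l)))" by (rule prod.swap)
  also have "\<dots> = (\<Prod>l<n. \<xi> l (finprod ?D (\<lambda>t. act M (\<theta> t) (fst t l)) T))"
    using at by (intro prod.cong refl D.character_finprod[OF bidualD(1,4)[OF M \<xi>], symmetric]) auto
  also have "\<dots> = 1" by (simp add: one bidualD(4)[OF M \<xi>])
  finally show False using w(2) by simp
qed

lemma lin_comb_restrict:
  assumes M: "left_module R M" and a: "\<And>l. l < n \<Longrightarrow> a l \<in> carrier M" and r: "\<And>l. l < n \<Longrightarrow> r l \<in> carrier R"
  shows "lin_comb M n a (\<lambda>l\<in>{..<n}. r l) = (\<Oplus>\<^bsub>M\<^esub>l\<in>{..<n}. r l \<odot>\<^bsub>M\<^esub> a l)"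
proof -
  interpret M: left_module R M by fact
  show ?thesis unfolding lin_comb_def using a r by (intro M.add.finprod_cong') auto
qed

lemma restrict_free: "(\<And>l. l < n \<Longrightarrow> r l \<in> carrier R) \<Longrightarrow> (\<lambda>l\<in>{..<n}. r l) \<in> carrier (free_module R n)"
  by (auto simp: free_module_def prod_module_def regular_module_def)

lemma evaluation_pure:
  fixes M :: "('r, 'm) module"
  assumes M: "left_module R M" shows "pure_mono R M (bidual M) (evaluation M)"
proof -
  interpret M: left_module R M by fact
  have MM: "left_module R (bidual M)" by (rule bidual_left_module[OF M])
  note ev = evaluation_hom[OF M]
  show ?thesis
    unfolding pure_mono_def
  proof (intro conjI allI impI ev inj_onI)
    fix x y assume xy: "x \<in> carrier M" "y \<in> carrier M" "evaluation M x = evaluation M y"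
    \<comment> \<open>Injectivity is the case of an equation without unknowns, whose left-hand side is zero.\<close>
    define r0 where "r0 = (\<lambda>l\<in>{..<0::nat}. \<zero>\<^bsub>R\<^esub>)"
    have r0: "r0 \<in> carrier (free_module R 0)" unfolding r0_def by (rule restrict_free) simp
    have z: "lin_comb M 0 b r0 = \<zero>\<^bsub>M\<^esub>" "lin_comb (bidual M) 0 c r0 = \<zero>\<^bsub>bidual M\<^esub>" for b c
      by (simp_all add: lin_comb_def abelian_monoid.finsum_empty[OF M.M.abelian_monoid_axioms]
        abelian_monoid.finsum_empty[OF abelian_group.axioms(1)[OF left_module.axioms(2)[OF MM]]])
    have "evaluation M (x \<oplus>\<^bsub>M\<^esub> \<ominus>\<^bsub>M\<^esub> y) = evaluation M (y \<oplus>\<^bsub>M\<^esub> \<ominus>\<^bsub>M\<^esub> y)"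
      using xy lmod_homD(2)[OF ev] by simp
    also have "\<dots> = \<zero>\<^bsub>bidual M\<^esub>" using xy lmod_hom_zero[OF M MM ev] by (simp add: M.M.r_neg)
    finally have "evaluation M (x \<oplus>\<^bsub>M\<^esub> \<ominus>\<^bsub>M\<^esub> y) = \<zero>\<^bsub>bidual M\<^esub>" .
    then have "\<exists>b. (\<forall>l<0. b l \<in> carrier M) \<and> (\<forall>t\<in>{(r0, x \<oplus>\<^bsub>M\<^esub> \<ominus>\<^bsub>M\<^esub> y)}. lin_comb M 0 b (fst t) = snd t)"
      using xy by (intro evaluation_solvable[OF M, where \<xi>="\<lambda>_. undefined"]) (auto simp: z r0)
    then have "x \<oplus>\<^bsub>M\<^esub> \<ominus>\<^bsub>M\<^esub> y = \<zero>\<^bsub>M\<^esub>" using z(1) by auto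
    then show "x = y" using M.diff_zero_iff[OF xy(1,2)] by blast
  next
    fix m n :: nat and r :: "nat \<Rightarrow> nat \<Rightarrow> 'r" and a \<xi>
    assume r: "\<forall>k<m. \<forall>l<n. r k l \<in> carrier R" and a: "\<forall>k<m. a k \<in> carrier M"
      and \<xi>: "\<forall>l<n. \<xi> l \<in> carrier (bidual M)"
      and sol: "\<forall>k<m. (\<Oplus>\<^bsub>bidual M\<^esub>l\<in>{..<n}. r k l \<odot>\<^bsub>bidual M\<^esub> \<xi> l) = evaluation M (a k)"
    let ?T = "(\<lambda>k. (\<lambda>l\<in>{..<n}. r k l, a k)) ` {..<m}"
    have "\<exists>y. (\<forall>l<n. y l \<in> carrier M) \<and> (\<forall>t\<in>?T. lin_comb M n y (fst t) = snd t)"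
    proof (rule evaluation_solvable[OF M, where \<xi>=\<xi>])
      show "?T \<subseteq> carrier (free_module R n) \<times> carrier M" using r a by (auto intro!: restrict_free)
      show "lin_comb (bidual M) n \<xi> (fst t) = evaluation M (snd t)" if "t \<in> ?T" for t
        using that lin_comb_restrict[OF MM] \<xi> r sol by auto
    qed (use \<xi> in auto)
    then obtain y where y: "\<And>l. l < n \<Longrightarrow> y l \<in> carrier M"
      "\<And>k. k < m \<Longrightarrow> lin_comb M n y (\<lambda>l\<in>{..<n}. r k l) = a k" by auto
    show "\<exists>y. (\<forall>l<n. y l \<in> carrier M) \<and> (\<forall>k<m. (\<Oplus>\<^bsub>M\<^esub>l\<in>{..<n}. r k l \<odot>\<^bsub>M\<^esub> y l) = a k)"
      using y lin_comb_restrict[OF M] r by (intro exI[of _ y]) auto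
  qed
qed

section \<open>Extending homomorphisms into the double character module\<close>

lemma pure_mono_solve:
  assumes pure: "pure_mono R A C f"
    and T: "finite T" "T \<subseteq> carrier (free_module R n) \<times> carrier A"
    and x: "\<And>l. l < n \<Longrightarrow> x l \<in> carrier C"
    and sol: "\<And>t. t \<in> T \<Longrightarrow> lin_comb C n x (fst t) = f (snd t)"
  shows "\<exists>y. (\<forall>l<n. y l \<in> carrier A) \<and> (\<forall>t\<in>T. lin_comb A n y (fst t) = snd t)"
proof -
  obtain ts where ts: "set ts = T" using finite_list[OF T(1)] by blast
  have tT: "ts ! k \<in> T" if "k < length ts" for k using that ts by auto
  have "\<exists>y. (\<forall>l<n. y l \<in> carrier A) \<and>
      (\<forall>k<length ts. (\<Oplus>\<^bsub>A\<^esub>l\<in>{..<n}. fst (ts ! k) l \<odot>\<^bsub>A\<^esub> y l) = snd (ts ! k))"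
  proof (rule pure[unfolded pure_mono_def, THEN conjunct2, THEN conjunct2, rule_format])
    show "fst (ts ! k) l \<in> carrier R" if "k < length ts" "l < n" for k l
      using tT[OF that(1)] T(2) that(2) by (intro free_module_coeff[of _ R n]) auto
    show "snd (ts ! k) \<in> carrier A" if "k < length ts" for k using tT[OF that] T(2) by auto
    show "(\<Oplus>\<^bsub>C\<^esub>l\<in>{..<n}. fst (ts ! k) l \<odot>\<^bsub>C\<^esub> x l) = f (snd (ts ! k))" if "k < length ts" for k
      using sol[OF tT[OF that]] by (simp add: lin_comb_def)
  qed (rule x)
  then obtain y where y: "\<And>l. l < n \<Longrightarrow> y l \<in> carrier A"
    "\<And>k. k < length ts \<Longrightarrow> lin_comb A n y (fst (ts ! k)) = snd (ts ! k)" by (auto simp: lin_comb_def)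
  have "lin_comb A n y (fst t) = snd t" if "t \<in> T" for t
    using that y(2) unfolding ts[symmetric] in_set_conv_nth by blast
  then show ?thesis using y(1) by blast
qed

text \<open>
  Purity provides a map \<open>N \<rightarrow> M\<close> that is a retraction and a homomorphism as far as finitely many
  instances can tell: the elements that occur are treated as unknowns of a linear system over \<open>M\<close>.
\<close>

lemma pure_local_retraction:
  fixes M :: "('r, 'm) module" and N :: "('r, 'n) module"
  assumes M: "left_module R M" and N: "left_module R N" and pure: "pure_mono R M N i"
    and X: "finite X" "X \<subseteq> carrier M" and P: "finite P" "P \<subseteq> carrier N \<times> carrier N"
    and S: "finite S" "S \<subseteq> carrier R \<times> carrier N"
  shows "\<exists>\<sigma>. (\<forall>y. \<sigma> y \<in> carrier M) \<and> (\<forall>x\<in>X. \<sigma> (i x) = x) \<and>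
    (\<forall>(y, z)\<in>P. \<sigma> (y \<oplus>\<^bsub>N\<^esub> z) = \<sigma> y \<oplus>\<^bsub>M\<^esub> \<sigma> z) \<and> (\<forall>(r, y)\<in>S. \<sigma> (r \<odot>\<^bsub>N\<^esub> y) = r \<odot>\<^bsub>M\<^esub> \<sigma> y)"
proof -
  interpret M: left_module R M by fact
  interpret N: left_module R N by fact
  have i: "i \<in> lmod_hom R M N" using pure by (simp add: pure_mono_def)
  define Y where "Y = i ` X \<union> fst ` P \<union> snd ` P \<union> (\<lambda>(y, z). y \<oplus>\<^bsub>N\<^esub> z) ` P \<union> snd ` S \<union> (\<lambda>(r, y). r \<odot>\<^bsub>N\<^esub> y) ` S"
  have fin: "finite Y" using X P S by (simp add: Y_def)
  have YN: "Y \<subseteq> carrier N" using X P S lmod_homD(1)[OF i] by (auto simp: Y_def)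
  have inX: "i x \<in> Y" if "x \<in> X" for x using that by (simp add: Y_def)
  have inP: "y \<in> Y" "z \<in> Y" "y \<oplus>\<^bsub>N\<^esub> z \<in> Y" if "(y, z) \<in> P" for y z
    using imageI[OF that, of fst] imageI[OF that, of snd] imageI[OF that, of "\<lambda>(y, z). y \<oplus>\<^bsub>N\<^esub> z"]
    by (simp_all add: Y_def)
  have inS: "y \<in> Y" "r \<odot>\<^bsub>N\<^esub> y \<in> Y" if "(r, y) \<in> S" for r y
    using imageI[OF that, of snd] imageI[OF that, of "\<lambda>(r, y). r \<odot>\<^bsub>N\<^esub> y"] by (simp_all add: Y_def)
  obtain ys where ys: "set ys = Y" using finite_list[OF fin] by blast
  let ?n = "length ys"
  let ?F = "free_module R ?n"
  interpret F: left_module R ?F by (rule free_left_module[OF M.ring_axioms])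
  have "\<exists>l. l < ?n \<and> ys ! l = y" if "y \<in> Y" for y using that unfolding ys[symmetric] by (simp add: in_set_conv_nth)
  then obtain idx where idx: "\<And>y. y \<in> Y \<Longrightarrow> idx y < ?n \<and> ys ! idx y = y" by metis
  define U where "U y = unit_vec R ?n (idx y)" for y
  have U: "U y \<in> carrier ?F" for y unfolding U_def by (rule unit_vec_closed[OF M.ring_axioms])
  define Uadd where "Uadd = (\<lambda>(y, z). (U y \<oplus>\<^bsub>?F\<^esub> U z) \<oplus>\<^bsub>?F\<^esub> \<ominus>\<^bsub>?F\<^esub> U (y \<oplus>\<^bsub>N\<^esub> z))"
  define Usm where "Usm = (\<lambda>(r, y). (r \<odot>\<^bsub>?F\<^esub> U y) \<oplus>\<^bsub>?F\<^esub> \<ominus>\<^bsub>?F\<^esub> U (r \<odot>\<^bsub>N\<^esub> y))"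
  \<comment> \<open>Elements of \<open>X\<close> are prescribed; additivity and linearity become homogeneous equations.\<close>
  define T where "T = (\<lambda>x. (U (i x), x)) ` X \<union> (\<lambda>p. (Uadd p, \<zero>\<^bsub>M\<^esub>)) ` P \<union> (\<lambda>s. (Usm s, \<zero>\<^bsub>M\<^esub>)) ` S"
  have Uc: "p \<in> P \<Longrightarrow> Uadd p \<in> carrier ?F" "s \<in> S \<Longrightarrow> Usm s \<in> carrier ?F" for p s
    using U S(2) by (auto simp: Uadd_def Usm_def split: prod.split)
  have Uadd_val: "h (Uadd (y, z)) = \<zero>\<^bsub>L\<^esub> \<longleftrightarrow> h (U y) \<oplus>\<^bsub>L\<^esub> h (U z) = h (U (y \<oplus>\<^bsub>N\<^esub> z))"
    and Usm_val: "r \<in> carrier R \<Longrightarrow> h (Usm (r, y)) = \<zero>\<^bsub>L\<^esub> \<longleftrightarrow> r \<odot>\<^bsub>L\<^esub> h (U y) = h (U (r \<odot>\<^bsub>N\<^esub> y))"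
    if L: "left_module R L" and h: "h \<in> lmod_hom R ?F L" for L :: "('r, 'l) module" and h y z r
  proof -
    interpret L: left_module R L by fact
    note hU = lmod_homD(1)[OF h U] and inv = lmod_hom_a_inv[OF F.left_module_axioms L h U]
    have "h (Uadd (y, z)) = (h (U y) \<oplus>\<^bsub>L\<^esub> h (U z)) \<oplus>\<^bsub>L\<^esub> \<ominus>\<^bsub>L\<^esub> h (U (y \<oplus>\<^bsub>N\<^esub> z))"
      using U by (simp add: Uadd_def lmod_homD[OF h] inv)
    then show "h (Uadd (y, z)) = \<zero>\<^bsub>L\<^esub> \<longleftrightarrow> h (U y) \<oplus>\<^bsub>L\<^esub> h (U z) = h (U (y \<oplus>\<^bsub>N\<^esub> z))"
      using L.diff_zero_iff hU by simp
    assume r: "r \<in> carrier R"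
    have "h (Usm (r, y)) = (r \<odot>\<^bsub>L\<^esub> h (U y)) \<oplus>\<^bsub>L\<^esub> \<ominus>\<^bsub>L\<^esub> h (U (r \<odot>\<^bsub>N\<^esub> y))"
      using U r by (simp add: Usm_def lmod_homD[OF h] inv)
    then show "h (Usm (r, y)) = \<zero>\<^bsub>L\<^esub> \<longleftrightarrow> r \<odot>\<^bsub>L\<^esub> h (U y) = h (U (r \<odot>\<^bsub>N\<^esub> y))"
      using L.diff_zero_iff hU r by simp
  qed
  have ysN: "ys ! l \<in> carrier N" if "l < ?n" for l using that ys YN nth_mem by blast
  let ?h = "lin_comb N ?n (\<lambda>l. ys ! l)"
  have h: "?h \<in> lmod_hom R ?F N" by (rule lin_comb_hom[OF N ysN])
  have hU: "?h (U y) = y" if "y \<in> Y" for y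
    unfolding U_def using idx[OF that] lin_comb_unit[OF N ysN] by simp
  have "\<exists>b. (\<forall>l<?n. b l \<in> carrier M) \<and> (\<forall>t\<in>T. lin_comb M ?n b (fst t) = snd t)"
  proof (rule pure_mono_solve[OF pure])
    show "finite T" using X P S by (simp add: T_def)
    show "T \<subseteq> carrier ?F \<times> carrier M" using U Uc X(2) by (auto simp: T_def)
    show "ys ! l \<in> carrier N" if "l < ?n" for l by (rule ysN[OF that])
    fix t assume "t \<in> T"
    then consider x where "x \<in> X" "t = (U (i x), x)" | y z where "(y, z) \<in> P" "t = (Uadd (y, z), \<zero>\<^bsub>M\<^esub>)"
      | r y where "(r, y) \<in> S" "t = (Usm (r, y), \<zero>\<^bsub>M\<^esub>)"
      unfolding T_def by auto
    then show "?h (fst t) = i (snd t)"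
    proof cases
      case 1 then show ?thesis by (simp add: hU inX)
    next
      case 2
      then have "?h (Uadd (y, z)) = \<zero>\<^bsub>N\<^esub>" using Uadd_val[OF N h] by (simp add: hU inP)
      then show ?thesis using 2 lmod_hom_zero[OF M N i] by simp
    next
      case 3
      then have "?h (Usm (r, y)) = \<zero>\<^bsub>N\<^esub>" using Usm_val[OF N h, of r y] S(2) hU inS[OF 3(1)] by auto
      then show ?thesis using 3 lmod_hom_zero[OF M N i] by simp
    qed
  qed
  then obtain b where b: "\<And>l. l < ?n \<Longrightarrow> b l \<in> carrier M" "\<And>t. t \<in> T \<Longrightarrow> lin_comb M ?n b (fst t) = snd t" by blast
  let ?g = "lin_comb M ?n b"
  have g: "?g \<in> lmod_hom R ?F M" by (rule lin_comb_hom[OF M b(1)])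
  define \<sigma> where "\<sigma> y = ?g (U y)" for y
  show ?thesis
  proof (intro exI[of _ \<sigma>] conjI allI ballI)
    show "\<sigma> y \<in> carrier M" for y unfolding \<sigma>_def by (rule lmod_homD(1)[OF g U])
    show "\<sigma> (i x) = x" if "x \<in> X" for x using b(2)[of "(U (i x), x)"] that by (simp add: \<sigma>_def T_def)
    show "case p of (y, z) \<Rightarrow> \<sigma> (y \<oplus>\<^bsub>N\<^esub> z) = \<sigma> y \<oplus>\<^bsub>M\<^esub> \<sigma> z" if "p \<in> P" for p
    proof -
      obtain y z where p: "p = (y, z)" by (cases p)
      have "?g (Uadd (y, z)) = \<zero>\<^bsub>M\<^esub>" using b(2)[of "(Uadd p, \<zero>\<^bsub>M\<^esub>)"] that p by (auto simp: T_def)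
      then show ?thesis using Uadd_val[OF M g] p by (simp add: \<sigma>_def)
    qed
    show "case p of (r, y) \<Rightarrow> \<sigma> (r \<odot>\<^bsub>N\<^esub> y) = r \<odot>\<^bsub>M\<^esub> \<sigma> y" if "p \<in> S" for p
    proof -
      obtain r y where p: "p = (r, y)" by (cases p)
      have "?g (Usm (r, y)) = \<zero>\<^bsub>M\<^esub>" using b(2)[of "(Usm p, \<zero>\<^bsub>M\<^esub>)"] that p by (auto simp: T_def)
      then show ?thesis using Usm_val[OF M g, of r y] p S(2) that by (auto simp add: \<sigma>_def)
    qed
  qed
qed

lemma compact_unit_circle: "compact {z::complex. norm z = 1}"
proof -
  have "continuous_on {- pi..pi} (\<lambda>t. cis t)"
    unfolding cis_conv_exp by (intro continuous_intros)
  then have "compact (cis ` {- pi..pi})" by (rule compact_continuous_image) simp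
  moreover have "cis ` {- pi..pi} = {z. norm z = 1}"
  proof (intro equalityI subsetI)
    fix z :: complex assume "z \<in> {z. norm z = 1}"
    then have "z = cis (Arg z)" using rcis_cmod_Arg[of z] by (simp add: rcis_def)
    then show "z \<in> cis ` {- pi..pi}" using Arg_bounded[of z] by (intro rev_image_eqI[of "Arg z"]) auto
  qed auto
  ultimately show ?thesis by simp
qed

text \<open>
  The instance of the pure injectivity of \<open>M**\<close> in which evaluation is extended.  A homomorphism \<open>N \<rightarrow> M**\<close> is a function
  \<open>k : N \<times> M* \<rightarrow> T\<close> that is additive in each argument and balanced over the ring; all these
  conditions are closed in the product topology, and Tychonoff's theorem applies.  For a finite number
  of conditions, composing evaluation with a local retraction gives a function that satisfies them.
\<close>

lemma pure_extension_to_bidual: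
  fixes M :: "('r, 'm) module" and N :: "('r, 'n) module"
  assumes M: "left_module R M" and N: "left_module R N" and pure: "pure_mono R M N i"
  shows "\<exists>k\<in>lmod_hom R N (bidual M). \<forall>x\<in>carrier M. k (i x) = evaluation M x"
proof -
  interpret M: left_module R M by fact
  interpret N: left_module R N by fact
  let ?D = "dual M"
  interpret D: comm_group ?D by (rule M.dual_comm_group)
  have i: "i \<in> lmod_hom R M N" using pure by (simp add: pure_mono_def)
  \<comment> \<open>One condition for each choice of all arguments, so that a single index runs over one product.\<close>
  define idx where "idx = carrier M \<times> (carrier N \<times> carrier N) \<times> (carrier R \<times> carrier N) \<times> (carrier ?D \<times> carrier ?D)"
  define cond :: "'m \<times> ('n \<times> 'n) \<times> ('r \<times> 'n) \<times> (('m \<Rightarrow> complex) \<times> ('m \<Rightarrow> complex)) \<Rightarrow> ('n \<times> ('m \<Rightarrow> complex) \<Rightarrow> complex) set" where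
    "cond = (\<lambda>(x, (y, z), (r, v), (\<chi>, \<psi>)). {k. k (i x, \<chi>) = \<chi> x \<and> k (y \<oplus>\<^bsub>N\<^esub> z, \<chi>) = k (y, \<chi>) * k (z, \<chi>) \<and>
      k (y, \<chi> \<otimes>\<^bsub>?D\<^esub> \<psi>) = k (y, \<chi>) * k (y, \<psi>) \<and> k (r \<odot>\<^bsub>N\<^esub> v, \<chi>) = k (v, act M \<chi> r)})"
  let ?K = "\<Pi>\<^sub>E p\<in>(UNIV :: ('n \<times> ('m \<Rightarrow> complex)) set). {z::complex. norm z = 1}"
  have "?K \<inter> (\<Inter>p\<in>idx. cond p) \<noteq> {}"
  proof (rule compact_imp_fip_image)
    have "compactin (product_topology (\<lambda>_. euclidean) UNIV) ?K"
      unfolding compactin_PiE using compact_unit_circle by simp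
    then show "compact ?K" by (simp add: euclidean_product_topology)
    show "closed (cond p)" for p
      unfolding cond_def case_prod_beta
      by (intro closed_Collect_conj closed_Collect_eq continuous_on_mult continuous_on_const
          continuous_on_product_coordinates)
    fix I assume I: "finite I" "I \<subseteq> idx"
    have "\<exists>\<sigma>. (\<forall>y. \<sigma> y \<in> carrier M) \<and> (\<forall>x\<in>fst ` I. \<sigma> (i x) = x) \<and>
      (\<forall>(y, z)\<in>(fst \<circ> snd) ` I. \<sigma> (y \<oplus>\<^bsub>N\<^esub> z) = \<sigma> y \<oplus>\<^bsub>M\<^esub> \<sigma> z) \<and>
      (\<forall>(r, y)\<in>(fst \<circ> snd \<circ> snd) ` I. \<sigma> (r \<odot>\<^bsub>N\<^esub> y) = r \<odot>\<^bsub>M\<^esub> \<sigma> y)"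
      by (rule pure_local_retraction[OF M N pure]) (use I in \<open>auto simp: idx_def\<close>)
    then obtain \<sigma> where \<sigma>: "\<And>y. \<sigma> y \<in> carrier M" "\<forall>x\<in>fst ` I. \<sigma> (i x) = x"
      "\<forall>(y, z)\<in>(fst \<circ> snd) ` I. \<sigma> (y \<oplus>\<^bsub>N\<^esub> z) = \<sigma> y \<oplus>\<^bsub>M\<^esub> \<sigma> z"
      "\<forall>(r, y)\<in>(fst \<circ> snd \<circ> snd) ` I. \<sigma> (r \<odot>\<^bsub>N\<^esub> y) = r \<odot>\<^bsub>M\<^esub> \<sigma> y" by blast
    define k where "k p = (if snd p \<in> carrier ?D then snd p (\<sigma> (fst p)) else 1)" for p
    have "k \<in> ?K" using M.dualD(1) \<sigma>(1) by (auto simp: k_def)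
    moreover have "k \<in> cond p" if p: "p \<in> I" for p
    proof -
      obtain x y z r v \<chi> \<psi> where eq: "p = (x, (y, z), (r, v), (\<chi>, \<psi>))" by (metis surj_pair)
      have c: "x \<in> carrier M" "r \<in> carrier R" "\<chi> \<in> carrier ?D" "\<psi> \<in> carrier ?D"
        using p I(2) by (auto simp: eq idx_def)
      have "\<sigma> (i x) = x" "\<sigma> (y \<oplus>\<^bsub>N\<^esub> z) = \<sigma> y \<oplus>\<^bsub>M\<^esub> \<sigma> z" "\<sigma> (r \<odot>\<^bsub>N\<^esub> v) = r \<odot>\<^bsub>M\<^esub> \<sigma> v"
        using bspec[OF \<sigma>(2) imageI[OF p]] bspec[OF \<sigma>(3) imageI[OF p]] bspec[OF \<sigma>(4) imageI[OF p]]
        by (simp_all add: eq)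
      then show ?thesis
        using c \<sigma>(1) by (simp add: cond_def eq k_def M.dualD dual_ops M.act_closed act_apply)
    qed
    ultimately show "?K \<inter> (\<Inter>p\<in>I. cond p) \<noteq> {}" by blast
  qed
  then obtain k where k: "k \<in> ?K" "\<And>p. p \<in> idx \<Longrightarrow> k \<in> cond p" by blast
  have idxI: "(x, (y, z), (r, v), (\<chi>, \<psi>)) \<in> idx"
    if "x \<in> carrier M" "y \<in> carrier N" "z \<in> carrier N" "r \<in> carrier R" "v \<in> carrier N" "\<chi> \<in> carrier ?D" "\<psi> \<in> carrier ?D"
    for x y z r v \<chi> \<psi> using that by (simp add: idx_def)
  have kc: "k (i x, \<chi>) = \<chi> x" "k (y \<oplus>\<^bsub>N\<^esub> z, \<chi>) = k (y, \<chi>) * k (z, \<chi>)"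
    "k (y, \<chi> \<otimes>\<^bsub>?D\<^esub> \<psi>) = k (y, \<chi>) * k (y, \<psi>)" "k (r \<odot>\<^bsub>N\<^esub> v, \<chi>) = k (v, act M \<chi> r)"
    if "x \<in> carrier M" "y \<in> carrier N" "z \<in> carrier N" "r \<in> carrier R" "v \<in> carrier N" "\<chi> \<in> carrier ?D" "\<psi> \<in> carrier ?D"
    for x y z r v \<chi> \<psi>
    using k(2)[OF idxI[OF that]] by (simp_all add: cond_def)
  have k1: "norm (k p) = 1" for p using PiE_mem[OF k(1), of p] by simp
  define f where "f y = (\<lambda>\<chi>\<in>carrier ?D. k (y, \<chi>))" for y
  have fc: "f y \<in> carrier (bidual M)" if "y \<in> carrier N" for y
    unfolding f_def using that k1 kc(3)[OF M.M.zero_closed that that M.R.zero_closed that] N.zero_closed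
    by (intro bidualI) simp_all
  interpret MM: left_module R "bidual M" by (rule bidual_left_module[OF M])
  have f: "f \<in> lmod_hom R N (bidual M)"
  proof (rule lmod_homI)
    fix y assume y: "y \<in> carrier N" show "f y \<in> carrier (bidual M)" by (rule fc[OF y])
    fix r assume r: "r \<in> carrier R"
    show "f (r \<odot>\<^bsub>N\<^esub> y) = r \<odot>\<^bsub>bidual M\<^esub> f y"
    proof (rule bidual_eqI[OF fc[OF N.smult_closed[OF r y]] MM.smult_closed[OF r fc[OF y]]])
      fix \<chi> assume \<chi>: "\<chi> \<in> carrier ?D"
      show "f (r \<odot>\<^bsub>N\<^esub> y) \<chi> = (r \<odot>\<^bsub>bidual M\<^esub> f y) \<chi>"
        using kc(4)[OF M.M.zero_closed y y r y \<chi> \<chi>] M.act_closed[OF \<chi> r] \<chi>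
        by (simp add: bidual_ops) (simp add: f_def)
    qed
  next
    fix y z assume y: "y \<in> carrier N" "z \<in> carrier N"
    show "f (y \<oplus>\<^bsub>N\<^esub> z) = f y \<oplus>\<^bsub>bidual M\<^esub> f z"
    proof (rule bidual_eqI[OF fc[OF N.M.a_closed[OF y]] MM.M.a_closed[OF fc[OF y(1)] fc[OF y(2)]]])
      fix \<chi> assume \<chi>: "\<chi> \<in> carrier ?D"
      show "f (y \<oplus>\<^bsub>N\<^esub> z) \<chi> = (f y \<oplus>\<^bsub>bidual M\<^esub> f z) \<chi>"
        using kc(2)[OF M.M.zero_closed y M.R.zero_closed y(1) \<chi> \<chi>] \<chi>
        by (simp add: bidual_ops) (simp add: f_def)
    qed
  qed
  moreover have "f (i x) = evaluation M x" if x: "x \<in> carrier M" for x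
  proof (rule bidual_eqI[OF fc[OF lmod_homD(1)[OF i x]] lmod_homD(1)[OF evaluation_hom[OF M] x]])
    fix \<chi> assume \<chi>: "\<chi> \<in> carrier ?D"
    have z: "\<zero>\<^bsub>N\<^esub> \<in> carrier N" "\<zero>\<^bsub>R\<^esub> \<in> carrier R" by simp_all
    show "f (i x) \<chi> = evaluation M x \<chi>"
      using kc(1)[OF x z(1,1,2,1) \<chi> \<chi>] \<chi> by (simp add: f_def evaluation_def)
  qed
  ultimately show ?thesis by blast
qed

section \<open>Homomorphisms from presented modules\<close>

lemma hom_factor_surj:
  assumes L: "left_module R L" and X: "left_module R X" and N: "left_module R N"
    and p: "p \<in> lmod_hom R L X" and sur: "p ` carrier L = carrier X" and s: "s \<in> lmod_hom R L N"
    and ker: "\<And>r. \<lbrakk>r \<in> carrier L; p r = \<zero>\<^bsub>X\<^esub>\<rbrakk> \<Longrightarrow> s r = \<zero>\<^bsub>N\<^esub>"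
  shows "\<exists>f\<in>lmod_hom R X N. \<forall>r\<in>carrier L. f (p r) = s r"
proof -
  interpret L: left_module R L by fact
  interpret X: left_module R X by fact
  interpret N: left_module R N by fact
  have eq: "s x = s y" if xy: "x \<in> carrier L" "y \<in> carrier L" "p x = p y" for x y
  proof -
    have "p (x \<oplus>\<^bsub>L\<^esub> \<ominus>\<^bsub>L\<^esub> y) = \<zero>\<^bsub>X\<^esub>"
      using xy lmod_homD[OF p] lmod_hom_a_inv[OF L X p] by (simp add: X.M.r_neg)
    then have "s (x \<oplus>\<^bsub>L\<^esub> \<ominus>\<^bsub>L\<^esub> y) = \<zero>\<^bsub>N\<^esub>" using xy by (intro ker) simp_all
    then show ?thesis
      using xy lmod_homD[OF s] lmod_hom_a_inv[OF L N s] N.diff_zero_iff by simp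
  qed
  have "\<exists>r. r \<in> carrier L \<and> p r = x" if "x \<in> carrier X" for x using that unfolding sur[symmetric] by blast
  then obtain g where g: "\<And>x. x \<in> carrier X \<Longrightarrow> g x \<in> carrier L \<and> p (g x) = x" by metis
  have sg: "s (g (p r)) = s r" if "r \<in> carrier L" for r
    using g[OF lmod_homD(1)[OF p that]] that by (intro eq) auto
  have "(\<lambda>x. s (g x)) \<in> lmod_hom R X N"
  proof (rule lmod_homI)
    fix x assume x: "x \<in> carrier X"
    show "s (g x) \<in> carrier N" using g[OF x] lmod_homD(1)[OF s] by blast
    fix r assume r: "r \<in> carrier R"
    have "s (g (p (r \<odot>\<^bsub>L\<^esub> g x))) = r \<odot>\<^bsub>N\<^esub> s (g x)"
      using g[OF x] r lmod_homD[OF s] by (simp add: sg)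
    then show "s (g (r \<odot>\<^bsub>X\<^esub> x)) = r \<odot>\<^bsub>N\<^esub> s (g x)" using g[OF x] r lmod_homD(3)[OF p] by simp
  next
    fix x y assume xy: "x \<in> carrier X" "y \<in> carrier X"
    have "s (g (p (g x \<oplus>\<^bsub>L\<^esub> g y))) = s (g x) \<oplus>\<^bsub>N\<^esub> s (g y)"
      using g xy lmod_homD[OF s] by (simp add: sg)
    then show "s (g (x \<oplus>\<^bsub>X\<^esub> y)) = s (g x) \<oplus>\<^bsub>N\<^esub> s (g y)" using g xy lmod_homD(2)[OF p] by simp
  qed
  moreover have "\<forall>r\<in>carrier L. s (g (p r)) = s r" using sg by (rule ballI)
  ultimately show ?thesis by (intro bexI[where x="\<lambda>x. s (g x)"])
qed

lemma finitely_presentedE: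
  assumes "finitely_presented R X"
  obtains n p V where "left_module R X" "p \<in> lmod_hom R (free_module R n) X"
    "p ` carrier (free_module R n) = carrier X" "finite V" "V \<subseteq> carrier (free_module R n)"
    "a_kernel (free_module R n) X p = submodule_span R (free_module R n) V"
  using assms unfolding finitely_presented_def by blast

lemma submodule_span_incl: "V \<subseteq> submodule_span R M V"
  by (auto simp: submodule_span_def)

lemma presentation_hom:
  assumes X: "left_module R X" and p: "p \<in> lmod_hom R (free_module R n) X"
    and sur: "p ` carrier (free_module R n) = carrier X" and V: "V \<subseteq> carrier (free_module R n)"
    and ker: "a_kernel (free_module R n) X p = submodule_span R (free_module R n) V"
    and N: "left_module R N" and a: "\<And>l. l < n \<Longrightarrow> a l \<in> carrier N"
    and rel: "\<And>v. v \<in> V \<Longrightarrow> lin_comb N n a v = \<zero>\<^bsub>N\<^esub>"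
  shows "\<exists>f\<in>lmod_hom R X N. \<forall>r\<in>carrier (free_module R n). f (p r) = lin_comb N n a r"
proof (rule hom_factor_surj[OF _ X N p sur lin_comb_hom[OF N a]])
  show "left_module R (free_module R n)"
    by (rule free_left_module) (rule left_module.axioms(1)[OF N])
  fix r assume "r \<in> carrier (free_module R n)" "p r = \<zero>\<^bsub>X\<^esub>"
  then have "r \<in> submodule_span R (free_module R n) V"
    unfolding ker[symmetric] by (simp add: a_kernel_def kernel_def)
  then show "lin_comb N n a r = \<zero>\<^bsub>N\<^esub>"
    by (intro free_hom_kernel[OF N lin_comb_hom[OF N a] V rel])
qed

lemma presentation_eq:
  assumes X: "left_module R X" and p: "p \<in> lmod_hom R (free_module R n) X"
    and sur: "p ` carrier (free_module R n) = carrier X" and N: "left_module R N"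
    and f: "f \<in> lmod_hom R X N" and g: "g \<in> lmod_hom R X N"
    and eq: "\<And>l. l < n \<Longrightarrow> f (p (unit_vec R n l)) = g (p (unit_vec R n l))" and x: "x \<in> carrier X"
  shows "f x = g x"
proof -
  interpret N: left_module R N by fact
  obtain r where r: "r \<in> carrier (free_module R n)" "x = p r" using x sur by auto
  have "p (unit_vec R n l) \<in> carrier X" for l by (intro lmod_homD(1)[OF p] unit_vec_closed N.ring_axioms)
  then have "lin_comb N n (\<lambda>l. f (p (unit_vec R n l))) r = lin_comb N n (\<lambda>l. g (p (unit_vec R n l))) r"
    by (intro lin_comb_cong[OF N lmod_homD(1)[OF f] eq r(1)])
  then show ?thesis
    unfolding r(2) using free_hom_lin_comb[OF N lmod_hom_comp[OF p f] r(1)]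
      free_hom_lin_comb[OF N lmod_hom_comp[OF p g] r(1)] by simp
qed

section \<open>A lifting criterion for filtered colimits\<close>

text \<open>
  Homomorphisms \<open>X \<rightarrow> M\<close> killing \<open>S\<close> are homomorphisms from the finitely presented module
  \<open>X/\<langle>S\<rangle>\<close>.  So this is the condition that homomorphisms from finitely presented modules to \<open>M\<close>
  factor through \<open>B\<close>, for those modules that the filtered colimit needs.
\<close>

definition lifts_through :: "('r, 'x) ring_scheme \<Rightarrow> ('r, 'b) module set \<Rightarrow> ('r, 'm) module \<Rightarrow> bool" where
  "lifts_through R B M \<longleftrightarrow> (\<forall>X\<in>B. \<forall>S f. finite S \<longrightarrow> S \<subseteq> carrier X \<longrightarrow> f \<in> lmod_hom R X M \<longrightarrow>
     (\<forall>s\<in>S. f s = \<zero>\<^bsub>M\<^esub>) \<longrightarrow>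
     (\<exists>Z\<in>B. \<exists>g\<in>lmod_hom R X Z. \<exists>h\<in>lmod_hom R Z M. (\<forall>s\<in>S. g s = \<zero>\<^bsub>Z\<^esub>) \<and> (\<forall>x\<in>carrier X. h (g x) = f x)))"

lemma lifts_throughE:
  assumes "lifts_through R B M" "X \<in> B" "finite S" "S \<subseteq> carrier X" "f \<in> lmod_hom R X M"
    and "\<And>s. s \<in> S \<Longrightarrow> f s = \<zero>\<^bsub>M\<^esub>"
  obtains Z g h where "Z \<in> B" "g \<in> lmod_hom R X Z" "h \<in> lmod_hom R Z M"
    "\<And>s. s \<in> S \<Longrightarrow> g s = \<zero>\<^bsub>Z\<^esub>" "\<And>x. x \<in> carrier X \<Longrightarrow> h (g x) = f x"
proof -
  have "\<exists>Z\<in>B. \<exists>g\<in>lmod_hom R X Z. \<exists>h\<in>lmod_hom R Z M. (\<forall>s\<in>S. g s = \<zero>\<^bsub>Z\<^esub>) \<and> (\<forall>x\<in>carrier X. h (g x) = f x)"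
    using assms unfolding lifts_through_def by blast
  then show ?thesis using that by blast
qed

lemma lim_class_lifts:
  fixes M :: "('r, 'm) module" and B :: "('r, 'b) module set"
  assumes R: "ring R" and fp: "\<And>X. X \<in> B \<Longrightarrow> finitely_presented R X" and M: "M \<in> lim_class R B"
  shows "left_module R M" "lifts_through R B M"
    "y \<in> carrier M \<Longrightarrow> \<exists>Z\<in>B. \<exists>h\<in>lmod_hom R Z M. \<exists>z\<in>carrier Z. h z = y"
proof -
  obtain J :: "(('r, 'b) module \<times> ('b \<Rightarrow> 'm), 'b \<Rightarrow> 'b) small_cat" and D d c where
    J: "filtered_category J" "is_diagram R B J D d" "is_colimit R J D d M c"
    using M unfolding lim_class_def by blast
  have Bm: "left_module R X" if "X \<in> B" for X using fp that by (simp add: finitely_presented_def)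
  interpret filtered_diagram J R B D d
    using J R Bm by (intro filtered_diagram.intro filtered_diagram_axioms.intro)
  have e: "explicit_colimit R J D d M c" by (rule colimit_explicit[OF J(3)])
  have co: "is_cocone R J D d M c" using e by (simp add: explicit_colimit_def)
  show M: "left_module R M" using co by (simp add: is_cocone_def)
  have ch: "c i \<in> lmod_hom R (D i) M" if "i \<in> Obj J" for i using co that by (simp add: is_cocone_def)
  show "\<exists>Z\<in>B. \<exists>h\<in>lmod_hom R Z M. \<exists>z\<in>carrier Z. h z = y" if "y \<in> carrier M"
    using e that ch D_in unfolding explicit_colimit_def by meson
  show "lifts_through R B M"
    unfolding lifts_through_def
  proof (intro ballI allI impI)
    fix X S f assume X: "X \<in> B" and S: "finite S" "S \<subseteq> carrier X" and f: "f \<in> lmod_hom R X M"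
      and fS: "\<forall>s\<in>S. f s = \<zero>\<^bsub>M\<^esub>"
    obtain i h where i: "i \<in> Obj J" "h \<in> lmod_hom R X (D i)" "\<forall>x\<in>carrier X. c i (h x) = f x"
      using fp_factor[OF e fp[OF X] f] by blast
    have "\<exists>j\<in>Obj J. \<exists>u\<in>Arr J i j. \<forall>y\<in>h ` S. d i j u y = \<zero>\<^bsub>D j\<^esub>"
    proof (rule finite_kill[OF i(1)])
      show "finite (h ` S)" using S(1) by simp
      show "h ` S \<subseteq> carrier (D i)" using S(2) lmod_homD(1)[OF i(2)] by blast
      fix y assume "y \<in> h ` S"
      then have "y \<in> carrier (D i)" "c i y = \<zero>\<^bsub>M\<^esub>" using S(2) lmod_homD(1)[OF i(2)] i(3) fS by auto
      then show "\<exists>j\<in>Obj J. \<exists>u\<in>Arr J i j. d i j u y = \<zero>\<^bsub>D j\<^esub>"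
        using e i(1) unfolding explicit_colimit_def by blast
    qed
    then obtain j u where j: "j \<in> Obj J" "u \<in> Arr J i j" "\<forall>s\<in>S. d i j u (h s) = \<zero>\<^bsub>D j\<^esub>" by blast
    have "\<forall>x\<in>carrier X. c j (d i j u (h x)) = f x"
      using cocone_d[OF co i(1) j(1,2)] lmod_homD(1)[OF i(2)] i(3) by simp
    then show "\<exists>Z\<in>B. \<exists>g\<in>lmod_hom R X Z. \<exists>h\<in>lmod_hom R Z M. (\<forall>s\<in>S. g s = \<zero>\<^bsub>Z\<^esub>) \<and> (\<forall>x\<in>carrier X. h (g x) = f x)"
      using j(3) by (intro bexI[OF _ D_in[OF j(1)]] bexI[OF _ lmod_hom_comp[OF i(2) d_hom[OF i(1) j(1,2)]]]
          bexI[OF _ ch[OF j(1)]]) blast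
  qed
qed

lemma restrict_hom:
  assumes "left_module R X" "u \<in> lmod_hom R X Y" shows "restrict u (carrier X) \<in> lmod_hom R X Y"
proof -
  interpret X: left_module R X by fact
  show ?thesis by (rule lmod_homI) (simp_all add: lmod_homD[OF assms(2)])
qed

text \<open>
  Two parallel arrows into \<open>(Y, g)\<close> are equalized by lifting \<open>g\<close>, with \<open>S\<close> the differences of the
  arrows at finitely many generators; two objects have a common upper bound in their
  biproduct.  An element that becomes zero in \<open>M\<close> is killed by lifting with \<open>S\<close> a singleton.  The element
  \<open>y\<close> of \<open>M\<close> is in the image of \<open>Z \<rightarrow> R \<rightarrow> M\<close>, where \<open>Z \<rightarrow> R\<close> hits \<open>1\<close> and \<open>R \<rightarrow> M\<close> sends \<open>1\<close> to \<open>y\<close>.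
\<close>

lemma lim_class_criterion:
  fixes M :: "('r, 'm) module" and B :: "('r, 'b) module set"
  assumes R: "ring R" and B: "additive_fp_subcategory R B" and reg: "regular_module R \<in> lim_class R B"
    and M: "left_module R M" and lifts: "lifts_through R B M"
  shows "M \<in> lim_class R B"
proof -
  interpret M: left_module R M by fact
  have fp: "finitely_presented R X" if "X \<in> B" for X
    using B that by (auto simp: additive_fp_subcategory_def)
  have Bm: "left_module R X" if "X \<in> B" for X using fp[OF that] by (simp add: finitely_presented_def)
  let ?C = "canonical_cat R B M"
  have obj: "(X, f) \<in> Obj ?C \<longleftrightarrow> X \<in> B \<and> f \<in> lmod_hom R X M" for X f by (simp add: canonical_cat_def)
  have arr: "u \<in> Arr ?C (X, f) (Y, g) \<longleftrightarrow>
      u \<in> lmod_hom R X Y \<and> u \<in> extensional (carrier X) \<and> (\<forall>x\<in>carrier X. g (u x) = f x)"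
    for u X f Y g by (simp add: canonical_cat_def)
  have cmp: "Cmp ?C (X, f) q k v u = (\<lambda>x\<in>carrier X. v (u x))" for X f q k v u
    by (simp add: canonical_cat_def)
  have idt: "Idt ?C (X, f) = (\<lambda>x\<in>carrier X. x)" for X f by (simp add: canonical_cat_def)
  have rarr: "restrict u (carrier X) \<in> Arr ?C (X, f) (Y, g)"
    if "X \<in> B" "u \<in> lmod_hom R X Y" "\<And>x. x \<in> carrier X \<Longrightarrow> g (u x) = f x" for u X f Y g
    unfolding arr using restrict_hom[OF Bm[OF that(1)] that(2)] that(3) by simp
  have idh: "(\<lambda>x. x) \<in> lmod_hom R X X" for X :: "('r, 'b) module"
    by (rule lmod_homI) simp_all
  have cat: "filtered_category ?C"
  proof (unfold_locales, goal_cases)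
    case (1 p)
    then show ?case by (cases p) (auto simp: obj arr idt intro!: restrict_hom Bm idh)
  next
    case (2 p q k u v)
    then obtain X f Y g Z h where p: "p = (X, f)" "q = (Y, g)" "k = (Z, h)" "X \<in> B"
      by (cases p; cases q; cases k) (auto simp: obj)
    have u: "u \<in> lmod_hom R X Y" "\<forall>x\<in>carrier X. g (u x) = f x"
      and v: "v \<in> lmod_hom R Y Z" "\<forall>x\<in>carrier Y. h (v x) = g x"
      using 2(4,5) by (auto simp: p arr)
    show ?case
      unfolding p(1-3) cmp using u(2) v(2)
      by (intro rarr p(4) lmod_hom_comp[OF u(1) v(1)]) (simp add: lmod_homD(1)[OF u(1)])
  next
    case (3 p q u)
    then show ?case
      by (cases p; cases q) (auto simp: obj arr cmp idt extensional_def fun_eq_iff)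
  next
    case (4 p q u)
    then show ?case
      by (cases p; cases q) (auto simp: obj arr cmp idt extensional_def fun_eq_iff lmod_homD(1))
  next
    case (5 p q k l u v w)
    then show ?case
      by (cases p; cases q; cases k; cases l) (auto simp: obj arr cmp fun_eq_iff lmod_homD(1))
  next
    case 6
    obtain X where "X \<in> B" using B by (auto simp: additive_fp_subcategory_def)
    moreover have "(\<lambda>_. \<zero>\<^bsub>M\<^esub>) \<in> lmod_hom R X M" by (rule lmod_homI) (simp_all add: M.smult_zero)
    ultimately show ?case using obj by blast
  next
    case (7 p q)
    then obtain X f Y g where X: "p = (X, f)" "X \<in> B" "f \<in> lmod_hom R X M"
      and Y: "q = (Y, g)" "Y \<in> B" "g \<in> lmod_hom R Y M" by (cases p; cases q) (auto simp: obj)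
    obtain Z where Z: "Z \<in> B" "is_biproduct R X Y Z"
      using B X(2) Y(2) unfolding additive_fp_subcategory_def by blast
    then obtain i j s t where i: "i \<in> lmod_hom R X Z" "j \<in> lmod_hom R Y Z"
      "s \<in> lmod_hom R Z X" "t \<in> lmod_hom R Z Y"
      "\<forall>x\<in>carrier X. s (i x) = x \<and> t (i x) = \<zero>\<^bsub>Y\<^esub>" "\<forall>y\<in>carrier Y. s (j y) = \<zero>\<^bsub>X\<^esub> \<and> t (j y) = y"
      unfolding is_biproduct_def by blast
    let ?k = "\<lambda>z. f (s z) \<oplus>\<^bsub>M\<^esub> g (t z)"
    note fs = lmod_homD[OF lmod_hom_comp[OF i(3) X(3)]] and gt = lmod_homD[OF lmod_hom_comp[OF i(4) Y(3)]]
    have k: "?k \<in> lmod_hom R Z M"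
      by (rule lmod_homI) (simp_all add: fs gt M.smult_r_distr M.M.a_ac)
    have "restrict i (carrier X) \<in> Arr ?C p (Z, ?k)"
      unfolding X(1) using i(5) lmod_hom_zero[OF Bm[OF Y(2)] M Y(3)] lmod_homD(1)[OF X(3)]
      by (intro rarr X(2) i(1)) simp
    moreover have "restrict j (carrier Y) \<in> Arr ?C q (Z, ?k)"
      unfolding Y(1) using i(6) lmod_hom_zero[OF Bm[OF X(2)] M X(3)] lmod_homD(1)[OF Y(3)]
      by (intro rarr Y(2) i(2)) simp
    moreover have "(Z, ?k) \<in> Obj ?C" using obj Z(1) k by blast
    ultimately show ?case by blast
  next
    case (8 p q u v)
    then obtain X f Y g where X: "p = (X, f)" "X \<in> B" "f \<in> lmod_hom R X M"
      and Y: "q = (Y, g)" "Y \<in> B" "g \<in> lmod_hom R Y M"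
      and u: "u \<in> lmod_hom R X Y" "\<forall>x\<in>carrier X. g (u x) = f x"
      and v: "v \<in> lmod_hom R X Y" "\<forall>x\<in>carrier X. g (v x) = f x"
      by (cases p; cases q) (auto simp: obj arr)
    interpret Y: left_module R Y by (rule Bm[OF Y(2)])
    obtain n t where t: "t \<in> lmod_hom R (free_module R n) X" "t ` carrier (free_module R n) = carrier X"
      using fp[OF X(2)] unfolding finitely_presented_def by blast
    let ?x = "\<lambda>l. t (unit_vec R n l)"
    have x: "?x l \<in> carrier X" for l by (intro lmod_homD(1)[OF t(1)] unit_vec_closed R)
    define S where "S = (\<lambda>l. u (?x l) \<oplus>\<^bsub>Y\<^esub> \<ominus>\<^bsub>Y\<^esub> v (?x l)) ` {..<n}"
    have SY: "S \<subseteq> carrier Y" using x lmod_homD(1)[OF u(1)] lmod_homD(1)[OF v(1)] by (auto simp: S_def)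
    have "g s = \<zero>\<^bsub>M\<^esub>" if "s \<in> S" for s
      using that x u(2) v(2) lmod_homD[OF Y(3)] lmod_homD(1)[OF u(1)] lmod_homD(1)[OF v(1)]
        lmod_hom_a_inv[OF Y.left_module_axioms M Y(3)] lmod_homD(1)[OF X(3)] by (auto simp: S_def M.M.r_neg)
    moreover have "finite S" by (simp add: S_def)
    ultimately obtain Z w h where w: "Z \<in> B" "w \<in> lmod_hom R Y Z" "h \<in> lmod_hom R Z M"
      "\<And>s. s \<in> S \<Longrightarrow> w s = \<zero>\<^bsub>Z\<^esub>" "\<And>y. y \<in> carrier Y \<Longrightarrow> h (w y) = g y"
      using lifts_throughE[OF lifts Y(2) _ SY Y(3)] by metis
    interpret Z: left_module R Z by (rule Bm[OF w(1)])
    have wgen: "w (u (?x l)) = w (v (?x l))" if "l < n" for l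
    proof -
      have "w (u (?x l) \<oplus>\<^bsub>Y\<^esub> \<ominus>\<^bsub>Y\<^esub> v (?x l)) = \<zero>\<^bsub>Z\<^esub>" using that by (intro w(4)) (simp add: S_def)
      then show ?thesis
        using x lmod_homD(1)[OF u(1)] lmod_homD(1)[OF v(1)] lmod_homD[OF w(2)]
          lmod_hom_a_inv[OF Y.left_module_axioms Z.left_module_axioms w(2)] Z.diff_zero_iff by simp
    qed
    have wuv: "w (u x) = w (v x)" if "x \<in> carrier X" for x
      by (rule presentation_eq[OF Bm[OF X(2)] t Z.left_module_axioms lmod_hom_comp[OF u(1) w(2)]
          lmod_hom_comp[OF v(1) w(2)] wgen that])
    let ?w = "restrict w (carrier Y)"
    have "?w \<in> Arr ?C q (Z, h)" unfolding Y(1) using w(5) by (intro rarr Y(2) w(2))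
    moreover have "Cmp ?C p q (Z, h) ?w u = Cmp ?C p q (Z, h) ?w v"
      unfolding X(1) cmp using wuv lmod_homD(1)[OF u(1)] lmod_homD(1)[OF v(1)]
      by (intro restrict_ext) simp
    moreover have "(Z, h) \<in> Obj ?C" using obj w(1,3) by blast
    ultimately show ?case by blast
  qed
  let ?d = "\<lambda>(p :: ('r, 'b) module \<times> ('b \<Rightarrow> 'm)) (q :: ('r, 'b) module \<times> ('b \<Rightarrow> 'm)) (u :: 'b \<Rightarrow> 'b). u"
  have dg: "is_diagram R B ?C fst ?d"
    unfolding is_diagram_def by (auto simp: obj arr idt cmp)
  interpret C: filtered_diagram ?C R B fst ?d
    using cat R Bm dg by (intro filtered_diagram.intro filtered_diagram_axioms.intro)
  have "explicit_colimit R ?C fst ?d M snd"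
    unfolding explicit_colimit_def is_cocone_def
  proof (intro conjI ballI impI M)
    fix y assume y: "y \<in> carrier M"
    have "\<one>\<^bsub>R\<^esub> \<in> carrier (regular_module R)" by (simp add: regular_module_def)
    then obtain Z h z where Z: "Z \<in> B" "h \<in> lmod_hom R Z (regular_module R)" "z \<in> carrier Z" "h z = \<one>\<^bsub>R\<^esub>"
      using lim_class_lifts(3)[OF R fp reg] by blast
    have hc: "h x \<in> carrier R" if "x \<in> carrier Z" for x
      using lmod_homD(1)[OF Z(2) that] by (simp add: regular_module_def)
    have "(\<lambda>x. h x \<odot>\<^bsub>M\<^esub> y) \<in> lmod_hom R Z M"
      using hc y lmod_homD[OF Z(2)]
      by (intro lmod_homI) (simp_all add: regular_module_def M.smult_l_distr M.smult_assoc1)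
    then have "(Z, \<lambda>x. h x \<odot>\<^bsub>M\<^esub> y) \<in> Obj ?C" using obj Z(1) by blast
    then show "\<exists>p\<in>Obj ?C. \<exists>x\<in>carrier (fst p). snd p x = y"
      using Z(3,4) y by (intro bexI[of _ "(Z, \<lambda>x. h x \<odot>\<^bsub>M\<^esub> y)"] bexI[of _ z]) simp_all
  next
    fix p x assume "p \<in> Obj ?C" and x: "x \<in> carrier (fst p)" "snd p x = \<zero>\<^bsub>M\<^esub>"
    then obtain X f where X: "p = (X, f)" "X \<in> B" "f \<in> lmod_hom R X M" by (cases p) (auto simp: obj)
    obtain Z g h where Z: "Z \<in> B" "g \<in> lmod_hom R X Z" "h \<in> lmod_hom R Z M"
      "\<And>s. s \<in> {x} \<Longrightarrow> g s = \<zero>\<^bsub>Z\<^esub>" "\<And>x. x \<in> carrier X \<Longrightarrow> h (g x) = f x"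
      using x X(1) by (rule_tac lifts_throughE[OF lifts X(2) _ _ X(3), of "{x}"]) auto
    have "restrict g (carrier X) \<in> Arr ?C p (Z, h)" unfolding X(1) using Z(5) by (intro rarr X(2) Z(2))
    moreover have "(Z, h) \<in> Obj ?C" using obj Z(1,3) by blast
    moreover have "restrict g (carrier X) x = \<zero>\<^bsub>fst (Z, h)\<^esub>" using x X(1) Z(4) by simp
    ultimately show "\<exists>q\<in>Obj ?C. \<exists>u\<in>Arr ?C p q. u x = \<zero>\<^bsub>fst q\<^esub>" by blast
  qed (auto simp: obj arr)
  then have "is_colimit R ?C fst ?d M snd" by (rule C.explicit_imp_colimit)
  then show ?thesis unfolding lim_class_def using cat dg by blast
qed

lemma lifts_through_retract:
  assumes lifts: "lifts_through R B N" and M: "left_module R M" and N: "left_module R N"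
    and i: "i \<in> lmod_hom R M N" and r: "r \<in> lmod_hom R N M" and ri: "\<And>x. x \<in> carrier M \<Longrightarrow> r (i x) = x"
  shows "lifts_through R B M"
  unfolding lifts_through_def
proof (intro ballI allI impI)
  fix X S f assume X: "X \<in> B" and S: "finite S" "S \<subseteq> carrier X" and f: "f \<in> lmod_hom R X M"
    and fS: "\<forall>s\<in>S. f s = \<zero>\<^bsub>M\<^esub>"
  obtain Z g h where Z: "Z \<in> B" "g \<in> lmod_hom R X Z" "h \<in> lmod_hom R Z N"
    "\<And>s. s \<in> S \<Longrightarrow> g s = \<zero>\<^bsub>Z\<^esub>" "\<And>x. x \<in> carrier X \<Longrightarrow> h (g x) = i (f x)"
    using fS lmod_hom_zero[OF M N i]
    by (rule_tac lifts_throughE[OF lifts X S lmod_hom_comp[OF f i]]) auto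
  then show "\<exists>Z\<in>B. \<exists>g\<in>lmod_hom R X Z. \<exists>h\<in>lmod_hom R Z M. (\<forall>s\<in>S. g s = \<zero>\<^bsub>Z\<^esub>) \<and> (\<forall>x\<in>carrier X. h (g x) = f x)"
    using ri lmod_homD(1)[OF f] by (intro bexI[OF _ Z(1)] bexI[OF _ Z(2)] bexI[OF _ lmod_hom_comp[OF Z(3) r]]) auto
qed

section \<open>Approximations\<close>

lemma lifts_through_member:
  assumes "X \<in> B" shows "lifts_through R B X"
  unfolding lifts_through_def
proof (intro ballI allI impI)
  fix Y S f assume f: "f \<in> lmod_hom R Y X" "\<forall>s\<in>S. f s = \<zero>\<^bsub>X\<^esub>"
  have "(\<lambda>x. x) \<in> lmod_hom R X X" by (rule lmod_homI) simp_all
  then show "\<exists>Z\<in>B. \<exists>g\<in>lmod_hom R Y Z. \<exists>h\<in>lmod_hom R Z X. (\<forall>s\<in>S. g s = \<zero>\<^bsub>Z\<^esub>) \<and> (\<forall>x\<in>carrier Y. h (g x) = f x)"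
    using f(2) by (intro bexI[OF _ assms] bexI[OF _ f(1)] bexI[where x="\<lambda>x. x"]) simp_all
qed

text \<open>
  The universal candidate is the homomorphism from \<open>X\<close> to the product of all members of \<open>B\<close>, one
  factor for each homomorphism that kills \<open>S\<close>.  The product is in \<open>lim B\<close> by coherence,
  so this homomorphism factors through a member of \<open>B\<close>.  A homomorphism is coded by the
  list of its values at generators, which keeps the index set within the type allowed by
  \<open>B_coherent\<close>.
\<close>

lemma left_approximation:
  fixes B :: "('r, 'b) module set"
  assumes R: "ring R" and B: "additive_fp_subcategory R B" and reg: "regular_module R \<in> lim_class R B"
    and coh: "B_coherent R B" and X: "X \<in> B" and S: "finite S" "S \<subseteq> carrier X"
  shows "\<exists>Y\<in>B. \<exists>g\<in>lmod_hom R X Y. (\<forall>s\<in>S. g s = \<zero>\<^bsub>Y\<^esub>) \<and>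
    (\<forall>Z\<in>B. \<forall>f\<in>lmod_hom R X Z. (\<forall>s\<in>S. f s = \<zero>\<^bsub>Z\<^esub>) \<longrightarrow> (\<exists>h\<in>lmod_hom R Y Z. \<forall>x\<in>carrier X. h (g x) = f x))"
proof -
  have fp: "finitely_presented R X" if "X \<in> B" for X
    using B that by (auto simp: additive_fp_subcategory_def)
  have Bm: "left_module R X" if "X \<in> B" for X using fp[OF that] by (simp add: finitely_presented_def)
  interpret X: left_module R X by (rule Bm[OF X])
  obtain n p where p: "p \<in> lmod_hom R (free_module R n) X" "p ` carrier (free_module R n) = carrier X"
    using fp[OF X] unfolding finitely_presented_def by blast
  define xs where "xs = map (\<lambda>l. p (unit_vec R n l)) [0..<n]"
  define kills where "kills Z f \<longleftrightarrow> f \<in> lmod_hom R X Z \<and> (\<forall>s\<in>S. f s = \<zero>\<^bsub>Z\<^esub>)" for f and Z :: "('r, 'b) module"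
  define I where "I = {(Z, map f xs) |Z f. Z \<in> B \<and> kills Z f}"
  \<comment> \<open>The choice is harmless: a homomorphism is determined by its values at the generators \<open>xs\<close>.\<close>
  define hom_at where "hom_at i = (SOME f. kills (fst i) f \<and> map f xs = snd i)" for i
  have ha: "kills (fst i) (hom_at i)" "map (hom_at i) xs = snd i" "fst i \<in> B" if "i \<in> I" for i
  proof -
    have "\<exists>f. kills (fst i) f \<and> map f xs = snd i" using that by (auto simp: I_def)
    from someI_ex[OF this] show "kills (fst i) (hom_at i)" "map (hom_at i) xs = snd i" by (auto simp: hom_at_def)
    show "fst i \<in> B" using that by (auto simp: I_def)
  qed
  note hh = lmod_homD[OF ha(1)[unfolded kills_def, THEN conjunct1]]
  let ?P = "prod_module I fst"
  have "\<forall>i\<in>I. fst i \<in> lim_class R B"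
    using lim_class_criterion[OF R B reg Bm[OF ha(3)] lifts_through_member[OF ha(3)]] by (intro ballI)
  then have P: "?P \<in> lim_class R B"
    by (rule coh[unfolded B_coherent_def, THEN spec, THEN spec, THEN mp])
  let ?c = "\<lambda>x. \<lambda>i\<in>I. hom_at i x"
  have c: "?c \<in> lmod_hom R X ?P"
  proof (rule lmod_homI)
    fix x assume x: "x \<in> carrier X"
    show "?c x \<in> carrier ?P" using hh(1)[OF _ x] unfolding prod_module_def by simp
    fix r assume r: "r \<in> carrier R"
    show "?c (r \<odot>\<^bsub>X\<^esub> x) = r \<odot>\<^bsub>?P\<^esub> ?c x"
      using hh(3)[OF _ r x] unfolding prod_module_def by (simp cong: restrict_cong)
  next
    fix x y assume x: "x \<in> carrier X" "y \<in> carrier X"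
    show "?c (x \<oplus>\<^bsub>X\<^esub> y) = ?c x \<oplus>\<^bsub>?P\<^esub> ?c y"
      using hh(2)[OF _ x] unfolding prod_module_def by (simp cong: restrict_cong)
  qed
  have cS: "?c s = \<zero>\<^bsub>?P\<^esub>" if s: "s \<in> S" for s
  proof -
    have "hom_at i s = \<zero>\<^bsub>fst i\<^esub>" if "i \<in> I" for i using ha(1)[OF that] s by (simp add: kills_def)
    then show ?thesis unfolding prod_module_def by (simp cong: restrict_cong)
  qed
  have "lifts_through R B ?P" by (rule lim_class_lifts(2)[OF R fp P])
  then obtain Y g h where Y: "Y \<in> B" "g \<in> lmod_hom R X Y" "h \<in> lmod_hom R Y ?P"
    "\<And>s. s \<in> S \<Longrightarrow> g s = \<zero>\<^bsub>Y\<^esub>" "\<And>x. x \<in> carrier X \<Longrightarrow> h (g x) = ?c x"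
    by (rule lifts_throughE[OF _ X S c cS]) blast+
  have "\<exists>h\<in>lmod_hom R Y Z. \<forall>x\<in>carrier X. h (g x) = f x"
    if Z: "Z \<in> B" and f: "f \<in> lmod_hom R X Z" "\<forall>s\<in>S. f s = \<zero>\<^bsub>Z\<^esub>" for Z f
  proof -
    let ?i = "(Z, map f xs)"
    have i: "?i \<in> I" using Z f by (auto simp: I_def kills_def)
    have "hom_at ?i x = f x" if "x \<in> carrier X" for x
    proof (rule presentation_eq[OF Bm[OF X] p Bm[OF Z] _ f(1) _ that])
      show "hom_at ?i \<in> lmod_hom R X Z" using ha(1)[OF i] by (simp add: kills_def)
      show "hom_at ?i (p (unit_vec R n l)) = f (p (unit_vec R n l))" if "l < n" for l
        using ha(2)[OF i] that by (simp add: xs_def)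
    qed
    then have "\<forall>x\<in>carrier X. h (g x) ?i = f x" using Y(5) i by simp
    moreover have "(\<lambda>y. h y ?i) \<in> lmod_hom R Y Z"
    proof (rule lmod_homI)
      fix y assume y: "y \<in> carrier Y"
      show "h y ?i \<in> carrier Z"
        using lmod_homD(1)[OF Y(3) y] i PiE_mem[of "h y" I "\<lambda>i. carrier (fst i)" ?i]
        by (simp add: prod_module_def)
      fix r assume r: "r \<in> carrier R"
      show "h (r \<odot>\<^bsub>Y\<^esub> y) ?i = r \<odot>\<^bsub>Z\<^esub> h y ?i"
        unfolding lmod_homD(3)[OF Y(3) r y] using i by (simp add: prod_module_def)
    next
      fix y y' assume y: "y \<in> carrier Y" "y' \<in> carrier Y"
      show "h (y \<oplus>\<^bsub>Y\<^esub> y') ?i = h y ?i \<oplus>\<^bsub>Z\<^esub> h y' ?i"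
        unfolding lmod_homD(2)[OF Y(3) y] using i by (simp add: prod_module_def)
    qed
    ultimately show ?thesis by (intro bexI[where x="\<lambda>y. h y ?i"])
  qed
  then show ?thesis
    using Y(4) by (intro bexI[OF _ Y(1)] bexI[OF _ Y(2)] conjI ballI impI) simp_all
qed

text \<open>
  That homomorphisms killing \<open>S\<close> extend along the approximation \<open>g\<close> is, after presenting \<open>X\<close> and \<open>Y\<close>, an
  implication between linear systems: \<open>T\<close> consists of the relations of \<open>X\<close> and of lifts of \<open>S\<close>, and
  \<open>E\<close> says that \<open>b\<close> satisfies the relations of \<open>Y\<close> and that \<open>a\<close> is the restriction of \<open>b\<close> along \<open>g\<close>.
\<close>

lemma bidual_lifts_through:
  fixes M :: "('r, 'm) module" and B :: "('r, 'b) module set"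
  assumes R: "ring R" and B: "additive_fp_subcategory R B" and reg: "regular_module R \<in> lim_class R B"
    and coh: "B_coherent R B" and M: "left_module R M" and lifts: "lifts_through R B M"
  shows "lifts_through R B (bidual M)"
  unfolding lifts_through_def
proof (intro ballI allI impI)
  fix X S f assume X: "X \<in> B" and S: "finite S" "S \<subseteq> carrier X" and f: "f \<in> lmod_hom R X (bidual M)"
    and fS: "\<forall>s\<in>S. f s = \<zero>\<^bsub>bidual M\<^esub>"
  have fp: "finitely_presented R X" if "X \<in> B" for X
    using B that by (auto simp: additive_fp_subcategory_def)
  have MM: "left_module R (bidual M)" by (rule bidual_left_module[OF M])
  obtain Y g where Y: "Y \<in> B" and g: "g \<in> lmod_hom R X Y" and gS: "\<forall>s\<in>S. g s = \<zero>\<^bsub>Y\<^esub>"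
    and approx: "\<forall>Z\<in>B. \<forall>f\<in>lmod_hom R X Z. (\<forall>s\<in>S. f s = \<zero>\<^bsub>Z\<^esub>) \<longrightarrow> (\<exists>h\<in>lmod_hom R Y Z. \<forall>x\<in>carrier X. h (g x) = f x)"
    using left_approximation[OF R B reg coh X S] by blast
  have extend: "\<exists>h\<in>lmod_hom R Y M. \<forall>x\<in>carrier X. h (g x) = f x"
    if f: "f \<in> lmod_hom R X M" "\<And>s. s \<in> S \<Longrightarrow> f s = \<zero>\<^bsub>M\<^esub>" for f
  proof -
    obtain Z k h where Z: "Z \<in> B" "k \<in> lmod_hom R X Z" "h \<in> lmod_hom R Z M"
      "\<And>s. s \<in> S \<Longrightarrow> k s = \<zero>\<^bsub>Z\<^esub>" "\<And>x. x \<in> carrier X \<Longrightarrow> h (k x) = f x"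
      using lifts_throughE[OF lifts X S f] by metis
    obtain l where l: "l \<in> lmod_hom R Y Z" "\<forall>x\<in>carrier X. l (g x) = k x" using approx Z(1,2,4) by blast
    show ?thesis using l(2) Z(5) by (intro bexI[OF _ lmod_hom_comp[OF l(1) Z(3)]]) simp
  qed
  obtain n p V where p: "left_module R X" "p \<in> lmod_hom R (free_module R n) X"
    "p ` carrier (free_module R n) = carrier X" and V: "finite V" "V \<subseteq> carrier (free_module R n)"
    "a_kernel (free_module R n) X p = submodule_span R (free_module R n) V"
    using fp[OF X] by (rule finitely_presentedE)
  obtain m q W where q: "left_module R Y" "q \<in> lmod_hom R (free_module R m) Y"
    "q ` carrier (free_module R m) = carrier Y" and W: "finite W" "W \<subseteq> carrier (free_module R m)"
    "a_kernel (free_module R m) Y q = submodule_span R (free_module R m) W"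
    using fp[OF Y] by (rule finitely_presentedE)
  let ?F = "free_module R n" and ?G = "free_module R m"
  have F: "left_module R ?F" and G: "left_module R ?G" by (rule free_left_module[OF R])+
  have F0: "\<zero>\<^bsub>?F\<^esub> \<in> carrier ?F"
    using abelian_monoid.zero_closed[OF abelian_group.axioms(1)[OF left_module.axioms(2)[OF F]]] .
  have pV: "p v = \<zero>\<^bsub>X\<^esub>" if "v \<in> V" for v
    using submodule_span_incl[of V R ?F] that unfolding V(3)[symmetric] by (auto simp: a_kernel_def kernel_def)
  have qW: "q w = \<zero>\<^bsub>Y\<^esub>" if "w \<in> W" for w
    using submodule_span_incl[of W R ?G] that unfolding W(3)[symmetric] by (auto simp: a_kernel_def kernel_def)
  have u: "unit_vec R n l \<in> carrier ?F" "unit_vec R m l \<in> carrier ?G" for l by (rule unit_vec_closed[OF R])+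
  have "\<exists>t. t \<in> carrier ?F \<and> p t = s" if "s \<in> S" for s
    using that S(2) unfolding p(3)[symmetric] by blast
  then obtain \<tau> where \<tau>: "\<And>s. s \<in> S \<Longrightarrow> \<tau> s \<in> carrier ?F \<and> p (\<tau> s) = s" by metis
  have "\<exists>t. t \<in> carrier ?G \<and> q t = g (p (unit_vec R n l))" for l
    using lmod_homD(1)[OF g lmod_homD(1)[OF p(2) u(1)], of l] unfolding q(3)[symmetric] by force
  then obtain Q where Q: "\<And>l. Q l \<in> carrier ?G \<and> q (Q l) = g (p (unit_vec R n l))" by metis
  define T where "T = V \<union> \<tau> ` S"
  define E where "E = (\<lambda>w. (\<zero>\<^bsub>?F\<^esub>, w)) ` W \<union> (\<lambda>l. (unit_vec R n l, Q l)) ` {..<n}"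
  have T: "finite T" "T \<subseteq> carrier ?F" using V S(1) \<tau> by (auto simp: T_def)
  have E: "finite E" "E \<subseteq> carrier ?F \<times> carrier ?G" using W F0 u Q by (auto simp: E_def)
  have zero: "lin_comb L n a \<zero>\<^bsub>?F\<^esub> = \<zero>\<^bsub>L\<^esub>" if "left_module R L" "\<And>l. l < n \<Longrightarrow> a l \<in> carrier L"
    for L :: "('r, 'l) module" and a using lmod_hom_zero[OF F that(1) lin_comb_hom[OF that]] .
  let ?\<xi> = "\<lambda>l. f (p (unit_vec R n l))"
  have \<xi>: "?\<xi> l \<in> carrier (bidual M)" for l by (intro lmod_homD(1)[OF f] lmod_homD(1)[OF p(2)] u)
  have \<xi>p: "lin_comb (bidual M) n ?\<xi> r = f (p r)" if "r \<in> carrier ?F" for r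
    using free_hom_lin_comb[OF MM lmod_hom_comp[OF p(2) f] that] by simp
  have "\<exists>\<eta>. (\<forall>j<m. \<eta> j \<in> carrier (bidual M)) \<and>
    (\<forall>(s, k)\<in>E. lin_comb (bidual M) n ?\<xi> s = lin_comb (bidual M) m \<eta> k)"
  proof (rule bidual_transfer[OF M T E _ \<xi>])
    show "lin_comb (bidual M) n ?\<xi> t = \<zero>\<^bsub>bidual M\<^esub>" if "t \<in> T" for t
      using that T(2) pV \<tau> fS lmod_hom_zero[OF p(1) MM f] by (auto simp: T_def \<xi>p)
    fix a assume a: "\<And>l. l < n \<Longrightarrow> a l \<in> carrier M" and aT: "\<And>t. t \<in> T \<Longrightarrow> lin_comb M n a t = \<zero>\<^bsub>M\<^esub>"
    have aV: "lin_comb M n a v = \<zero>\<^bsub>M\<^esub>" if "v \<in> V" for v using aT that by (simp add: T_def)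
    obtain fa where fa: "fa \<in> lmod_hom R X M" "\<And>r. r \<in> carrier ?F \<Longrightarrow> fa (p r) = lin_comb M n a r"
      using presentation_hom[OF p V(2,3) M, of a] a aV by blast
    have "fa s = \<zero>\<^bsub>M\<^esub>" if "s \<in> S" for s using fa(2)[of "\<tau> s"] \<tau>[OF that] aT[of "\<tau> s"] that by (simp add: T_def)
    then obtain h where h: "h \<in> lmod_hom R Y M" "\<And>x. x \<in> carrier X \<Longrightarrow> h (g x) = fa x"
      using extend[OF fa(1)] by blast
    let ?b = "\<lambda>j. h (q (unit_vec R m j))"
    have bq: "lin_comb M m ?b k = h (q k)" if "k \<in> carrier ?G" for k
      using free_hom_lin_comb[OF M lmod_hom_comp[OF q(2) h(1)] that] by simp
    have "lin_comb M n a \<zero>\<^bsub>?F\<^esub> = lin_comb M m ?b w" if "w \<in> W" for w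
      using bq[of w] qW[OF that] W(2) that lmod_hom_zero[OF q(1) M h(1)] zero[OF M a] by auto
    moreover have "lin_comb M n a (unit_vec R n l) = lin_comb M m ?b (Q l)" for l
      using bq[of "Q l"] Q[of l] fa(2)[OF u(1), of l] h(2) lmod_homD(1)[OF p(2) u(1)] by simp
    moreover have "?b j \<in> carrier M" for j by (intro lmod_homD(1)[OF h(1)] lmod_homD(1)[OF q(2)] u)
    ultimately show "\<exists>b. (\<forall>j<m. b j \<in> carrier M) \<and> (\<forall>(s, k)\<in>E. lin_comb M n a s = lin_comb M m b k)"
      by (intro exI[of _ ?b]) (auto simp: E_def)
  qed
  then obtain \<eta> where \<eta>: "\<And>j. j < m \<Longrightarrow> \<eta> j \<in> carrier (bidual M)"
    "\<forall>(s, k)\<in>E. lin_comb (bidual M) n ?\<xi> s = lin_comb (bidual M) m \<eta> k" by blast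
  have \<eta>W: "lin_comb (bidual M) m \<eta> w = \<zero>\<^bsub>bidual M\<^esub>" if "w \<in> W" for w
  proof -
    have "(\<zero>\<^bsub>?F\<^esub>, w) \<in> E" using that by (simp add: E_def)
    then have "lin_comb (bidual M) n ?\<xi> \<zero>\<^bsub>?F\<^esub> = lin_comb (bidual M) m \<eta> w" using \<eta>(2) by blast
    then show ?thesis using zero[OF MM, of ?\<xi>] \<xi> by simp
  qed
  have \<eta>Q: "lin_comb (bidual M) m \<eta> (Q l) = ?\<xi> l" if "l < n" for l
  proof -
    have "(unit_vec R n l, Q l) \<in> E" using that by (simp add: E_def)
    then have "lin_comb (bidual M) n ?\<xi> (unit_vec R n l) = lin_comb (bidual M) m \<eta> (Q l)" using \<eta>(2) by blast
    then show ?thesis using \<xi>p[OF u(1), of l] by simp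
  qed
  obtain h where h: "h \<in> lmod_hom R Y (bidual M)" "\<And>r. r \<in> carrier ?G \<Longrightarrow> h (q r) = lin_comb (bidual M) m \<eta> r"
    using presentation_hom[OF q W(2,3) MM, of \<eta>] \<eta>(1) \<eta>W by blast
  have "h (g x) = f x" if "x \<in> carrier X" for x
  proof (rule presentation_eq[OF p MM lmod_hom_comp[OF g h(1)] f _ that])
    show "h (g (p (unit_vec R n l))) = f (p (unit_vec R n l))" if "l < n" for l
      using h(2)[of "Q l"] Q[of l] \<eta>Q[OF that] by simp
  qed
  then show "\<exists>Z\<in>B. \<exists>g\<in>lmod_hom R X Z. \<exists>h\<in>lmod_hom R Z (bidual M).
      (\<forall>s\<in>S. g s = \<zero>\<^bsub>Z\<^esub>) \<and> (\<forall>x\<in>carrier X. h (g x) = f x)"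
    using gS by (intro bexI[OF _ Y] bexI[OF _ g] bexI[OF _ h(1)] conjI ballI) simp_all
qed

section \<open>The pure injective envelope and its quotient\<close>

lemma left_module_image:
  assumes M: "left_module R M" and sur: "\<pi> ` carrier M = carrier Q" and zero: "\<pi> \<zero>\<^bsub>M\<^esub> = \<zero>\<^bsub>Q\<^esub>"
    and add: "\<And>x y. \<lbrakk>x \<in> carrier M; y \<in> carrier M\<rbrakk> \<Longrightarrow> \<pi> (x \<oplus>\<^bsub>M\<^esub> y) = \<pi> x \<oplus>\<^bsub>Q\<^esub> \<pi> y"
    and smult: "\<And>r x. \<lbrakk>r \<in> carrier R; x \<in> carrier M\<rbrakk> \<Longrightarrow> \<pi> (r \<odot>\<^bsub>M\<^esub> x) = r \<odot>\<^bsub>Q\<^esub> \<pi> x"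
  shows "left_module R Q"
proof -
  interpret M: left_module R M by fact
  have el: "\<exists>x\<in>carrier M. q = \<pi> x" if "q \<in> carrier Q" for q using that unfolding sur[symmetric] by blast
  have cl: "\<pi> x \<in> carrier Q" if "x \<in> carrier M" for x using that unfolding sur[symmetric] by blast
  show ?thesis
  proof (intro left_module.intro left_module_axioms.intro M.ring_axioms abelian_groupI)
    fix x assume "x \<in> carrier Q" then obtain x' where x: "x' \<in> carrier M" "x = \<pi> x'" using el by blast
    show "\<exists>y\<in>carrier Q. y \<oplus>\<^bsub>Q\<^esub> x = \<zero>\<^bsub>Q\<^esub>"
      using x by (intro bexI[of _ "\<pi> (\<ominus>\<^bsub>M\<^esub> x')"]) (simp_all add: cl add[symmetric] zero M.M.l_neg)
    show "\<zero>\<^bsub>Q\<^esub> \<oplus>\<^bsub>Q\<^esub> x = x" using x by (simp add: zero[symmetric] add[symmetric])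
    show "\<one>\<^bsub>R\<^esub> \<odot>\<^bsub>Q\<^esub> x = x" using x by (simp add: smult[symmetric])
    fix r assume r: "r \<in> carrier R"
    show "r \<odot>\<^bsub>Q\<^esub> x \<in> carrier Q" using x r by (simp add: smult[symmetric] cl)
    fix s assume s: "s \<in> carrier R"
    show "(r \<oplus>\<^bsub>R\<^esub> s) \<odot>\<^bsub>Q\<^esub> x = r \<odot>\<^bsub>Q\<^esub> x \<oplus>\<^bsub>Q\<^esub> s \<odot>\<^bsub>Q\<^esub> x"
      using x r s by (simp add: smult[symmetric] add[symmetric] M.smult_l_distr)
    show "(r \<otimes>\<^bsub>R\<^esub> s) \<odot>\<^bsub>Q\<^esub> x = r \<odot>\<^bsub>Q\<^esub> (s \<odot>\<^bsub>Q\<^esub> x)"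
      using x r s by (simp add: smult[symmetric] M.smult_assoc1)
  next
    fix x y assume "x \<in> carrier Q" "y \<in> carrier Q"
    then obtain x' y' where x: "x' \<in> carrier M" "x = \<pi> x'" "y' \<in> carrier M" "y = \<pi> y'" using el by blast
    show "x \<oplus>\<^bsub>Q\<^esub> y \<in> carrier Q" using x by (simp add: add[symmetric] cl)
    show "x \<oplus>\<^bsub>Q\<^esub> y = y \<oplus>\<^bsub>Q\<^esub> x" using x by (simp add: add[symmetric] M.M.a_comm)
    fix r assume r: "r \<in> carrier R"
    show "r \<odot>\<^bsub>Q\<^esub> (x \<oplus>\<^bsub>Q\<^esub> y) = r \<odot>\<^bsub>Q\<^esub> x \<oplus>\<^bsub>Q\<^esub> r \<odot>\<^bsub>Q\<^esub> y"
      using x r by (simp add: smult[symmetric] add[symmetric] M.smult_r_distr)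
  next
    fix x y z assume "x \<in> carrier Q" "y \<in> carrier Q" "z \<in> carrier Q"
    then obtain x' y' z' where x: "x' \<in> carrier M" "x = \<pi> x'" "y' \<in> carrier M" "y = \<pi> y'" "z' \<in> carrier M" "z = \<pi> z'"
      using el[of x] el[of y] el[of z] by auto
    show "x \<oplus>\<^bsub>Q\<^esub> y \<oplus>\<^bsub>Q\<^esub> z = x \<oplus>\<^bsub>Q\<^esub> (y \<oplus>\<^bsub>Q\<^esub> z)" 
      using arg_cong[OF M.M.a_assoc[OF x(1,3,5)], of \<pi>] x by (simp add: add)
  next
    show "\<zero>\<^bsub>Q\<^esub> \<in> carrier Q" using cl[OF M.M.zero_closed] zero by simp
  qed
qed

lemma pure_mono_range:
  assumes F: "left_module R F" and P: "left_module R P" and e: "pure_mono R F P e"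
  defines "G \<equiv> P\<lparr>carrier := e ` carrier F\<rparr>"
  shows "left_module R G" "e \<in> lmod_hom R F G" "(\<lambda>x. x) \<in> lmod_hom R G P" "pure_mono R G P (\<lambda>x. x)"
proof -
  have eh: "e \<in> lmod_hom R F P" using e by (simp add: pure_mono_def)
  interpret F: left_module R F by fact
  interpret P: left_module R P by fact
  show G: "left_module R G"
    using lmod_homD[OF eh] lmod_hom_zero[OF F P eh] by (intro left_module_image[OF F, of e]) (simp_all add: G_def)
  show eG: "e \<in> lmod_hom R F G"
    using lmod_homD[OF eh] by (intro lmod_homI) (simp_all add: G_def)
  show incl: "(\<lambda>x. x) \<in> lmod_hom R G P"
    using lmod_homD(1)[OF eh] by (intro lmod_homI) (auto simp: G_def)
  show "pure_mono R G P (\<lambda>x. x)"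
    unfolding pure_mono_def
  proof (intro conjI allI impI incl)
    show "inj_on (\<lambda>x. x) (carrier G)" by simp
    fix m n :: nat and r a x
    assume r: "\<forall>k<m. \<forall>l<n. r k l \<in> carrier R" and a: "\<forall>k<m. a k \<in> carrier G"
      and x: "\<forall>l<n. x l \<in> carrier P"
      and sol: "\<forall>k<m. (\<Oplus>\<^bsub>P\<^esub>l\<in>{..<n}. r k l \<odot>\<^bsub>P\<^esub> x l) = a k"
    have "\<forall>k. k < m \<longrightarrow> (\<exists>b. b \<in> carrier F \<and> a k = e b)" using a by (auto simp: G_def)
    then obtain b where b: "\<And>k. k < m \<Longrightarrow> b k \<in> carrier F \<and> a k = e (b k)" by metis
    let ?row = "\<lambda>k. \<lambda>l\<in>{..<n}. r k l"
    have row: "?row k \<in> carrier (free_module R n)" if "k < m" for k using r that by (intro restrict_free) simp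
    let ?T = "(\<lambda>k. (?row k, b k)) ` {..<m}"
    have "\<exists>y. (\<forall>l<n. y l \<in> carrier F) \<and> (\<forall>t\<in>?T. lin_comb F n y (fst t) = snd t)"
    proof (rule pure_mono_solve[OF e, where x = x])
      show "?T \<subseteq> carrier (free_module R n) \<times> carrier F" using row b by auto
      show "lin_comb P n x (fst t) = e (snd t)" if "t \<in> ?T" for t
        using that lin_comb_restrict[OF P] x r sol b by auto
    qed (use x in auto)
    then obtain y where y: "\<And>l. l < n \<Longrightarrow> y l \<in> carrier F" "\<And>k. k < m \<Longrightarrow> lin_comb F n y (?row k) = b k" by auto
    have ey: "e (y l) \<in> carrier G" if "l < n" for l using lmod_homD(1)[OF eG y(1)[OF that]] .
    have "(\<Oplus>\<^bsub>G\<^esub>l\<in>{..<n}. r k l \<odot>\<^bsub>G\<^esub> e (y l)) = a k" if k: "k < m" for k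
    proof -
      have "(\<Oplus>\<^bsub>G\<^esub>l\<in>{..<n}. r k l \<odot>\<^bsub>G\<^esub> e (y l)) = lin_comb G n (\<lambda>l. e (y l)) (?row k)"
        using ey r k by (intro lin_comb_restrict[OF G, symmetric]) auto
      also have "\<dots> = e (lin_comb F n y (?row k))" by (rule hom_lin_comb[OF F G eG y(1) row[OF k], symmetric])
      finally show ?thesis using y(2)[OF k] b[OF k] by simp
    qed
    then show "\<exists>y. (\<forall>l<n. y l \<in> carrier G) \<and> (\<forall>k<m. (\<Oplus>\<^bsub>G\<^esub>l\<in>{..<n}. r k l \<odot>\<^bsub>G\<^esub> y l) = a k)"
      using ey by (intro exI[of _ "\<lambda>l. e (y l)"]) blast
  qed
qed

lemma quotient_projection:
  assumes F: "left_module R F" and P: "left_module R P" and e: "e \<in> lmod_hom R F P"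
  defines "H \<equiv> e ` carrier F"
  shows "left_module R (quotient_module P H)"
    and "(\<lambda>x. H +>\<^bsub>P\<^esub> x) \<in> lmod_hom R P (quotient_module P H)"
    and "(\<lambda>x. H +>\<^bsub>P\<^esub> x) ` carrier P = carrier (quotient_module P H)"
    and "\<And>x. x \<in> carrier P \<Longrightarrow> H +>\<^bsub>P\<^esub> x = \<zero>\<^bsub>quotient_module P H\<^esub> \<longleftrightarrow> x \<in> H"
proof -
  interpret F: left_module R F by fact
  interpret P: left_module R P by fact
  let ?Q = "quotient_module P H" and ?\<pi> = "\<lambda>x. H +>\<^bsub>P\<^esub> x"
  interpret e: abelian_group_hom F P e by (rule lmod_hom_abelian[OF F P e])
  have "subgroup H (add_monoid P)"
    unfolding H_def using group_hom.img_is_subgroup[OF e.a_group_hom] by simp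
  then have ag: "additive_subgroup H P" by (rule additive_subgroupI)
  interpret H: abelian_subgroup H P by (rule abelian_subgroupI3[OF ag P.M.abelian_group_axioms])
  have HP: "H \<subseteq> carrier P" by (rule H.a_subset)
  have Hsm: "r \<odot>\<^bsub>P\<^esub> h \<in> H" if r: "r \<in> carrier R" and h: "h \<in> H" for r h
  proof -
    obtain x where "x \<in> carrier F" "h = e x" using h by (auto simp: H_def)
    then show ?thesis using lmod_homD(3)[OF e r, symmetric] r by (simp add: H_def)
  qed
  show sur: "?\<pi> ` carrier P = carrier ?Q"
    by (auto simp: quotient_module_def A_RCOSETS_def')
  have eq: "?\<pi> x = ?\<pi> y" if "x \<in> carrier P" "y \<in> ?\<pi> x" for x y
    by (rule P.M.a_repr_independence[OF that(2,1) H.a_subgroup])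
  have zero: "?\<pi> x = \<zero>\<^bsub>?Q\<^esub> \<longleftrightarrow> x \<in> H" if "x \<in> carrier P" for x
    using P.M.a_coset_join1[OF _ that H.a_subgroup] P.M.a_coset_join2[OF that H.a_subgroup]
    by (auto simp: quotient_module_def)
  then show "\<And>x. x \<in> carrier P \<Longrightarrow> ?\<pi> x = \<zero>\<^bsub>?Q\<^esub> \<longleftrightarrow> x \<in> H" .
  have add: "?\<pi> (x \<oplus>\<^bsub>P\<^esub> y) = ?\<pi> x \<oplus>\<^bsub>?Q\<^esub> ?\<pi> y" if "x \<in> carrier P" "y \<in> carrier P" for x y
    using H.a_rcos_sum[OF that] by (simp add: quotient_module_def)
  have smult: "?\<pi> (r \<odot>\<^bsub>P\<^esub> x) = r \<odot>\<^bsub>?Q\<^esub> ?\<pi> x" if r: "r \<in> carrier R" and x: "x \<in> carrier P" for r x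
  proof -
    have "?\<pi> (r \<odot>\<^bsub>P\<^esub> y) = ?\<pi> (r \<odot>\<^bsub>P\<^esub> x)" if y: "y \<in> ?\<pi> x" for y
    proof -
      obtain h where h: "h \<in> H" "y = h \<oplus>\<^bsub>P\<^esub> x" using y by (auto simp: a_r_coset_def')
      have "r \<odot>\<^bsub>P\<^esub> y = r \<odot>\<^bsub>P\<^esub> h \<oplus>\<^bsub>P\<^esub> r \<odot>\<^bsub>P\<^esub> x" using h r x HP by (auto simp: P.smult_r_distr)
      then have "r \<odot>\<^bsub>P\<^esub> y \<in> ?\<pi> (r \<odot>\<^bsub>P\<^esub> x)" using Hsm[OF r h(1)] by (auto simp: a_r_coset_def')
      then show ?thesis using eq[of "r \<odot>\<^bsub>P\<^esub> x"] r x by simp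
    qed
    moreover have "x \<in> ?\<pi> x" using H.a_rcos_self[OF x] .
    ultimately have "(\<Union>y\<in>?\<pi> x. ?\<pi> (r \<odot>\<^bsub>P\<^esub> y)) = ?\<pi> (r \<odot>\<^bsub>P\<^esub> x)" by blast
    then show ?thesis by (simp add: quotient_module_def)
  qed
  have "?\<pi> \<zero>\<^bsub>P\<^esub> = \<zero>\<^bsub>?Q\<^esub>" using zero[of "\<zero>\<^bsub>P\<^esub>"] H.zero_closed by simp
  then show "left_module R ?Q" by (rule left_module_image[OF P sur _ add smult])
  show "?\<pi> \<in> lmod_hom R P ?Q" using sur add smult by (intro lmod_homI) auto
qed

text \<open>
  Lifts \<open>x\<close> of the images of the generators satisfy the relations up to elements of \<open>F\<close>.  By purity
  these errors are the values of the relations at a tuple \<open>y\<close> in \<open>F\<close>, and \<open>x - y\<close> defines a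
  homomorphism to \<open>P\<close>.
\<close>

lemma lifts_through_pure_quotient:
  fixes F :: "('r, 'f) module" and P :: "('r, 'p) module" and B :: "('r, 'b) module set"
  assumes R: "ring R" and fp: "\<And>X. X \<in> B \<Longrightarrow> finitely_presented R X"
    and F: "left_module R F" and P: "left_module R P" and e: "pure_mono R F P e" and lifts: "lifts_through R B P"
  shows "lifts_through R B (quotient_module P (e ` carrier F))"
  unfolding lifts_through_def
proof (intro ballI allI impI)
  have eh: "e \<in> lmod_hom R F P" using e by (simp add: pure_mono_def)
  let ?H = "e ` carrier F"
  let ?Q = "quotient_module P ?H" and ?\<pi> = "\<lambda>x. ?H +>\<^bsub>P\<^esub> x"
  note proj = quotient_projection[OF F P eh]
  have Q: "left_module R ?Q" by (rule proj(1))
  interpret P: left_module R P by fact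
  interpret F: left_module R F by fact
  interpret Q: left_module R ?Q by fact
  fix X S f assume X: "X \<in> B" and S: "finite S" "S \<subseteq> carrier X" and f: "f \<in> lmod_hom R X ?Q"
    and fS: "\<forall>s\<in>S. f s = \<zero>\<^bsub>?Q\<^esub>"
  obtain n p V where p: "left_module R X" "p \<in> lmod_hom R (free_module R n) X"
    "p ` carrier (free_module R n) = carrier X" and V: "finite V" "V \<subseteq> carrier (free_module R n)"
    "a_kernel (free_module R n) X p = submodule_span R (free_module R n) V"
    using fp[OF X] by (rule finitely_presentedE)
  let ?F = "free_module R n" and ?f = "\<lambda>l. f (p (unit_vec R n l))"
  have pV: "p v = \<zero>\<^bsub>X\<^esub>" if "v \<in> V" for v
    using submodule_span_incl[of V R ?F] that unfolding V(3)[symmetric] by (auto simp: a_kernel_def kernel_def)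
  have "\<exists>t. t \<in> carrier ?F \<and> p t = s" if "s \<in> S" for s
    using that S(2) unfolding p(3)[symmetric] by blast
  then obtain \<tau> where \<tau>: "\<And>s. s \<in> S \<Longrightarrow> \<tau> s \<in> carrier ?F \<and> p (\<tau> s) = s" by metis
  define T where "T = V \<union> \<tau> ` S"
  have T: "finite T" "T \<subseteq> carrier ?F" using V S(1) \<tau> by (auto simp: T_def)
  have fT: "f (p t) = \<zero>\<^bsub>?Q\<^esub>" if "t \<in> T" for t
    using that pV \<tau> fS lmod_hom_zero[OF p(1) Q f] by (auto simp: T_def)
  have fc: "?f l \<in> carrier ?Q" for l by (intro lmod_homD(1)[OF f] lmod_homD(1)[OF p(2)] unit_vec_closed R)
  then have "\<exists>x. x \<in> carrier P \<and> ?\<pi> x = ?f l" for l unfolding proj(3)[symmetric] by (metis imageE)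
  then obtain x where x: "\<And>l. x l \<in> carrier P \<and> ?\<pi> (x l) = ?f l" by metis
  have \<pi>lin: "?\<pi> (lin_comb P n a t) = lin_comb ?Q n (\<lambda>l. ?\<pi> (a l)) t"
    if "\<And>l. l < n \<Longrightarrow> a l \<in> carrier P" "t \<in> carrier ?F" for a t
    by (rule hom_lin_comb[OF P Q proj(2) that])
  have "lin_comb P n x t \<in> ?H" if t: "t \<in> T" for t
  proof -
    have tF: "t \<in> carrier ?F" using t T(2) by blast
    have "?\<pi> (lin_comb P n x t) = lin_comb ?Q n ?f t" using \<pi>lin[of x t] x tF by simp
    also have "\<dots> = \<zero>\<^bsub>?Q\<^esub>" using free_hom_lin_comb[OF Q lmod_hom_comp[OF p(2) f] tF] fT[OF t] by simp
    finally show ?thesis using proj(4)[OF lin_comb_closed[OF P _ tF], of x] x by simp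
  qed
  then have "\<exists>c. c \<in> carrier F \<and> lin_comb P n x t = e c" if "t \<in> T" for t using that by blast
  then obtain c where c: "\<And>t. t \<in> T \<Longrightarrow> c t \<in> carrier F \<and> lin_comb P n x t = e (c t)" by metis
  have "\<exists>y. (\<forall>l<n. y l \<in> carrier F) \<and> (\<forall>t\<in>(\<lambda>t. (t, c t)) ` T. lin_comb F n y (fst t) = snd t)"
    by (rule pure_mono_solve[OF e, where x = x]) (use T c x in auto)
  then obtain y where y: "\<And>l. l < n \<Longrightarrow> y l \<in> carrier F" "\<And>t. t \<in> T \<Longrightarrow> lin_comb F n y t = c t" by auto
  have ey: "e (y l) \<in> carrier P" if "l < n" for l using lmod_homD(1)[OF eh y(1)[OF that]] .
  define z where "z l = x l \<oplus>\<^bsub>P\<^esub> \<ominus>\<^bsub>P\<^esub> e (y l)" for l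
  have z: "z l \<in> carrier P" "z l \<oplus>\<^bsub>P\<^esub> e (y l) = x l" if "l < n" for l
    using x[of l] ey[OF that] by (simp_all add: z_def P.M.a_assoc P.M.l_neg)
  have zT: "lin_comb P n z t = \<zero>\<^bsub>P\<^esub>" if t: "t \<in> T" for t
  proof -
    have tF: "t \<in> carrier ?F" using t T(2) by blast
    have lz: "lin_comb P n z t \<in> carrier P" by (rule lin_comb_closed[OF P z(1) tF])
    have ec: "e (c t) \<in> carrier P" using c[OF t] lmod_homD(1)[OF eh] by blast
    have "lin_comb P n z t \<oplus>\<^bsub>P\<^esub> e (c t) = lin_comb P n z t \<oplus>\<^bsub>P\<^esub> lin_comb P n (\<lambda>l. e (y l)) t"
      using hom_lin_comb[OF F P eh _ tF, of y] y(1) y(2)[OF t] by simp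
    also have "\<dots> = lin_comb P n (\<lambda>l. z l \<oplus>\<^bsub>P\<^esub> e (y l)) t" by (rule lin_comb_add[OF P tF z(1) ey, symmetric])
    also have "\<dots> = lin_comb P n x t" using z x by (intro lin_comb_cong[OF P _ _ tF]) simp_all
    also have "\<dots> = e (c t)" using c[OF t] by blast
    finally show ?thesis using lz ec P.M.add.r_cancel_one by auto
  qed
  have zV: "lin_comb P n z v = \<zero>\<^bsub>P\<^esub>" if "v \<in> V" for v using zT that by (simp add: T_def)
  obtain k where k: "k \<in> lmod_hom R X P" "\<And>r. r \<in> carrier ?F \<Longrightarrow> k (p r) = lin_comb P n z r"
    using presentation_hom[OF p V(2,3) P, of z] z(1) zV by blast
  have kS: "k s = \<zero>\<^bsub>P\<^esub>" if "s \<in> S" for s using k(2)[of "\<tau> s"] \<tau>[OF that] zT[of "\<tau> s"] that by (simp add: T_def)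
  have \<pi>k: "?\<pi> (k v) = f v" if "v \<in> carrier X" for v
  proof (rule presentation_eq[OF p Q lmod_hom_comp[OF k(1) proj(2)] f _ that])
    fix l assume l: "l < n"
    have "k (p (unit_vec R n l)) = z l"
      using k(2)[OF unit_vec_closed[OF R], of l] lin_comb_unit[OF P z(1) l] by simp
    moreover have "?\<pi> (z l) = ?\<pi> (x l)"
    proof -
      have "?\<pi> (x l) = ?\<pi> (z l) \<oplus>\<^bsub>?Q\<^esub> ?\<pi> (e (y l))"
        using lmod_homD(2)[OF proj(2) z(1)[OF l] ey[OF l]] z(2)[OF l] by simp
      also have "?\<pi> (e (y l)) = \<zero>\<^bsub>?Q\<^esub>" using proj(4)[OF ey[OF l]] y(1)[OF l] by blast
      finally show ?thesis using lmod_homD(1)[OF proj(2) z(1)[OF l]] by simp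
    qed
    ultimately show "?\<pi> (k (p (unit_vec R n l))) = f (p (unit_vec R n l))" using x[of l] by simp
  qed
  obtain Z g h where Z: "Z \<in> B" "g \<in> lmod_hom R X Z" "h \<in> lmod_hom R Z P"
    "\<And>s. s \<in> S \<Longrightarrow> g s = \<zero>\<^bsub>Z\<^esub>" "\<And>x. x \<in> carrier X \<Longrightarrow> h (g x) = k x"
    by (rule lifts_throughE[OF lifts X S k(1) kS]) blast+
  show "\<exists>Z\<in>B. \<exists>g\<in>lmod_hom R X Z. \<exists>h\<in>lmod_hom R Z ?Q. (\<forall>s\<in>S. g s = \<zero>\<^bsub>Z\<^esub>) \<and> (\<forall>x\<in>carrier X. h (g x) = f x)"
    using Z(4,5) \<pi>k by (intro bexI[OF _ Z(1)] bexI[OF _ Z(2)] bexI[OF _ lmod_hom_comp[OF Z(3) proj(2)]]) simp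
qed

text \<open>
  The copy \<open>G\<close> of \<open>F\<close> is used in place of \<open>F\<close> because injectivity of \<open>PE\<close> is tested on modules
  carried by the type of \<open>PE\<close> and by that of its double character module.
\<close>

lemma envelope_lifts_through:
  fixes F :: "('r, 'f) module" and PE :: "('r, 'p) module"
  assumes env: "pure_injective_envelope R F PE e"
  defines "G \<equiv> PE\<lparr>carrier := e ` carrier F\<rparr>"
  assumes lifts: "lifts_through R B (bidual G)"
  shows "lifts_through R B PE"
proof -
  have F: "left_module R F" and pinj: "pure_injective R PE" and pure: "pure_mono R F PE e"
    and bij: "\<And>\<phi>. \<phi> \<in> lmod_hom R PE PE \<Longrightarrow> \<forall>x\<in>carrier F. \<phi> (e x) = e x \<Longrightarrow> bij_betw \<phi> (carrier PE) (carrier PE)"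
    using env unfolding pure_injective_envelope_def by blast+
  have P: "left_module R PE" using pinj by (simp add: pure_injective_def)
  note range = pure_mono_range[OF F P pure, folded G_def]
  have GG: "left_module R (bidual G)" by (rule bidual_left_module[OF range(1)])
  obtain h where h: "h \<in> lmod_hom R (bidual G) PE" "\<And>x. x \<in> carrier G \<Longrightarrow> h (evaluation G x) = x"
    using pinj range(1,3) GG evaluation_pure[OF range(1)] unfolding pure_injective_def by blast
  obtain k where k: "k \<in> lmod_hom R PE (bidual G)" "\<And>x. x \<in> carrier G \<Longrightarrow> k x = evaluation G x"
    using pure_extension_to_bidual[OF range(1) P range(4)] by blast
  let ?\<phi> = "\<lambda>x. h (k x)"
  have \<phi>: "?\<phi> \<in> lmod_hom R PE PE" by (rule lmod_hom_comp[OF k(1) h(1)])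
  have "bij_betw ?\<phi> (carrier PE) (carrier PE)"
    using h(2) k(2) lmod_homD(1)[OF range(2)] by (intro bij[OF \<phi>]) simp
  then have inj: "inj_on ?\<phi> (carrier PE)" and sur: "?\<phi> ` carrier PE = carrier PE" by (auto simp: bij_betw_def)
  have "\<exists>\<psi>\<in>lmod_hom R PE PE. \<forall>x\<in>carrier PE. \<psi> (?\<phi> x) = x"
  proof (rule hom_factor_surj[OF P P P \<phi> sur])
    show "(\<lambda>x. x) \<in> lmod_hom R PE PE" by (rule lmod_homI) simp_all
    interpret P: left_module R PE by fact
    show "x = \<zero>\<^bsub>PE\<^esub>" if "x \<in> carrier PE" "?\<phi> x = \<zero>\<^bsub>PE\<^esub>" for x
      using inj_onD[OF inj, of x "\<zero>\<^bsub>PE\<^esub>"] that lmod_hom_zero[OF P P \<phi>] by simp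
  qed
  then obtain \<psi> where \<psi>: "\<psi> \<in> lmod_hom R PE PE" "\<forall>x\<in>carrier PE. \<psi> (?\<phi> x) = x" by blast
  show ?thesis
    by (rule lifts_through_retract[OF lifts P GG k(1) lmod_hom_comp[OF h(1) \<psi>(1)]])
      (use \<psi>(2) in simp)
qed

theorem mainTheorem8:
  fixes R :: "('r, 'x) ring_scheme"
    and B :: "('r, 'b) module set"
    and F :: "('r, 'f) module"
    and PE :: "('r, 'p) module"
    and e :: "'f \<Rightarrow> 'p"
  assumes "ring R"
    and "additive_fp_subcategory R B"
    and "regular_module R \<in> lim_class R B"
    and "B_coherent R B"
    and "F \<in> lim_class R B"
    and "pure_injective_envelope R F PE e"
  shows "PE \<in> lim_class R B \<and> quotient_module PE (e ` carrier F) \<in> lim_class R B"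
proof -
  note R = assms(1) and B = assms(2) and reg = assms(3) and coh = assms(4) and env = assms(6)
  have fp: "finitely_presented R X" if "X \<in> B" for X
    using B that by (auto simp: additive_fp_subcategory_def)
  have F: "left_module R F" and P: "left_module R PE" and pure: "pure_mono R F PE e"
    using env by (simp_all add: pure_injective_envelope_def pure_injective_def)
  have eh: "e \<in> lmod_hom R F PE" and inj: "inj_on e (carrier F)" using pure by (simp_all add: pure_mono_def)
  define G where "G = PE\<lparr>carrier := e ` carrier F\<rparr>"
  note range = pure_mono_range[OF F P pure, folded G_def]
  have "\<exists>q\<in>lmod_hom R G F. \<forall>x\<in>carrier F. q (e x) = x"
  proof (rule hom_factor_surj[OF F range(1) F range(2)])
    show "e ` carrier F = carrier G" by (simp add: G_def)
    show "(\<lambda>x. x) \<in> lmod_hom R F F" by (rule lmod_homI) simp_all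
    interpret F: left_module R F by fact
    show "x = \<zero>\<^bsub>F\<^esub>" if "x \<in> carrier F" "e x = \<zero>\<^bsub>G\<^esub>" for x
      using inj_onD[OF inj, of x "\<zero>\<^bsub>F\<^esub>"] that lmod_hom_zero[OF F range(1,2)] by simp
  qed
  then obtain q where q: "q \<in> lmod_hom R G F" "\<forall>x\<in>carrier F. q (e x) = x" by blast
  have "e (q x) = x" if "x \<in> carrier G" for x using that q(2) by (auto simp: G_def)
  moreover have "lifts_through R B F" by (rule lim_class_lifts(2)[OF R fp assms(5)])
  ultimately have "lifts_through R B G"
    by (intro lifts_through_retract[OF _ range(1) F q(1) range(2)])
  then have lGG: "lifts_through R B (bidual G)" by (rule bidual_lifts_through[OF R B reg coh range(1)])
  then have lP: "lifts_through R B PE" unfolding G_def by (rule envelope_lifts_through[OF env])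
  have lQ: "lifts_through R B (quotient_module PE (e ` carrier F))"
    by (rule lifts_through_pure_quotient[OF R fp F P pure lP])
  show ?thesis
    using lim_class_criterion[OF R B reg P lP] lim_class_criterion[OF R B reg quotient_projection(1)[OF F P eh] lQ] ..
qed

end
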